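(* Let $1\le p\le q$, $n=p+q$, and let $\Lambda^{\mathrm{dom}}=(\Lambda^{\mathrm{dom}}_1>\Lambda^{\mathrm{dom}}_2>\dots>\Lambda^{\mathrm{dom}}_n)$ be a regular integral $\mathfrak g$-dominant parameter for $\mathfrak{su}(p,q)$. Then: (a) If $\Lambda^{\mathrm{dom}}_q=\Lambda^{\mathrm{dom}}_{q+1}+1$, then there exist integers $s,r$ with $1\le s\le q$ and $q+1-s\le r\le n-s$ such that $\Lambda^{\mathrm{dom}}$ is of the form $$\Lambda^{\mathrm{dom}}=(\Lambda^{\mathrm{dom}}_1,\ldots,\Lambda^{\mathrm{dom}}_{s-1};\ \Lambda^{\mathrm{dom}}_s,\Lambda^{\mathrm{dom}}_s-1,\ldots,\Lambda^{\mathrm{dom}}_s-r;\ \Lambda^{\mathrm{dom}}_{s+r+1},\ldots,\Lambda^{\mathrm{dom}}_n),$$ where $\Lambda^{\mathrm{dom}}_{s-1}\ge\Lambda^{\mathrm{dom}}_s+2$ if $s>1$, $\Lambda^{\mathrm{dom}}_{s+r+1}\le\Lambda^{\mathrm{dom}}_s-r-2$ if $n>s+r$, and $s\le q\le s+r-1$. The unitary conjugates of $\Lambda^{\mathrm{dom}}$ are exactly $$\Lambda=(\Lambda^{\mathrm{dom}}_{q+1},\Lambda^{\mathrm{dom}}_{q+2},\ldots,\Lambda^{\mathrm{dom}}_n\,|\,\Lambda^{\mathrm{dom}}_1,\ldots,\Lambda^{\mathrm{dom}}_q)$$ and $$\begin{aligned}\Lambda=(&\Lambda^{\mathrm{dom}}_s-a,\ldots,\Lambda^{\mathrm{dom}}_s-b;\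 \Lambda^{\mathrm{dom}}_s-c-1,\ldots,\Lambda^{\mathrm{dom}}_s-r;\ \Lambda^{\mathrm{dom}}_{s+r+1},\ldots,\Lambda^{\mathrm{dom}}_n\,|\\ &\Lambda^{\mathrm{dom}}_1,\ldots,\Lambda^{\mathrm{dom}}_{s-1};\ \Lambda^{\mathrm{dom}}_s,\ldots,\Lambda^{\mathrm{dom}}_s-a+1;\ \Lambda^{\mathrm{dom}}_s-b-1,\ldots,\Lambda^{\mathrm{dom}}_s-c),\end{aligned}$$ where $a,b,c$ are integers with $0\le a\le q-s$, $0\le b-a\le(s+r-1)-q$ and $c=b-a-s+q+1$. For the latter parameters, $\Lambda_{p'}=\Lambda^{\mathrm{dom}}_s-b$, $\Lambda_{n-q'+1}=\Lambda^{\mathrm{dom}}_s-b-1$, $p'=b-a+1$ and $q'=c-b$. (If $a=0$, the string $\Lambda^{\mathrm{dom}}_s,\ldots,\Lambda^{\mathrm{dom}}_s-a+1$ is empty; if $c=r$, the string $\Lambda^{\mathrm{dom}}_s-c-1,\ldots,\Lambda^{\mathrm{dom}}_s-r$ is empty.) (b) If $\Lambda^{\mathrm{dom}}_q\ne\Lambda^{\mathrm{dom}}_{q+1}+1$, then the only unitary conjugate of $\Lambda^{\mathrm{dom}}$ is $$\Lambda=(\Lambda^{\mathrm{dom}}_{q+1},\Lambda^{\mathrm{dom}}_{q+2},\ldots,\Lambda^{\mathrm{dom}}_n\,|\,\Lambda^{\mathrm{dom}}_1,\ldots,\Lambda^{\mathrm{dom}}_q).$$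
   Context: Setting: $\mathfrak g_0=\mathfrak{su}(p,q)$ with $1\le p\le q$, $n=p+q$, complexification $\mathfrak g=\mathfrak{sl}(n,\mathbb C)$, $\mathfrak k=\mathfrak s(\mathfrak{gl}(p,\mathbb C)\oplus\mathfrak{gl}(q,\mathbb C))$. Weights of the diagonal Cartan subalgebra are written as $n$-tuples (modulo adding a common constant), with a bar separating the first $p$ from the last $q$ coordinates. Positive roots are $\varepsilon_i-\varepsilon_j$, $i<j$; those with both indices $\le p$ or both $>p$ are compact, the others noncompact. $\rho=(\frac{n-1}2,\frac{n-3}2,\ldots,-\frac{n-1}2)$. For $\lambda$ $\mathfrak k$-dominant integral, $L(\lambda)$ is the irreducible highest weight $(\mathfrak g,K)$-module with highest weight $\lambda$; its parameter is $\Lambda=\lambda+\rho$, which satisfies $\Lambda_1>\dots>\Lambda_p$ and $\Lambda_{p+1}>\dots>\Lambda_n$ ($\mathfrak k$-dominant regular). $L(\lambda)$, and equivalently its parameter $\Lambda$, is called unitary if $L(\lambda)$ admits a positive definite Hermitian form for which $\mathfrak g_0$ acts by skew-Hermitian operators. $\Lambda$ is integral if $\Lambda_i-\Lambda_j\in\mathbb Z$ for all $i,j$. $\Lambda^{\mathrm{dom}}$ denotes the $\mathfrak g$-dominant representative: $\Lambda^{\mathrm{dom}}_1\ge\dots\ge\Lambda^{\mathrm{dom}}_n$. It is regular if no coordinate repeats. A unitary conjugate of $\Lambda^{\mathrm{dom}}$ is a $\mathfrak k$-dominant regular permutation of its coordinates which is unitary. For a parameter $\Lambda$, let $p'\in[1,p]$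 be maximal such that $\Lambda_1,\ldots,\Lambda_{p'}$ decrease by exactly one at each step, and $q'\in[1,q]$ maximal such that $\Lambda_{n-q'+1},\ldots,\Lambda_n$ decrease by exactly one at each step. The known description of unitarity used by the paper: an integral parameter $\Lambda$ is unitary if and only if $\Lambda_1-\Lambda_n\le p'+q'-1$, equivalently $\Lambda_{p'}-\Lambda_{n-q'+1}\le1$. A string is a sequence of numbers decreasing by one. *)

theory Defs
  imports
    Complex_Main
    "HOL-Library.Function_Algebras"
    "HOL-Library.Multiset"
    "Jordan_Normal_Form.Matrix"
begin

section \<open>The Lie algebras\<close>

text \<open>Matrices are indexed from 0, so the first block of an \<open>n\<close>-by-\<open>n\<close> matrix, \<open>n = p + q\<close>,
  consists of the indices below \<open>p\<close>.\<close>

definition sl :: "nat \<Rightarrow> complex mat set" where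
  "sl n = {X \<in> carrier_mat n n. (\<Sum>i<n. X $$ (i, i)) = 0}"

definition root_vector :: "nat \<Rightarrow> nat \<Rightarrow> nat \<Rightarrow> complex mat" where
  "root_vector n i j = mat n n (\<lambda>(k, l). if k = i \<and> l = j then 1 else 0)"

definition k_alg :: "nat \<Rightarrow> nat \<Rightarrow> complex mat set" where
  "k_alg p q = {X \<in> sl (p + q). \<forall>i < p + q. \<forall>j < p + q. (i < p) \<noteq> (j < p) \<longrightarrow> X $$ (i, j) = 0}"

definition signature_mat :: "nat \<Rightarrow> nat \<Rightarrow> complex mat" where
  "signature_mat p q = mat_diag (p + q) (\<lambda>i. if i < p then 1 else - 1)"

definition su :: "nat \<Rightarrow> nat \<Rightarrow> complex mat set" where
  "su p q = {X \<in> sl (p + q).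
     map_mat cnj (transpose_mat X) * signature_mat p q + signature_mat p q * X
       = 0\<^sub>m (p + q) (p + q)}"


section \<open>Highest weight modules\<close>

text \<open>A representation of \<open>sl(n,C)\<close> on the complex subspace \<open>V\<close> of the ambient space; the values
  of \<open>act\<close> outside \<open>sl n\<close> and \<open>V\<close> are irrelevant.\<close>

locale sl_module = vector_space scale
  for scale :: "complex \<Rightarrow> 'v::ab_group_add \<Rightarrow> 'v" +
  fixes n :: nat and V :: "'v set" and act :: "complex mat \<Rightarrow> 'v \<Rightarrow> 'v"
  assumes subspace_V: "subspace V"
    and act_closed: "\<And>X v. X \<in> sl n \<Longrightarrow> v \<in> V \<Longrightarrow> act X v \<in> V"
    and act_add: "\<And>X v w. X \<in> sl n \<Longrightarrow> v \<in> V \<Longrightarrow> w \<in> V \<Longrightarrow> act X (v + w) = act X v + act X w"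
    and act_scale: "\<And>X c v. X \<in> sl n \<Longrightarrow> v \<in> V \<Longrightarrow> act X (scale c v) = scale c (act X v)"
    and add_act: "\<And>X Y v. X \<in> sl n \<Longrightarrow> Y \<in> sl n \<Longrightarrow> v \<in> V \<Longrightarrow> act (X + Y) v = act X v + act Y v"
    and scale_act: "\<And>X c v. X \<in> sl n \<Longrightarrow> v \<in> V \<Longrightarrow> act (c \<cdot>\<^sub>m X) v = scale c (act X v)"
    and act_bracket: "\<And>X Y v. X \<in> sl n \<Longrightarrow> Y \<in> sl n \<Longrightarrow> v \<in> V \<Longrightarrow>
          act (X * Y - Y * X) v = act X (act Y v) - act Y (act X v)"
begin

definition stable :: "complex mat set \<Rightarrow> 'v set \<Rightarrow> bool" where
  "stable A W \<longleftrightarrow> subspace W \<and> W \<subseteq> V \<and> (\<forall>X \<in> A. \<forall>w \<in> W. act X w \<in> W)"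

definition irreducible_module :: bool where
  "irreducible_module \<longleftrightarrow> V \<noteq> {0} \<and> (\<forall>W. stable (sl n) W \<longrightarrow> W = {0} \<or> W = V)"

definition highest_weight_vector :: "real list \<Rightarrow> 'v \<Rightarrow> bool" where
  "highest_weight_vector lam v \<longleftrightarrow> v \<in> V \<and> v \<noteq> 0 \<and>
     (\<forall>i j. i < j \<and> j < n \<longrightarrow> act (root_vector n i j) v = 0) \<and>
     (\<forall>H \<in> sl n. diagonal_mat H \<longrightarrow>
        act H v = scale (\<Sum>i<n. complex_of_real (lam ! i) * H $$ (i, i)) v)"

text \<open>Local finiteness under the complexified Lie algebra of \<open>K = S(U(p) \<times> U(q))\<close>. As \<open>K\<close> is
  connected, this is the infinitesimal form of being a \<open>(g,K)\<close>-module: a compatible action of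
  \<open>K\<close> is determined by the one of its Lie algebra, and it exists for the weights with
  integral coordinate differences.\<close>

definition locally_k_finite :: "nat \<Rightarrow> bool" where
  "locally_k_finite p \<longleftrightarrow> (\<forall>v \<in> V. \<exists>W. v \<in> W \<and> stable (k_alg p (n - p)) W \<and>
     (\<exists>B. finite B \<and> W \<subseteq> span B))"

definition unitary_form :: "nat \<Rightarrow> ('v \<Rightarrow> 'v \<Rightarrow> complex) \<Rightarrow> bool" where
  "unitary_form p h \<longleftrightarrow>
     (\<forall>u \<in> V. \<forall>v \<in> V. \<forall>w \<in> V. h (u + v) w = h u w + h v w) \<and>
     (\<forall>c. \<forall>v \<in> V. \<forall>w \<in> V. h (scale c v) w = c * h v w) \<and>
     (\<forall>v \<in> V. \<forall>w \<in> V. h w v = cnj (h v w)) \<and>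
     (\<forall>v \<in> V. v \<noteq> 0 \<longrightarrow> Re (h v v) > 0) \<and>
     (\<forall>X \<in> su p (n - p). \<forall>v \<in> V. \<forall>w \<in> V. h (act X v) w = - h v (act X w))"

end

text \<open>\<open>V\<close> with the action \<open>act\<close> is a copy of \<open>L(lam)\<close>, which is unique up to isomorphism.\<close>

definition is_L :: "(complex \<Rightarrow> 'v::ab_group_add \<Rightarrow> 'v) \<Rightarrow> nat \<Rightarrow> nat \<Rightarrow> real list \<Rightarrow> 'v set
    \<Rightarrow> (complex mat \<Rightarrow> 'v \<Rightarrow> 'v) \<Rightarrow> bool" where
  "is_L scale p q lam V act \<longleftrightarrow>
     sl_module scale (p + q) V act \<and>
     sl_module.irreducible_module scale (p + q) V act \<and>
     sl_module.locally_k_finite scale (p + q) V act p \<and>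
     (\<exists>v. sl_module.highest_weight_vector scale (p + q) V act lam v)"


section \<open>Parameters\<close>

text \<open>A parameter is the list of its \<open>n = p + q\<close> coordinates, the bar being after the first \<open>p\<close>;
  \<open>coord\<close> is the access with indices starting at 1.\<close>

definition coord :: "real list \<Rightarrow> nat \<Rightarrow> real" where
  "coord \<Lambda> i = \<Lambda> ! (i - 1)"

definition rho :: "nat \<Rightarrow> real list" where
  "rho n = map (\<lambda>i. (real n - 1) / 2 - real i) [0..<n]"

definition integral_param :: "real list \<Rightarrow> bool" where
  "integral_param \<Lambda> \<longleftrightarrow> (\<forall>x \<in> set \<Lambda>. \<forall>y \<in> set \<Lambda>. x - y \<in> \<int>)"

definition k_dominant_regular :: "nat \<Rightarrow> real list \<Rightarrow> bool" where
  "k_dominant_regular p \<Lambda> \<longleftrightarrow> sorted_wrt (>) (take p \<Lambda>) \<and> sorted_wrt (>) (drop p \<Lambda>)"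

definition g_dominant_regular :: "real list \<Rightarrow> bool" where
  "g_dominant_regular \<Lambda> \<longleftrightarrow> sorted_wrt (>) \<Lambda>"

definition seq_scale :: "complex \<Rightarrow> (nat \<Rightarrow> complex) \<Rightarrow> nat \<Rightarrow> complex" where
  "seq_scale c v = (\<lambda>i. c * v i)"

lemma vector_space_seq_scale: "vector_space seq_scale"
  by unfold_locales (auto simp: seq_scale_def fun_eq_iff algebra_simps)

text \<open>Every \<open>L(lam)\<close> has countable dimension, hence is isomorphic to a module on a subspace of the
  space of complex sequences. So nothing is lost by fixing this ambient space, and by uniqueness of
  \<open>L(lam)\<close> it does not matter which copy is chosen.\<close>

definition unitary_param :: "nat \<Rightarrow> nat \<Rightarrow> real list \<Rightarrow> bool" where
  "unitary_param p q \<Lambda> \<longleftrightarrow>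
     (\<exists>V act. is_L seq_scale p q (map2 (-) \<Lambda> (rho (p + q))) V act \<and>
        (\<exists>h. sl_module.unitary_form seq_scale (p + q) V act p h))"

definition unitary_conjugates :: "nat \<Rightarrow> nat \<Rightarrow> real list \<Rightarrow> real list set" where
  "unitary_conjugates p q D =
     {\<Lambda>. mset \<Lambda> = mset D \<and> k_dominant_regular p \<Lambda> \<and> unitary_param p q \<Lambda>}"

definition p_prime :: "nat \<Rightarrow> real list \<Rightarrow> nat" where
  "p_prime p \<Lambda> = Max {k \<in> {1..p}. \<forall>i \<in> {1..<k}. coord \<Lambda> (i + 1) = coord \<Lambda> i - 1}"

definition q_prime :: "nat \<Rightarrow> nat \<Rightarrow> real list \<Rightarrow> nat" where
  "q_prime p q \<Lambda> = Max {k \<in> {1..q}.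
     \<forall>i \<in> {p + q - k + 1..<p + q}. coord \<Lambda> (i + 1) = coord \<Lambda> i - 1}"


section \<open>The shapes of the conjugates\<close>

text \<open>\<open>segment D i j\<close> is \<open>D\<^sub>i, \<dots>, D\<^sub>j\<close> and \<open>down x i j\<close> is the string \<open>x - i, x - i - 1, \<dots>, x - j\<close>;
  both are empty if \<open>j < i\<close>.\<close>

definition segment :: "real list \<Rightarrow> nat \<Rightarrow> nat \<Rightarrow> real list" where
  "segment D i j = map (coord D) [i..<j + 1]"

definition down :: "real \<Rightarrow> int \<Rightarrow> int \<Rightarrow> real list" where
  "down x i j = map (\<lambda>k. x - of_int k) [i..j]"

definition antidominant_conjugate :: "nat \<Rightarrow> nat \<Rightarrow> real list \<Rightarrow> real list" where
  "antidominant_conjugate p q D = segment D (q + 1) (p + q) @ segment D 1 q"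

definition string_conjugate ::
  "nat \<Rightarrow> nat \<Rightarrow> real list \<Rightarrow> nat \<Rightarrow> nat \<Rightarrow> int \<Rightarrow> int \<Rightarrow> int \<Rightarrow> real list" where
  "string_conjugate p q D s r a b c =
     (down (coord D s) a b @ down (coord D s) (c + 1) (int r) @ segment D (s + r + 1) (p + q)) @
     (segment D 1 (s - 1) @ down (coord D s) 0 (a - 1) @ down (coord D s) (b + 1) c)"

definition admissible :: "nat \<Rightarrow> nat \<Rightarrow> nat \<Rightarrow> int \<Rightarrow> int \<Rightarrow> int \<Rightarrow> bool" where
  "admissible q s r a b c \<longleftrightarrow>
     0 \<le> a \<and> a \<le> int q - int s \<and>
     0 \<le> b - a \<and> b - a \<le> (int s + int r - 1) - int q \<and>
     c = b - a - int s + int q + 1"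

end

theory Submission
  imports
    Defs
    "Jordan_Normal_Form.Determinant"
    "HOL-Library.Poly_Mapping"
    "HOL-Library.Multiset_Order"
    "HOL-Library.Countable"
begin

text \<open>An integral parameter \<open>\<Lambda>\<close> with pairwise different coordinates is unitary iff
  \<open>\<Lambda>\<^sub>i - \<Lambda>\<^sub>j \<le> 1\<close>, where \<open>i = p'\<close> and \<open>j = n - q' + 1\<close>; given this, the theorem is a matter of
  sorting the coordinates of \<open>\<Lambda>\<close>.

  Necessity: let \<open>F\<close> be the \<open>k\<close>-module generated by the highest weight vector. In \<open>p\<^sup>- \<otimes> F\<close> there is
  a \<open>k\<close>-highest weight vector of weight \<open>\<lambda> - (\<epsilon>\<^sub>i - \<epsilon>\<^sub>j)\<close>, and the norm of its image in \<open>L(\<lambda>)\<close> is a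
  positive multiple of \<open>1 - (\<Lambda>\<^sub>i - \<Lambda>\<^sub>j)\<close>. For each of the two blocks that vector comes from the matrix \<open>M\<close> of
  generators of \<open>gl(m)\<close>, acting on families of vectors: a product of factors \<open>M - c\<close> turns the family
  with the single entry \<open>v\<close> into an eigenvector of \<open>M\<close> whose first entry is a nonzero multiple of \<open>v\<close>.

  Sufficiency: put \<open>k = \<lambda>\<^sub>n - \<lambda>\<^sub>1\<close>. On the polynomials in the entries of an \<open>n \<times> k\<close> matrix, with
  the Fischer inner product, \<open>su(p,q)\<close> acts by the oscillator representation. The bound says
  exactly that there is room for a highest weight vector of weight \<open>\<lambda>\<close> which is a product of minors
  of the first \<open>p\<close> rows, using the first columns, and minors of the last \<open>q\<close> rows, using the last
  columns.\<close>

section \<open>Eigenvectors of the characteristic matrix of \<open>gl(m)\<close>\<close>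

text \<open>The module in the necessity part is an arbitrary irreducible one, and
  \<open>p^- \<otimes> F\<close> is not decomposed; the test vector has to be built from
  \<open>v\<close> alone. Up to sign, \<open>M\<close> is the split Casimir element on
  \<open>V\<close> tensored with the dual standard module, and its roots are the rho-shifted
  weights. The danger is that omitting one root still gives 0. The first entry of the result turns
  out to be \<open>v\<close> times the product of \<open>eig 0 - eig b - 1\<close> over
  \<open>b > 0\<close>, and this decides which indices are tested: \<open>i = p'\<close> and
  \<open>j = n - q' + 1\<close> are the inner ends of the two strings, so all coordinates still to
  be compared with them are at distance at least 2. The two eigenvalues then add up to
  \<open>\<Lambda>\<^sub>i - \<Lambda>\<^sub>j - 1\<close>. In the other direction irreducibility is
  read off from the positive form: a submodule without the highest weight vector is orthogonal to
  everything which that vector generates. In the combinatorial part the strings act as obstacles: a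
  string occupies all integers between its ends, so no other coordinate of a regular parameter lies
  there.\<close>

locale gl_action = vector_space scale
  for scale :: "complex \<Rightarrow> 'v::ab_group_add \<Rightarrow> 'v" +
  fixes V :: "'v set" and m :: nat and F :: "nat \<Rightarrow> nat \<Rightarrow> 'v \<Rightarrow> 'v"
  assumes sub: "subspace V"
    and closed: "\<And>a b v. a < m \<Longrightarrow> b < m \<Longrightarrow> v \<in> V \<Longrightarrow> F a b v \<in> V"
    and add: "\<And>a b v w. a < m \<Longrightarrow> b < m \<Longrightarrow> v \<in> V \<Longrightarrow> w \<in> V \<Longrightarrow> F a b (v + w) = F a b v + F a b w"
    and scal: "\<And>a b c v. a < m \<Longrightarrow> b < m \<Longrightarrow> v \<in> V \<Longrightarrow> F a b (scale c v) = scale c (F a b v)"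
    and bracket: "\<And>a b c d v. a < m \<Longrightarrow> b < m \<Longrightarrow> c < m \<Longrightarrow> d < m \<Longrightarrow> v \<in> V \<Longrightarrow>
      F a b (F c d v) - F c d (F a b v) = (if b = c then F a d v else 0) - (if a = d then F c b v else 0)"
begin

lemma zero: "a < m \<Longrightarrow> b < m \<Longrightarrow> F a b 0 = 0"
  using scal[of a b 0 0] subspace_0[OF sub] by simp

lemma neg: "a < m \<Longrightarrow> b < m \<Longrightarrow> v \<in> V \<Longrightarrow> F a b (- v) = - F a b v"
  using scal[of a b v "-1"] by simp

lemma diff: "a < m \<Longrightarrow> b < m \<Longrightarrow> v \<in> V \<Longrightarrow> w \<in> V \<Longrightarrow> F a b (v - w) = F a b v - F a b w"
  using add[of a b v "- w"] neg[of a b w] subspace_neg[OF sub] by simp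

lemma sums: "a < m \<Longrightarrow> b < m \<Longrightarrow> (\<And>i. i \<in> I \<Longrightarrow> f i \<in> V) \<Longrightarrow> F a b (\<Sum>i\<in>I. f i) = (\<Sum>i\<in>I. F a b (f i))"
proof (induction I rule: infinite_finite_induct)
  case (insert x I)
  then show ?case using subspace_sum[OF sub, of I f] by (simp add: add)
qed (simp_all add: zero)

text \<open>A family \<open>f\<close> encodes the sum of \<open>f a\<close> tensored with the dual
  basis vector of index \<open>a\<close>, an element of \<open>V\<close> tensored with the dual of
  the standard module. Entries from \<open>m\<close> on are 0, so that equal elements are equal
  functions.\<close>

definition families :: "(nat \<Rightarrow> 'v) set" where
  "families = {f. (\<forall>a<m. f a \<in> V) \<and> (\<forall>a\<ge>m. f a = 0)}"

definition step :: "complex \<Rightarrow> (nat \<Rightarrow> 'v) \<Rightarrow> nat \<Rightarrow> 'v" where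
  "step c f = (\<lambda>a. if a < m then (\<Sum>b<m. F a b (f b)) - scale c (f a) else 0)"

text \<open>The action of a generator on the tensor product. The subtracted term comes from the dual
  factor, where the generator sends the dual basis vector \<open>i\<close> to minus the dual basis
  vector \<open>j\<close>.\<close>

definition diagonal :: "nat \<Rightarrow> nat \<Rightarrow> (nat \<Rightarrow> 'v) \<Rightarrow> nat \<Rightarrow> 'v" where
  "diagonal i j f = (\<lambda>c. if c < m then F i j (f c) - (if c = j then f i else 0) else 0)"

lemma families_V: "f \<in> families \<Longrightarrow> f a \<in> V"
  using subspace_0[OF sub] by (cases "a < m") (auto simp: families_def)

lemma step_families: "f \<in> families \<Longrightarrow> step c f \<in> families"
  unfolding families_def step_def
  by (auto intro!: subspace_diff[OF sub] subspace_sum[OF sub] subspace_scale[OF sub] closed)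

lemma diagonal_families: "i < m \<Longrightarrow> j < m \<Longrightarrow> f \<in> families \<Longrightarrow> diagonal i j f \<in> families"
  unfolding families_def diagonal_def
  by (auto intro!: subspace_diff[OF sub] closed)

lemma step_sum:
  assumes "\<And>i. i \<in> I \<Longrightarrow> f i \<in> families"
  shows "step c (\<lambda>a. \<Sum>i\<in>I. f i a) = (\<lambda>a. \<Sum>i\<in>I. step c (f i) a)"
proof
  fix a
  show "step c (\<lambda>a. \<Sum>i\<in>I. f i a) a = (\<Sum>i\<in>I. step c (f i) a)"
  proof (cases "a < m")
    case True
    have "(\<Sum>b<m. F a b (\<Sum>i\<in>I. f i b)) = (\<Sum>b<m. \<Sum>i\<in>I. F a b (f i b))"
      using assms True by (intro sum.cong refl sums) (auto intro: families_V)
    also have "\<dots> = (\<Sum>i\<in>I. \<Sum>b<m. F a b (f i b))" by (rule sum.swap)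
    finally show ?thesis
      using True by (simp add: step_def sum_subtractf scale_sum_right)
  qed (simp add: step_def)
qed

lemma step_neg: "f \<in> families \<Longrightarrow> step c (\<lambda>a. - f a) = (\<lambda>a. - step c f a)"
  by (auto simp: step_def fun_eq_iff neg families_V sum_negf)

lemma diagonal_zero: "i < m \<Longrightarrow> j < m \<Longrightarrow> diagonal i j (\<lambda>a. 0) = (\<lambda>a. 0)"
  by (auto simp: diagonal_def fun_eq_iff zero)

lemma step_zero: "step c (\<lambda>a. 0) = (\<lambda>a. 0)"
  by (auto simp: step_def fun_eq_iff zero)

lemma step_commute:
  assumes "f \<in> families"
  shows "step c (step d f) = step d (step c f)"
proof
  fix a
  have V: "(\<Sum>b<m. F a' b (f b)) \<in> V" if "a' < m" for a'
    using that assms by (auto intro!: subspace_sum[OF sub] closed simp: families_V)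
  have "F a b ((\<Sum>b'<m. F b b' (f b')) - scale e (f b)) = F a b (\<Sum>b'<m. F b b' (f b')) - scale e (F a b (f b))"
    if "a < m" "b < m" for b e
    using that assms V by (simp add: diff scal families_V subspace_scale[OF sub])
  then show "step c (step d f) a = step d (step c f) a"
    by (simp add: step_def sum_subtractf scale_sum_right[symmetric] scale_right_diff_distrib mult.commute)
qed

text \<open>The matrix \<open>M\<close> is minus the split Casimir element of the tensor product,
  hence a module map. In coordinates, the commutators of \<open>F i j\<close> with a row of
  \<open>M\<close> are exactly the correction terms of \<open>diagonal\<close>.\<close>

lemma step_diagonal:
  assumes f: "f \<in> families" and ij: "i < m" "j < m"
  shows "step d (diagonal i j f) = diagonal i j (step d f)"
proof
  fix a
  show "step d (diagonal i j f) a = diagonal i j (step d f) a"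
  proof (cases "a < m")
    case a: True
    have V: "(\<Sum>b<m. F a b (f b)) \<in> V" if "a < m" for a
      using that assms by (auto intro!: subspace_sum[OF sub] closed simp: families_V)
    have "(\<Sum>c<m. F a c (diagonal i j f c))
        = (\<Sum>c<m. F a c (F i j (f c)) - (if c = j then F a c (f i) else 0))"
      using a ij f by (intro sum.cong refl) (auto simp: diagonal_def diff closed families_V)
    also have "\<dots> = (\<Sum>c<m. F a c (F i j (f c))) - F a j (f i)"
      using ij by (simp add: sum_subtractf sum.delta)
    finally have L: "(\<Sum>c<m. F a c (diagonal i j f c)) = (\<Sum>c<m. F a c (F i j (f c))) - F a j (f i)" .
    have "F i j (\<Sum>c<m. F a c (f c)) = (\<Sum>c<m. F i j (F a c (f c)))"
      using a ij f by (intro sums) (auto intro: closed families_V)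
    also have "\<dots> = (\<Sum>c<m. F a c (F i j (f c)) + (if j = a then F i c (f c) else 0) - (if i = c then F a j (f c) else 0))"
    proof (intro sum.cong refl)
      fix c assume "c \<in> {..<m}"
      then show "F i j (F a c (f c)) = F a c (F i j (f c)) + (if j = a then F i c (f c) else 0) - (if i = c then F a j (f c) else 0)"
        using bracket[of i j a c "f c"] a ij f by (auto simp: families_V algebra_simps)
    qed
    also have "\<dots> = (\<Sum>c<m. F a c (F i j (f c))) + (if j = a then \<Sum>c<m. F i c (f c) else 0) - F a j (f i)"
      using ij by (simp add: sum_subtractf sum.distrib)
    finally have R: "F i j (\<Sum>c<m. F a c (f c)) = (\<Sum>c<m. F a c (F i j (f c))) + (if j = a then \<Sum>c<m. F i c (f c) else 0) - F a j (f i)" .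
    have "step d (diagonal i j f) a = (\<Sum>c<m. F a c (diagonal i j f c)) - scale d (diagonal i j f a)"
      using a by (simp add: step_def)
    then show ?thesis
      unfolding L using a ij f V
      by (simp add: step_def diagonal_def diff scal R families_V subspace_scale[OF sub] scale_right_diff_distrib)
  qed (simp add: step_def diagonal_def)
qed

abbreviation steps :: "complex list \<Rightarrow> (nat \<Rightarrow> 'v) \<Rightarrow> nat \<Rightarrow> 'v" where
  "steps cs f \<equiv> foldr step cs f"

lemma steps_families: "f \<in> families \<Longrightarrow> steps cs f \<in> families"
  by (induction cs) (auto intro: step_families)

lemma steps_diagonal: "f \<in> families \<Longrightarrow> i < m \<Longrightarrow> j < m \<Longrightarrow> steps cs (diagonal i j f) = diagonal i j (steps cs f)"
  by (induction cs) (auto simp: step_diagonal steps_families)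

lemma steps_commute: "f \<in> families \<Longrightarrow> steps cs (step d f) = step d (steps cs f)"
  by (induction cs) (simp_all add: step_commute steps_families)

lemma steps_sum:
  "(\<And>i. i \<in> I \<Longrightarrow> f i \<in> families) \<Longrightarrow> steps cs (\<lambda>a. \<Sum>i\<in>I. f i a) = (\<lambda>a. \<Sum>i\<in>I. steps cs (f i) a)"
  by (induction cs) (simp_all add: step_sum steps_families)

lemma steps_neg: "f \<in> families \<Longrightarrow> steps cs (\<lambda>a. - f a) = (\<lambda>a. - steps cs f a)"
  by (induction cs) (simp_all add: step_neg steps_families)

end

locale gl_highest_weight = gl_action scale V m F
  for scale :: "complex \<Rightarrow> 'v::ab_group_add \<Rightarrow> 'v" and V m F +
  fixes v :: 'v and l :: "nat \<Rightarrow> complex"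
  assumes v: "v \<in> V"
    and raise: "\<And>a b. a < b \<Longrightarrow> b < m \<Longrightarrow> F a b v = 0"
    and weight: "\<And>a. a < m \<Longrightarrow> F a a v = scale (l a) v"
begin

text \<open>The roots of the characteristic identity of \<open>gl(m)\<close>: the weight of
  \<open>v\<close> shifted by the half-sum of the positive roots, up to a constant common to all
  \<open>k\<close>.\<close>

definition eig :: "nat \<Rightarrow> complex" where
  "eig k = l k + of_nat (m - 1 - k)"

definition base :: "nat \<Rightarrow> nat \<Rightarrow> 'v" where
  "base k = (\<lambda>a. if a = k then v else 0)"

lemma base_families: "k < m \<Longrightarrow> base k \<in> families"
  using v by (auto simp: base_def families_def subspace_0[OF sub])

lemma diagonal_base:
  "j < m \<Longrightarrow> k < m \<Longrightarrow> diagonal j k (base j) = (\<lambda>c. (if c = j then F j k v else 0) - (if c = k then v else 0))"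
  by (auto simp: diagonal_def base_def fun_eq_iff zero)

text \<open>Modulo what the later families \<open>base j\<close> generate, \<open>base k\<close> is
  an eigenvector of \<open>M\<close>. The shift \<open>m - 1 - k\<close> counts the indices
  \<open>j > k\<close>, each of which contributes \<open>- v\<close> to entry
  \<open>k\<close>.\<close>

lemma step_base:
  assumes k: "k < m"
  shows "step (eig k) (base k) = (\<lambda>a. \<Sum>j\<in>{k<..<m}. diagonal j k (base j) a)"
proof
  fix a
  show "step (eig k) (base k) a = (\<Sum>j\<in>{k<..<m}. diagonal j k (base j) a)"
  proof (cases "a < m")
    case a: True
    have "(\<Sum>b<m. F a b (base k b)) = (\<Sum>b<m. if b = k then F a k v else 0)"
      using a by (intro sum.cong) (auto simp: base_def zero)
    then have 1: "(\<Sum>b<m. F a b (base k b)) = F a k v" using k by simp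
    have "(\<Sum>j\<in>{k<..<m}. diagonal j k (base j) a)
        = (\<Sum>j\<in>{k<..<m}. (if a = j then F j k v else 0) - (if a = k then v else 0))"
      using k by (intro sum.cong refl) (simp add: diagonal_base)
    also have "\<dots> = (if k < a then F a k v else 0) - (if a = k then scale (of_nat (m - 1 - k)) v else 0)"
      using a by (simp add: sum_subtractf sum_constant_scale)
    finally show ?thesis
      using a k 1 raise[of a k] weight[of k]
      by (cases a k rule: linorder_cases) (auto simp: step_def base_def eig_def scale_left_distrib)
  qed (auto simp: step_def diagonal_def)
qed

text \<open>The characteristic identity, by triangularity: the factor of \<open>k\<close> sends
  \<open>base k\<close> to diagonal images of later \<open>base j\<close>, and the remaining factors
  commute with the diagonal action and kill those by induction.\<close>

lemma steps_kill:
  assumes "k \<le> m"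
  shows "\<forall>j. k \<le> j \<and> j < m \<longrightarrow> steps (map eig [k..<m]) (base j) = (\<lambda>a. 0)"
  using assms
proof (induction rule: inc_induct)
  case (step k)
  have split: "map eig [k..<m] = eig k # map eig [Suc k..<m]"
    using step.hyps by (simp add: upt_conv_Cons)
  show ?case
  proof (intro allI impI)
    fix j assume j: "k \<le> j \<and> j < m"
    show "steps (map eig [k..<m]) (base j) = (\<lambda>a. 0)"
    proof (cases "j = k")
      case True
      have "steps (map eig [k..<m]) (base k) = steps (map eig [Suc k..<m]) (step (eig k) (base k))"
        using step.hyps by (simp add: split steps_commute base_families)
      also have "\<dots> = steps (map eig [Suc k..<m]) (\<lambda>a. \<Sum>j\<in>{k<..<m}. diagonal j k (base j) a)"
        using step.hyps by (simp add: step_base)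
      also have "\<dots> = (\<lambda>a. \<Sum>j\<in>{k<..<m}. steps (map eig [Suc k..<m]) (diagonal j k (base j)) a)"
        using step.hyps by (intro steps_sum) (auto intro!: diagonal_families base_families)
      also have "\<dots> = (\<lambda>a. \<Sum>j\<in>{k<..<m}. 0)"
        using step.hyps step.IH
        by (intro ext sum.cong refl) (simp add: steps_diagonal base_families diagonal_zero)
      finally show ?thesis using True by simp
    qed (use j step.IH in \<open>simp add: split step_zero\<close>)
  qed
qed auto

primrec diag_coeff :: "complex list \<Rightarrow> nat \<Rightarrow> complex" where
  "diag_coeff [] k = 1"
| "diag_coeff (c # cs) k = (eig k - c) * diag_coeff cs k - (\<Sum>j\<in>{k<..<m}. diag_coeff cs j)"

text \<open>Since \<open>F k j\<close> kills \<open>v\<close>, raising sends \<open>base k\<close>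
  to minus \<open>base j\<close>. The relation survives \<open>steps\<close>, which commute with the
  diagonal action.\<close>

lemma steps_raise:
  assumes "k < j" "j < m" "c < m"
  shows "F k j (steps cs (base k) c) = (if c = j then steps cs (base k) k else 0) - steps cs (base j) c"
proof -
  have "diagonal k j (base k) = (\<lambda>c. - base j c)"
    unfolding diagonal_base[OF less_trans[OF assms(1,2)] assms(2)] using assms by (auto simp: raise base_def)
  then have "diagonal k j (steps cs (base k)) = (\<lambda>c. - steps cs (base j) c)"
    using steps_diagonal[of "base k" k j cs] assms by (simp add: base_families steps_neg)
  then have "diagonal k j (steps cs (base k)) c = - steps cs (base j) c" by simp
  then show ?thesis using assms by (auto simp: diagonal_def algebra_simps)
qed

text \<open>The other entries need not be known: by \<open>steps_raise\<close> those before
  \<open>k\<close> vanish, and \<open>F k j\<close> takes the entry at a later \<open>j\<close> back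
  to a multiple of \<open>v\<close>. This closes the recursion on the diagonal entries.\<close>

lemma steps_base_diag: "k < m \<Longrightarrow> steps cs (base k) k = scale (diag_coeff cs k) v"
proof (induction cs arbitrary: k)
  case (Cons c cs)
  define f where "f = steps cs (base k)"
  have f: "f \<in> families" using Cons.prems by (simp add: f_def steps_families base_families)
  have low: "f j = 0" if "j < k" for j
    using steps_raise[OF that, of j cs] Cons that v raise[OF that]
    by (simp add: f_def scal)
  have up: "F k j (f j) = scale (diag_coeff cs k - diag_coeff cs j) v" if "k < j" "j < m" for j
    using steps_raise[OF that, of j cs] Cons that by (simp add: f_def scale_left_diff_distrib)
  have "(\<Sum>b<m. F k b (f b)) = (\<Sum>b\<in>{k}\<union>{k<..<m}. F k b (f b))"
    using Cons.prems low by (intro sum.mono_neutral_right) (force simp: zero not_less le_less)+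
  also have "\<dots> = F k k (f k) + (\<Sum>b\<in>{k<..<m}. F k b (f b))"
    by simp
  also have "\<dots> = scale (l k * diag_coeff cs k) v + (\<Sum>b\<in>{k<..<m}. scale (diag_coeff cs k - diag_coeff cs b) v)"
    using Cons v up weight by (simp add: f_def scal mult.commute)
  also have "\<dots> = scale (l k * diag_coeff cs k + (\<Sum>b\<in>{k<..<m}. diag_coeff cs k - diag_coeff cs b)) v"
    by (simp add: scale_left_distrib scale_sum_left)
  finally have "(\<Sum>b<m. F k b (f b)) = scale (eig k * diag_coeff cs k - (\<Sum>j\<in>{k<..<m}. diag_coeff cs j)) v"
    by (simp add: sum_subtractf eig_def algebra_simps)
  moreover have "steps (c # cs) (base k) k = (\<Sum>b<m. F k b (f b)) - scale c (f k)"
    using Cons.prems by (simp add: step_def f_def)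
  ultimately show ?case
    using Cons by (simp add: f_def left_diff_distrib' scale_left_diff_distrib del: foldr.simps)
qed (simp add: base_def)

lemma steps_stable:
  assumes "subspace S" "v \<in> S" "\<And>a b u. a < m \<Longrightarrow> b < m \<Longrightarrow> u \<in> S \<Longrightarrow> F a b u \<in> S"
  shows "steps cs (base k) a \<in> S"
proof (induction cs arbitrary: a)
  case (Cons c cs)
  then show ?case using assms
    by (auto simp: step_def intro!: subspace_diff subspace_sum subspace_scale subspace_0)
qed (use assms in \<open>auto simp: base_def subspace_0\<close>)

text \<open>The \<open>diag_coeff\<close> obey a triangular linear recursion; pairing them with a left eigenvector
  \<open>y\<close> of its matrix turns the recursion into multiplication by \<open>eig 0 - c\<close>.\<close>

lemma diag_coeff_nonzero:
  assumes m: "0 < m" and ne: "\<And>b. 0 < b \<Longrightarrow> b < m \<Longrightarrow> eig 0 \<noteq> eig b \<and> eig 0 - eig b \<noteq> 1"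
  shows "diag_coeff (map eig [1..<m]) 0 \<noteq> 0"
proof -
  \<comment> \<open>The eigenvector equation with \<open>y 0 = 1\<close> makes the partial sums of
    \<open>y\<close> multiplicative; \<open>S j\<close> is the sum of
    \<open>y 0, \<dots>, y j\<close>. A factor of \<open>S\<close> vanishes only if
    \<open>eig 0 - eig i = 1\<close>.\<close>
  define S where "S j = (\<Prod>i\<in>{1..j}. 1 + 1 / (eig i - eig 0))" for j
  define y where "y j = (if j = 0 then 1 else S j - S (j - 1))" for j
  have ySum: "(\<Sum>k<j. y k) = S (j - 1)" if "j > 0" for j
    using that
  proof (induction j)
    case (Suc j)
    then show ?case by (cases "j = 0") (auto simp: y_def S_def)
  qed simp
  have y: "(eig j - eig 0) * y j = (\<Sum>k<j. y k)" if "j < m" for j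
  proof (cases "j = 0")
    case False
    then obtain i where i: "j = Suc i" by (cases j) auto
    have "y j = S i * (1 / (eig j - eig 0))"
      by (simp add: y_def i S_def algebra_simps)
    then show ?thesis using ySum[of j] ne[of j] False that i by auto
  qed simp
  have key: "(\<Sum>k<m. y k * diag_coeff (c # cs) k) = (eig 0 - c) * (\<Sum>k<m. y k * diag_coeff cs k)" for c cs
  proof -
    have "(\<Sum>k<m. y k * (\<Sum>j\<in>{k<..<m}. diag_coeff cs j)) = (\<Sum>k<m. \<Sum>j<m. if k < j then y k * diag_coeff cs j else 0)"
      unfolding sum_distrib_left by (intro sum.cong refl sum.mono_neutral_cong_left) auto
    also have "\<dots> = (\<Sum>j<m. \<Sum>k<m. if k < j then y k * diag_coeff cs j else 0)"
      by (rule sum.swap)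
    also have "\<dots> = (\<Sum>j<m. (\<Sum>k<j. y k) * diag_coeff cs j)"
      unfolding sum_distrib_right by (intro sum.cong refl sum.mono_neutral_cong_right) auto
    also have "\<dots> = (\<Sum>j<m. (eig j - eig 0) * y j * diag_coeff cs j)"
      by (intro sum.cong refl) (simp add: y)
    finally have *: "(\<Sum>k<m. y k * (\<Sum>j\<in>{k<..<m}. diag_coeff cs j)) = (\<Sum>j<m. (eig j - eig 0) * y j * diag_coeff cs j)" .
    have "(\<Sum>k<m. y k * diag_coeff (c # cs) k) = (\<Sum>k<m. y k * ((eig k - c) * diag_coeff cs k)) - (\<Sum>k<m. y k * (\<Sum>j\<in>{k<..<m}. diag_coeff cs j))"
      by (simp add: right_diff_distrib sum_subtractf)
    also have "\<dots> = (\<Sum>k<m. (eig 0 - c) * (y k * diag_coeff cs k))"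
      unfolding * sum_subtractf[symmetric] by (intro sum.cong refl) (simp add: algebra_simps)
    finally show ?thesis by (simp add: sum_distrib_left)
  qed
  have prod: "(\<Sum>k<m. y k * diag_coeff cs k) = (\<Prod>c\<leftarrow>cs. eig 0 - c) * S (m - 1)" for cs
  proof (induction cs)
    case Nil
    then show ?case using ySum[OF m] by simp
  next
    case (Cons c cs)
    show ?case unfolding key Cons.IH by (simp add: mult.assoc)
  qed
  \<comment> \<open>The counterpart of \<open>steps_kill\<close> for the coefficients; in the
    pairing with \<open>y\<close> it leaves only the term with index 0.\<close>
  have vanish: "diag_coeff (map eig [k..<m]) j = 0" if "k \<le> j" "j < m" "k \<le> m" for j k
    using that(3,1,2)
  proof (induction arbitrary: j rule: inc_induct)
    case (step k)
    have split: "map eig [k..<m] = eig k # map eig [Suc k..<m]"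
      using step.hyps by (simp add: upt_conv_Cons)
    show ?case
      using step by (cases "j = k") (auto simp: split intro!: sum.neutral)
  qed simp
  have "(\<Sum>k<m. y k * diag_coeff (map eig [1..<m]) k) = y 0 * diag_coeff (map eig [1..<m]) 0"
    using vanish[of 1] m by (simp add: sum.remove[of _ 0])
  moreover have "(\<Prod>c\<leftarrow>map eig [1..<m]. eig 0 - c) \<noteq> 0"
  proof -
    have "eig 0 - eig i \<noteq> 0" if "i \<in> set [1..<m]" for i
      using ne[of i] that by simp
    then have "0 \<notin> set (map (\<lambda>i. eig 0 - eig i) [1..<m])"
      by (metis (no_types, lifting) imageE list.set_map)
    then show ?thesis by (simp add: prod_list_zero_iff o_def)
  qed
  moreover have "S (m - 1) \<noteq> 0"
  proof -
    have "1 + 1 / (eig i - eig 0) \<noteq> 0" if "0 < i" "i < m" for i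
      using ne[OF that] by (auto simp: field_simps)
    then show ?thesis using m by (auto simp: S_def)
  qed
  ultimately show ?thesis using prod[of "map eig [1..<m]"] by (auto simp: y_def)
qed

text \<open>The factor of \<open>eig 0\<close> is the one left out, so applying it to the result
  completes the characteristic identity and gives 0. The clause on \<open>S\<close> hands down to
  all entries of \<open>w\<close> any linear condition that \<open>v\<close> satisfies and the
  operators preserve.\<close>

theorem eigenfamily_exists:
  assumes m: "0 < m" and ne: "\<forall>b. 0 < b \<and> b < m \<longrightarrow> eig 0 \<noteq> eig b \<and> eig 0 - eig b \<noteq> 1"
  shows "\<exists>w c. c \<noteq> 0 \<and> w 0 = scale c v \<and>
    (\<forall>a<m. (\<Sum>b<m. F a b (w b)) = scale (eig 0) (w a)) \<and>
    (\<forall>S. subspace S \<and> v \<in> S \<and> (\<forall>a<m. \<forall>b<m. \<forall>u\<in>S. F a b u \<in> S) \<longrightarrow> range w \<subseteq> S)"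
proof -
  let ?w = "steps (map eig [1..<m]) (base 0)" and ?c = "diag_coeff (map eig [1..<m]) 0"
  have 1: "?c \<noteq> 0" using diag_coeff_nonzero[OF m] ne by blast
  have 2: "?w 0 = scale ?c v"
    using m by (rule steps_base_diag)
  have "step (eig 0) ?w = steps (map eig [0..<m]) (base 0)"
    using m by (simp add: upt_conv_Cons)
  also have "\<dots> = (\<lambda>a. 0)" using steps_kill[of 0] m by blast
  finally have "step (eig 0) ?w = (\<lambda>a. 0)" .
  then have 3: "(\<Sum>b<m. F a b (?w b)) = scale (eig 0) (?w a)" if "a < m" for a
    using that by (auto simp: step_def fun_eq_iff split: if_splits)
  have 4: "range ?w \<subseteq> S" if "subspace S \<and> v \<in> S \<and> (\<forall>a<m. \<forall>b<m. \<forall>u\<in>S. F a b u \<in> S)" for S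
    using steps_stable[of S] that by auto
  show ?thesis
    by (rule exI[of _ ?w], rule exI[of _ ?c]) (use 1 2 3 4 in blast)
qed

end

text \<open>The second block will act on whole families, with the eigenfamily of the first block in
  the role of the highest weight vector.\<close>

lemma vector_space_family:
  assumes "vector_space (scale :: complex \<Rightarrow> 'v::ab_group_add \<Rightarrow> 'v)"
  shows "vector_space (\<lambda>c (f :: nat \<Rightarrow> 'v) a. scale c (f a))"
proof -
  interpret vector_space scale by fact
  show ?thesis by unfold_locales (auto simp: fun_eq_iff scale_right_distrib scale_left_distrib)
qed

lemma complex_gap:
  assumes "x - y = complex_of_real r" "2 \<le> r"
  shows "x \<noteq> y \<and> x - y \<noteq> 1"
proof
  show "x \<noteq> y"
  proof
    assume "x = y"
    then have "complex_of_real r = 0" using assms(1) by simp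
    then show False using assms(2) by simp
  qed
  show "x - y \<noteq> 1" unfolding assms(1) using assms(2) by simp
qed

lemma sum_family_apply: "(\<Sum>i\<in>I. f i) a = (\<Sum>i\<in>I. f i a)" for f :: "'i \<Rightarrow> nat \<Rightarrow> 'v::ab_group_add"
  by (induction I rule: infinite_finite_induct) auto

section \<open>Invariant positive forms and the norm computation\<close>

locale unitary_gl = gl_action scale V n E
  for scale :: "complex \<Rightarrow> 'v::ab_group_add \<Rightarrow> 'v" and V n E +
  fixes p :: nat and h :: "'v \<Rightarrow> 'v \<Rightarrow> complex"
  assumes h_add: "\<And>u v w. u \<in> V \<Longrightarrow> v \<in> V \<Longrightarrow> w \<in> V \<Longrightarrow> h (u + v) w = h u w + h v w"
    and h_scale: "\<And>c v w. v \<in> V \<Longrightarrow> w \<in> V \<Longrightarrow> h (scale c v) w = c * h v w"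
    and h_sym: "\<And>v w. v \<in> V \<Longrightarrow> w \<in> V \<Longrightarrow> h w v = cnj (h v w)"
    and h_pos: "\<And>v. v \<in> V \<Longrightarrow> v \<noteq> 0 \<Longrightarrow> Re (h v v) > 0"
    and h_adj: "\<And>i j v w. i < n \<Longrightarrow> j < n \<Longrightarrow> v \<in> V \<Longrightarrow> w \<in> V \<Longrightarrow>
       h (E i j v) w = (if (i < p) = (j < p) then 1 else - 1) * h v (E j i w)"
begin

lemma h_zero_left: "w \<in> V \<Longrightarrow> h 0 w = 0"
  using h_scale[of 0 w 0] subspace_0[OF sub] by simp

lemma h_sum_left: "(\<And>i. i \<in> I \<Longrightarrow> f i \<in> V) \<Longrightarrow> w \<in> V \<Longrightarrow> h (\<Sum>i\<in>I. f i) w = (\<Sum>i\<in>I. h (f i) w)"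
proof (induction I rule: infinite_finite_induct)
  case (insert x I)
  then show ?case using subspace_sum[OF sub, of I f] by (simp add: h_add)
qed (simp_all add: h_zero_left)

lemma h_sum_right: "(\<And>i. i \<in> I \<Longrightarrow> f i \<in> V) \<Longrightarrow> w \<in> V \<Longrightarrow> h w (\<Sum>i\<in>I. f i) = (\<Sum>i\<in>I. h w (f i))"
  using h_sum_left[of I f w] h_sym[of "\<Sum>i\<in>I. f i" w] subspace_sum[OF sub, of I f] h_sym[of _ w]
  by (simp add: h_sym[of _ w])

lemma h_nonneg: "v \<in> V \<Longrightarrow> Re (h v v) \<ge> 0"
  using h_pos[of v] h_zero_left[of v] by (cases "v = 0") auto

lemma commute:
  assumes "a < n" "b < n" "c < n" "d < n" "u \<in> V" "b \<noteq> c" "a \<noteq> d"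
  shows "E a b (E c d u) = E c d (E a b u)"
  using bracket[of a b c d u] assms by simp

text \<open>The norm of a \<open>k\<close>-highest weight vector in the image of \<open>p\<^sup>- \<otimes> F\<close>, where \<open>F\<close> is the
  \<open>k\<close>-module generated by \<open>v\<close>, is a positive multiple of \<open>1 - (\<Lambda>\<^sub>i - \<Lambda>\<^sub>j)\<close>.\<close>

theorem highest_weight_bound:
  fixes lam :: "nat \<Rightarrow> real"
  assumes v: "v \<in> V" "v \<noteq> 0"
    and raise: "\<And>i j. i < j \<Longrightarrow> j < n \<Longrightarrow> E i j v = 0"
    and weight: "\<And>i. i < n \<Longrightarrow> E i i v = scale (of_real (lam i)) v"
    and ij: "i0 < p" "p \<le> j0" "j0 < n"
    and gapi: "\<And>i. i0 < i \<Longrightarrow> i < p \<Longrightarrow> (lam i0 - i0) - (lam i - i) \<ge> 2"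
    and gapj: "\<And>j. p \<le> j \<Longrightarrow> j < j0 \<Longrightarrow> (lam j - j) - (lam j0 - j0) \<ge> 2"
  shows "(lam i0 - i0) - (lam j0 - j0) \<le> 1"
proof -
  \<comment> \<open>The blocks consist of the indices \<open>i0, \<dots>, p - 1\<close> and
    \<open>p, \<dots>, j0\<close>. Thus \<open>eig 0\<close> belongs to \<open>i0\<close> and to
    \<open>j0\<close>, and the gap hypotheses concern the remaining indices of the blocks.\<close>
  define m1 where "m1 = p - i0"
  define m2 where "m2 = j0 - p + 1"
  define F1 where "F1 a b = E (i0 + a) (i0 + b)" for a b
  \<comment> \<open>The weight of the second block is to be raised at \<open>j0\<close>, so the dual
    situation is needed: minus transpose is an automorphism of \<open>gl\<close>, and counting down
    from \<open>j0\<close> makes \<open>v\<close> a highest weight vector again, now with the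
    negated weights.\<close>
  define G where "G a b u = - E (j0 - b) (j0 - a) u" for a b u
  define F2 where "F2 a b f = (\<lambda>c::nat. G a b (f c))" for a b and f :: "nat \<Rightarrow> 'v"
  define scale' where "scale' c f = (\<lambda>a::nat. scale c (f a))" for c and f :: "nat \<Rightarrow> 'v"
  define V2 :: "(nat \<Rightarrow> 'v) set" where "V2 = {f. \<forall>a. f a \<in> V}"
  have m: "0 < m1" "0 < m2" and i0[simp]: "i0 + a < n" "i0 + a < p" if "a < m1" for a
    using ij that by (auto simp: m1_def m2_def)
  have j0[simp]: "j0 - b < n" "p \<le> j0 - b" "\<not> j0 - b < p" if "b < m2" for b
    using ij that by (auto simp: m2_def)
  have m: "0 < m1" "0 < m2" using ij by (auto simp: m1_def m2_def)
  have jinj: "j0 - a = j0 - b \<longleftrightarrow> a = b" if "a < m2" "b < m2" for a b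
    using that ij by (auto simp: m2_def)
  have ij_ne: "i0 + a \<noteq> j0 - b" "j0 - b \<noteq> i0 + a" if "a < m1" "b < m2" for a b
    using i0[OF that(1)] j0[OF that(2)] by auto
  interpret B1: gl_highest_weight scale V m1 F1 v "\<lambda>a. of_real (lam (i0 + a))"
    unfolding F1_def using v i0
    by unfold_locales (auto simp: sub closed add scal bracket raise weight)
  interpret vs2: vector_space scale'
    unfolding scale'_def by (rule vector_space_family) unfold_locales
  have mm1: "B1.eig a = of_real (lam (i0 + a) - (i0 + a) + p - 1)" if "a < m1" for a
  proof -
    have "m1 - 1 - a = p - (1 + (i0 + a))" using ij by (simp add: m1_def)
    moreover have "1 + (i0 + a) \<le> p" using that ij by (simp add: m1_def)
    ultimately show ?thesis unfolding B1.eig_def by (simp only: of_nat_diff) simp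
  qed
  have ne1: "\<forall>b. 0 < b \<and> b < m1 \<longrightarrow> B1.eig 0 \<noteq> B1.eig b \<and> B1.eig 0 - B1.eig b \<noteq> 1"
  proof (intro allI impI, elim conjE)
    fix b assume that: "0 < b" "b < m1"
    have "B1.eig 0 - B1.eig b = of_real ((lam i0 - i0) - (lam (i0 + b) - (i0 + b)))"
      using mm1[of 0] mm1[of b] that by simp
    moreover have "(lam i0 - i0) - (lam (i0 + b) - (i0 + b)) \<ge> 2"
      using gapi[of "i0 + b"] that by simp
    ultimately show "B1.eig 0 \<noteq> B1.eig b \<and> B1.eig 0 - B1.eig b \<noteq> 1" by (rule complex_gap)
  qed
  obtain w c1 where c1: "c1 \<noteq> 0" and w0: "w 0 = scale c1 v"
    and w_eig: "\<forall>a<m1. (\<Sum>b<m1. F1 a b (w b)) = scale (B1.eig 0) (w a)"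
    and w_S: "\<forall>S. subspace S \<and> v \<in> S \<and> (\<forall>a<m1. \<forall>b<m1. \<forall>u\<in>S. F1 a b u \<in> S) \<longrightarrow> range w \<subseteq> S"
    using B1.eigenfamily_exists[OF m(1) ne1] by (elim exE conjE)
  have G_closed: "G a b u \<in> V" if "a < m2" "b < m2" "u \<in> V" for a b u
    using that by (auto simp: G_def intro!: subspace_neg[OF sub] closed)
  have G_v: "G a b v = 0" if "a < b" "b < m2" for a b
    using that ij raise[of "j0 - b" "j0 - a"] by (auto simp: G_def m2_def)
  have FG: "F1 a b (G c d u) = G c d (F1 a b u)" if "a < m1" "b < m1" "c < m2" "d < m2" "u \<in> V" for a b c d u
    using that ij_ne unfolding F1_def G_def
    by (subst neg) (auto intro!: commute closed)
  \<comment> \<open>The conditions to be inherited by every \<open>w a\<close>: the noncompact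
    raising operators vanish on it, and it is still a highest weight vector for the second
    block.\<close>
  define S1 where "S1 = {u \<in> V. (\<forall>i<p. \<forall>j. p \<le> j \<and> j < n \<longrightarrow> E i j u = 0) \<and>
     (\<forall>a<m2. \<forall>b<m2. a < b \<longrightarrow> G a b u = 0) \<and> (\<forall>a<m2. G a a u = scale (of_real (- lam (j0 - a))) u)}"
  have raise_stable: "E i j (E a b u) = 0"
    if "\<forall>i<p. \<forall>j. p \<le> j \<and> j < n \<longrightarrow> E i j u = 0" "u \<in> V" "i < p" "p \<le> j" "j < n" "a < n" "b < n" "(a < p) = (b < p)" for i j a b u
  proof -
    have "i < n" "E i j u = 0" using that by auto
    moreover have "j = a \<Longrightarrow> E i b u = 0" "i = b \<Longrightarrow> E a j u = 0" using that by auto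
    ultimately show ?thesis
      using bracket[of i j a b u] zero[of a b] that by (auto split: if_splits)
  qed
  have "range w \<subseteq> S1"
  proof (rule w_S[rule_format], intro conjI allI impI ballI)
    show "subspace S1"
      unfolding S1_def using ij
      by (intro subspaceI)
        (auto simp: G_def zero add scal scale_right_distrib subspace_0[OF sub] subspace_add[OF sub]
           subspace_scale[OF sub] mult.commute minus_add_distrib[symmetric] simp del: minus_add_distrib)
    show "v \<in> S1"
      using v ij by (auto simp: S1_def raise G_v) (auto simp: G_def weight)
    fix a b u assume ab: "a < m1" "b < m1" and u: "u \<in> S1"
    then have uV: "u \<in> V" by (simp add: S1_def)
    show "F1 a b u \<in> S1"
      unfolding S1_def
    proof (intro CollectI conjI allI impI)
      show "F1 a b u \<in> V" using ab uV by (rule B1.closed)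
      show "E i j (F1 a b u) = 0" if "i < p" "p \<le> j \<and> j < n" for i j
        unfolding F1_def using that ab u uV by (intro raise_stable) (auto simp: S1_def)
      show "G c d (F1 a b u) = 0" if "c < m2" "d < m2" "c < d" for c d
        using FG[OF ab that(1,2) uV] u that B1.zero[OF ab] by (simp add: S1_def)
      show "G c c (F1 a b u) = scale (of_real (- lam (j0 - c))) (F1 a b u)" if "c < m2" for c
        using FG[OF ab that that uV] u that B1.scal[OF ab uV] by (simp add: S1_def del: of_real_minus)
    qed
  qed
  then have S1: "w a \<in> S1" for a by auto
  have wV: "w a \<in> V" for a using S1[of a] by (simp add: S1_def)
  interpret B2: gl_highest_weight scale' V2 m2 F2 w "\<lambda>a. of_real (- lam (j0 - a))"
  proof
    show "vs2.subspace V2"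
      by (intro vs2.subspaceI)
        (auto simp: V2_def scale'_def subspace_0[OF sub] subspace_add[OF sub] subspace_scale[OF sub])
    fix a b assume ab: "a < m2" "b < m2"
    show "F2 a b f \<in> V2" if "f \<in> V2" for f
      using ab that by (auto simp: F2_def V2_def G_closed)
    show "F2 a b (f + g) = F2 a b f + F2 a b g" if "f \<in> V2" "g \<in> V2" for f g
      using ab that by (auto simp: F2_def V2_def G_def add fun_eq_iff)
    show "F2 a b (scale' c f) = scale' c (F2 a b f)" if "f \<in> V2" for f c
      using ab that by (auto simp: F2_def V2_def G_def scale'_def scal fun_eq_iff)
    fix c d assume cd: "c < m2" "d < m2"
    show "F2 a b (F2 c d f) - F2 c d (F2 a b f) = (if b = c then F2 a d f else 0) - (if a = d then F2 c b f else 0)"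
      if "f \<in> V2" for f
    proof
      fix x
      have f: "f x \<in> V" using that by (simp add: V2_def)
      show "(F2 a b (F2 c d f) - F2 c d (F2 a b f)) x = ((if b = c then F2 a d f else 0) - (if a = d then F2 c b f else 0)) x"
        using bracket[of "j0 - b" "j0 - a" "j0 - d" "j0 - c" "f x"] ab cd f
        by (auto simp: F2_def G_def neg closed jinj)
    qed
  next
    show "w \<in> V2" using wV by (simp add: V2_def)
    show "F2 a b w = 0" if "a < b" "b < m2" for a b
      using S1 that by (auto simp: F2_def S1_def fun_eq_iff)
    show "F2 a a w = scale' (of_real (- lam (j0 - a))) w" if "a < m2" for a
      using S1 that by (auto simp: F2_def S1_def scale'_def fun_eq_iff)
  qed
  have mm2: "B2.eig a = of_real (- (lam (j0 - a) - (j0 - a)) - p)" if "a < m2" for a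
  proof -
    have "m2 - 1 - a = j0 - (a + p)" using ij by (simp add: m2_def)
    moreover have "a + p \<le> j0" "a \<le> j0" using that ij by (simp_all add: m2_def)
    ultimately show ?thesis unfolding B2.eig_def by (simp only: of_nat_diff) (simp add: of_nat_diff)
  qed
  have ne2: "\<forall>b. 0 < b \<and> b < m2 \<longrightarrow> B2.eig 0 \<noteq> B2.eig b \<and> B2.eig 0 - B2.eig b \<noteq> 1"
  proof (intro allI impI, elim conjE)
    fix b assume that: "0 < b" "b < m2"
    have "B2.eig 0 - B2.eig b = of_real ((lam (j0 - b) - (j0 - b)) - (lam j0 - j0))"
      using mm2[of 0] mm2[of b] that by simp
    moreover have "(lam (j0 - b) - (j0 - b)) - (lam j0 - j0) \<ge> 2"
      using gapj[of "j0 - b"] that j0[of b] ij by (simp add: m2_def)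
    ultimately show "B2.eig 0 \<noteq> B2.eig b \<and> B2.eig 0 - B2.eig b \<noteq> 1" by (rule complex_gap)
  qed
  obtain W c2 where c2: "c2 \<noteq> 0" and W0: "W 0 = scale' c2 w"
    and W_eig: "\<forall>a<m2. (\<Sum>b<m2. F2 a b (W b)) = scale' (B2.eig 0) (W a)"
    and W_S: "\<forall>S. vs2.subspace S \<and> w \<in> S \<and> (\<forall>a<m2. \<forall>b<m2. \<forall>u\<in>S. F2 a b u \<in> S) \<longrightarrow> range W \<subseteq> S"
    using B2.eigenfamily_exists[OF m(2) ne2] by (elim exE conjE)
  \<comment> \<open>Both blocks at once: the second block acts on families componentwise and commutes with the first.\<close>
  define S2 where "S2 = {f \<in> V2. (\<forall>a<m1. (\<Sum>b<m1. F1 a b (f b)) = scale (B1.eig 0) (f a)) \<and>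
     (\<forall>a. \<forall>i<p. \<forall>j. p \<le> j \<and> j < n \<longrightarrow> E i j (f a) = 0)}"
  have "range W \<subseteq> S2"
  proof (rule W_S[rule_format], intro conjI allI impI ballI)
    show "vs2.subspace S2"
      unfolding S2_def using ij
      by (intro vs2.subspaceI)
        (auto simp: V2_def scale'_def B1.zero B1.add B1.scal zero add scal subspace_0[OF sub] subspace_add[OF sub]
          subspace_scale[OF sub] sum.distrib scale_right_distrib scale_sum_right[symmetric] mult.commute)
    show "w \<in> S2" using S1 w_eig by (auto simp: S2_def S1_def V2_def)
    fix a b f assume ab: "a < m2" "b < m2" and f: "f \<in> S2"
    then have fV: "f x \<in> V" for x by (simp add: S2_def V2_def)
    show "F2 a b f \<in> S2"
      unfolding S2_def
    proof (intro CollectI conjI allI impI)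
      show "F2 a b f \<in> V2" using ab fV G_closed by (simp add: F2_def V2_def)
      show "E i j (F2 a b f x) = 0" if "i < p" "p \<le> j \<and> j < n" for i j x
      proof -
        have "E i j (E (j0 - b) (j0 - a) (f x)) = 0"
          using that ab f fV by (intro raise_stable) (auto simp: S2_def)
        then show ?thesis using that ab fV ij by (simp add: F2_def G_def neg closed)
      qed
      show "(\<Sum>y<m1. F1 x y (F2 a b f y)) = scale (B1.eig 0) (F2 a b f x)" if "x < m1" for x
      proof -
        have "(\<Sum>y<m1. F1 x y (F2 a b f y)) = (\<Sum>y<m1. G a b (F1 x y (f y)))"
          using that ab fV by (intro sum.cong refl) (simp add: F2_def FG)
        also have "\<dots> = G a b (\<Sum>y<m1. F1 x y (f y))"
          using that ab fV sums[of "j0 - b" "j0 - a" "{..<m1}" "\<lambda>y. F1 x y (f y)"]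
          by (simp add: G_def B1.closed sum_negf)
        also have "\<dots> = scale (B1.eig 0) (G a b (f x))"
          using f that ab fV by (simp add: S2_def G_def scal)
        finally show ?thesis by (simp add: F2_def)
      qed
    qed
  qed
  then have S2: "W b \<in> S2" for b by auto
  have WV: "W b a \<in> V" for a b using S2[of b] by (simp add: S2_def V2_def)
  have eig1: "(\<Sum>b<m1. F1 a b (W d b)) = scale (B1.eig 0) (W d a)" if "a < m1" for a d
    using S2[of d] that by (simp add: S2_def)
  have eig2: "(\<Sum>b<m2. G d b (W b a)) = scale (B2.eig 0) (W d a)" if "d < m2" for a d
    using W_eig that by (auto simp: F2_def scale'_def fun_eq_iff sum_family_apply)
  have kill: "E (i0 + c) (j0 - d) (W b a) = 0" if "c < m1" "d < m2" for a b c d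
    using S2[of b] that by (simp add: S2_def)
  define I where "I = {..<m2} \<times> {..<m1}"
  \<comment> \<open>The doubly indexed family \<open>W\<close> is a vector of
    \<open>p^- \<otimes> V\<close>, and \<open>u\<close> is its image under the action map.\<close>
  define u where "u = (\<Sum>(b, a)\<in>I. E (j0 - b) (i0 + a) (W b a))"
  have term_V: "E (j0 - b) (i0 + a) (W b a) \<in> V" if "(b, a) \<in> I" for a b
    using that WV by (auto simp: I_def intro!: closed)
  then have uV: "u \<in> V" unfolding u_def by (intro subspace_sum[OF sub]) auto
  \<comment> \<open>Each \<open>W b a\<close> is killed by the raising operator, so only commutators
    remain. They split into the matrix of the first block and that of the second, each acting by its
    own eigenvalue.\<close>
  have eu: "E (i0 + c) (j0 - d) u = scale (B1.eig 0 + B2.eig 0) (W d c)" if "(d, c) \<in> I" for c d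
  proof -
    have cd: "c < m1" "d < m2" using that by (auto simp: I_def)
    have "E (i0 + c) (j0 - d) u = (\<Sum>(b, a)\<in>I. E (i0 + c) (j0 - d) (E (j0 - b) (i0 + a) (W b a)))"
      unfolding u_def using cd term_V by (subst sums) (auto simp: case_prod_beta)
    also have "\<dots> = (\<Sum>(b, a)\<in>I. (if d = b then F1 c a (W b a) else 0) + (if c = a then G d b (W b a) else 0))"
    proof (intro sum.cong refl, clarify)
      fix b a assume "(b, a) \<in> I"
      then have ba: "a < m1" "b < m2" by (auto simp: I_def)
      show "E (i0 + c) (j0 - d) (E (j0 - b) (i0 + a) (W b a)) = (if d = b then F1 c a (W b a) else 0) + (if c = a then G d b (W b a) else 0)"
        using bracket[of "i0 + c" "j0 - d" "j0 - b" "i0 + a" "W b a"] kill[OF cd, of b a] cd ba WV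
        by (auto simp: jinj F1_def G_def zero)
    qed
    also have "\<dots> = (\<Sum>b<m2. \<Sum>a<m1. (if d = b then F1 c a (W b a) else 0) + (if c = a then G d b (W b a) else 0))"
      unfolding I_def by (rule sum.cartesian_product[symmetric])
    also have "\<dots> = (\<Sum>b<m2. (if d = b then \<Sum>a<m1. F1 c a (W b a) else 0) + G d b (W b c))"
      using cd by (intro sum.cong refl) (auto simp: sum.distrib)
    also have "\<dots> = (\<Sum>a<m1. F1 c a (W d a)) + (\<Sum>b<m2. G d b (W b c))"
      using cd by (simp add: sum.distrib)
    finally show ?thesis using cd by (simp add: eig1 eig2 scale_left_distrib)
  qed
  have mm: "B1.eig 0 + B2.eig 0 = of_real ((lam i0 - i0) - (lam j0 - j0) - 1)" (is "_ = of_real ?r")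
    using mm1[of 0] mm2[of 0] m by simp
  have "h u u = (\<Sum>(b, a)\<in>I. h u (E (j0 - b) (i0 + a) (W b a)))"
    by (subst (2) u_def, subst h_sum_right) (use term_V uV in \<open>auto simp: case_prod_beta\<close>)
  also have "\<dots> = (\<Sum>(b, a)\<in>I. - (of_real ?r * h (W b a) (W b a)))"
  proof (intro sum.cong refl, clarify)
    fix b a assume ba: "(b, a) \<in> I"
    then have ba': "a < m1" "b < m2" by (auto simp: I_def)
    have "h (E (i0 + a) (j0 - b) u) (W b a) = - h u (E (j0 - b) (i0 + a) (W b a))"
      using ba' WV uV by (subst h_adj) auto
    then show "h u (E (j0 - b) (i0 + a) (W b a)) = - (of_real ?r * h (W b a) (W b a))"
      using eu[OF ba] WV mm by (simp add: h_scale)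
  qed
  finally have "h u u = - (of_real ?r * (\<Sum>(b, a)\<in>I. h (W b a) (W b a)))"
    by (simp add: sum_negf sum_distrib_left case_prod_beta)
  then have "Re (h u u) = - (?r * Re (\<Sum>(b, a)\<in>I. h (W b a) (W b a)))"
    by simp
  then have 1: "Re (h u u) = - (?r * (\<Sum>(b, a)\<in>I. Re (h (W b a) (W b a))))"
    by (simp add: case_prod_beta)
  \<comment> \<open>One nonzero entry makes the sum of the squared norms strictly positive; only
    then does the sign of \<open>h u u\<close> control the sign of the eigenvalue.\<close>
  have "W 0 0 = scale (c2 * c1) v" by (simp add: W0 scale'_def w0)
  then have "W 0 0 \<noteq> 0" using c1 c2 v by simp
  then have "0 < Re (h (W 0 0) (W 0 0))" using WV h_pos by blast
  also have "\<dots> \<le> (\<Sum>(b, a)\<in>I. Re (h (W b a) (W b a)))"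
    using member_le_sum[of "(0, 0)" I "\<lambda>(b, a). Re (h (W b a) (W b a))"] m h_nonneg[OF WV]
    by (auto simp: I_def)
  finally have "0 < (\<Sum>(b, a)\<in>I. Re (h (W b a) (W b a)))" .
  then have "?r \<le> 0" using 1 h_nonneg[OF uV]
    by (smt (verit) mult_pos_pos)
  then show ?thesis by simp
qed

end

section \<open>Necessity of the bound\<close>

text \<open>The matrix unit with its trace removed. This projection of \<open>gl(n)\<close> onto
  \<open>sl(n)\<close> is a Lie algebra homomorphism, so an \<open>sl(n)\<close>-module becomes a
  \<open>gl(n)\<close>-module on which the identity matrix acts by 0.\<close>

definition gl_unit :: "nat \<Rightarrow> nat \<Rightarrow> nat \<Rightarrow> complex mat" where
  "gl_unit n i j = mat n n (\<lambda>(k, l). (if k = i \<and> l = j then 1 else 0) - (if i = j \<and> k = l then 1 / of_nat n else 0))"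

lemma gl_unit_carrier[simp]: "gl_unit n i j \<in> carrier_mat n n"
  by (simp add: gl_unit_def)

lemma gl_unit_dim[simp]: "dim_row (gl_unit n i j) = n" "dim_col (gl_unit n i j) = n"
  by (simp_all add: gl_unit_def)

lemma gl_unit_index: "k < n \<Longrightarrow> l < n \<Longrightarrow>
  gl_unit n i j $$ (k, l) = (if k = i \<and> l = j then 1 else 0) - (if i = j \<and> k = l then 1 / of_nat n else 0)"
  by (simp add: gl_unit_def)

lemma gl_unit_root: "i \<noteq> j \<Longrightarrow> gl_unit n i j = root_vector n i j"
  by (auto simp: gl_unit_def root_vector_def)

lemma gl_unit_sl: "i < n \<Longrightarrow> j < n \<Longrightarrow> gl_unit n i j \<in> sl n"
  by (cases "i = j") (auto simp: sl_def gl_unit_index sum_subtractf intro!: sum.neutral)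

lemma sl_carrier: "X \<in> sl n \<Longrightarrow> X \<in> carrier_mat n n"
  by (simp add: sl_def)

lemma sl_smult: "X \<in> sl n \<Longrightarrow> c \<cdot>\<^sub>m X \<in> sl n"
  by (auto simp: sl_def sum_distrib_left[symmetric])

lemma sl_add: "X \<in> sl n \<Longrightarrow> Y \<in> sl n \<Longrightarrow> X + Y \<in> sl n"
  by (auto simp: sl_def sum.distrib)

lemma sl_zero: "0\<^sub>m n n \<in> sl n"
  by (auto simp: sl_def)

lemma gl_unit_mult_index:
  assumes "i < n" "j < n" "a < n" "b < n" and Y: "Y \<in> carrier_mat n n"
  shows "(gl_unit n i j * Y) $$ (a, b)
    = (if a = i then Y $$ (j, b) else 0) - (if i = j then Y $$ (a, b) / of_nat n else 0)"
proof -
  have "(gl_unit n i j * Y) $$ (a, b) = (\<Sum>c<n. gl_unit n i j $$ (a, c) * Y $$ (c, b))"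
    using assms by (auto simp: scalar_prod_def atLeast0LessThan)
  also have "\<dots> = (\<Sum>c<n. (if c = j then if a = i then Y $$ (j, b) else 0 else 0)
      - (if c = a then if i = j then Y $$ (a, b) / of_nat n else 0 else 0))"
    using assms by (intro sum.cong refl) (auto simp: gl_unit_index algebra_simps)
  also have "\<dots> = (if a = i then Y $$ (j, b) else 0) - (if i = j then Y $$ (a, b) / of_nat n else 0)"
    using assms by (simp add: sum_subtractf)
  finally show ?thesis .
qed

text \<open>The removed scalars are central and drop out on the left. On the right they appear only
  if both conditions hold, and then they cancel.\<close>

lemma gl_unit_bracket:
  assumes "i < n" "j < n" "k < n" "l < n"
  shows "gl_unit n i j * gl_unit n k l - gl_unit n k l * gl_unit n i j
    = (if j = k then gl_unit n i l else 0\<^sub>m n n) + (- 1) \<cdot>\<^sub>m (if i = l then gl_unit n k j else 0\<^sub>m n n)"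
    (is "?L = ?R")
proof (rule eq_matI)
  fix a b assume "a < dim_row ?R" "b < dim_col ?R"
  then have ab: "a < n" "b < n" by (auto split: if_splits)
  have "?L $$ (a, b) = (gl_unit n i j * gl_unit n k l) $$ (a, b) - (gl_unit n k l * gl_unit n i j) $$ (a, b)"
    using ab by (intro index_minus_mat) auto
  also have "\<dots> = ?R $$ (a, b)"
    unfolding gl_unit_mult_index[OF assms(1,2) ab gl_unit_carrier] gl_unit_mult_index[OF assms(3,4) ab gl_unit_carrier]
    using ab assms by (cases "j = k"; cases "i = l"; cases "i = j"; cases "k = l")
      (simp_all add: gl_unit_index, simp_all add: diff_divide_distrib)
  finally show "?L $$ (a, b) = ?R $$ (a, b)" .
qed (auto split: if_splits)

context sl_module
begin

lemma act_zero: "v \<in> V \<Longrightarrow> act (0\<^sub>m n n) v = 0"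
  using scale_act[OF sl_zero, of v 0] by (simp add: smult_zero_mat)

sublocale gl: gl_action scale V n "\<lambda>i j. act (gl_unit n i j)"
proof
  fix a b c d v assume *: "a < n" "b < n" "c < n" "d < n" "v \<in> V"
  have if_sl: "(if P then gl_unit n a' b' else 0\<^sub>m n n) \<in> sl n" if "a' < n" "b' < n" for P a' b'
    using that by (auto intro: gl_unit_sl sl_zero)
  have "act (gl_unit n a b) (act (gl_unit n c d) v) - act (gl_unit n c d) (act (gl_unit n a b) v)
      = act ((if b = c then gl_unit n a d else 0\<^sub>m n n) + (- 1) \<cdot>\<^sub>m (if a = d then gl_unit n c b else 0\<^sub>m n n)) v"
    using * by (simp add: act_bracket[symmetric] gl_unit_sl gl_unit_bracket)
  also have "\<dots> = act (if b = c then gl_unit n a d else 0\<^sub>m n n) v - act (if a = d then gl_unit n c b else 0\<^sub>m n n) v"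
    using * by (simp add: add_act if_sl sl_smult scale_act)
  finally show "act (gl_unit n a b) (act (gl_unit n c d) v) - act (gl_unit n c d) (act (gl_unit n a b) v)
      = (if b = c then act (gl_unit n a d) v else 0) - (if a = d then act (gl_unit n c b) v else 0)"
    using * by (auto simp: act_zero)
qed (auto simp: subspace_V act_closed act_add act_scale gl_unit_sl)

end

lemma su_iff:
  assumes n: "n = p + q"
  shows "X \<in> su p q \<longleftrightarrow> X \<in> sl n \<and> (\<forall>i<n. \<forall>j<n. X $$ (j, i) = (if (i < p) = (j < p) then - 1 else 1) * cnj (X $$ (i, j)))"
proof (cases "X \<in> sl n")
  case True
  then have X: "X \<in> carrier_mat n n" "dim_row X = n" "dim_col X = n" by (auto simp: sl_def)
  let ?S = "signature_mat p q"
  let ?L = "map_mat cnj (transpose_mat X) * ?S + ?S * X"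
  have S: "?S \<in> carrier_mat n n" by (simp add: signature_mat_def n)
  have entry: "?L $$ (j, i) = cnj (X $$ (i, j)) * (if i < p then 1 else - 1) + (if j < p then 1 else - 1) * X $$ (j, i)"
    if "i < n" "j < n" for i j
  proof -
    have S': "?S $$ (k, l) = (if k = l then (if l < p then 1 else - 1) else 0)" if "k < n" "l < n" for k l
      using that by (auto simp: signature_mat_def n mat_diag_def)
    have D: "dim_row ?S = n" "dim_col ?S = n" by (simp_all add: signature_mat_def n mat_diag_def)
    have "(map_mat cnj (transpose_mat X) * ?S) $$ (j, i) = (\<Sum>k<n. cnj (X $$ (k, j)) * ?S $$ (k, i))"
      using that X S D by (simp add: scalar_prod_def atLeast0LessThan)
    also have "\<dots> = (\<Sum>k<n. if k = i then cnj (X $$ (i, j)) * (if i < p then 1 else - 1) else 0)"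
      using that by (intro sum.cong refl) (auto simp: S')
    finally have 1: "(map_mat cnj (transpose_mat X) * ?S) $$ (j, i) = cnj (X $$ (i, j)) * (if i < p then 1 else - 1)"
      using that by simp
    have "(?S * X) $$ (j, i) = (\<Sum>k<n. ?S $$ (j, k) * X $$ (k, i))"
      using that X S D by (simp add: scalar_prod_def atLeast0LessThan)
    also have "\<dots> = (\<Sum>k<n. if k = j then (if j < p then 1 else - 1) * X $$ (j, i) else 0)"
      using that by (intro sum.cong refl) (auto simp: S')
    finally have 2: "(?S * X) $$ (j, i) = (if j < p then 1 else - 1) * X $$ (j, i)"
      using that by simp
    have "?L $$ (j, i) = (map_mat cnj (transpose_mat X) * ?S) $$ (j, i) + (?S * X) $$ (j, i)"
      using that X D by (intro index_add_mat) auto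
    then show ?thesis by (simp only: 1 2)
  qed
  have "?L = 0\<^sub>m n n \<longleftrightarrow> (\<forall>i<n. \<forall>j<n. ?L $$ (j, i) = 0)"
  proof (intro iffI allI impI)
    fix i j assume *: "?L = 0\<^sub>m n n" and ij: "i < n" "j < n"
    show "?L $$ (j, i) = 0" by (simp only: * index_zero_mat ij)
  next
    assume *: "\<forall>i<n. \<forall>j<n. ?L $$ (j, i) = 0"
    show "?L = 0\<^sub>m n n"
    proof (rule eq_matI)
      fix i j assume "i < dim_row (0\<^sub>m n n :: complex mat)" "j < dim_col (0\<^sub>m n n :: complex mat)"
      then have ij: "i < n" "j < n" by simp_all
      have "?L $$ (i, j) = 0" by (rule *[rule_format, OF ij(2,1)])
      then show "?L $$ (i, j) = 0\<^sub>m n n $$ (i, j)" by (simp only: index_zero_mat ij)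
    qed (simp_all only: index_add_mat index_mult_mat index_map_mat index_transpose_mat index_zero_mat X carrier_matD[OF S])
  qed
  also have "\<dots> \<longleftrightarrow> (\<forall>i<n. \<forall>j<n. X $$ (j, i) = (if (i < p) = (j < p) then - 1 else 1) * cnj (X $$ (i, j)))"
  proof (intro all_cong)
    fix i j assume ij: "i < n" "j < n"
    show "?L $$ (j, i) = 0 \<longleftrightarrow> X $$ (j, i) = (if (i < p) = (j < p) then - 1 else 1) * cnj (X $$ (i, j))"
      unfolding entry[OF ij] by (cases "i < p"; cases "j < p") (auto simp: complex_eq_iff)
  qed
  finally show ?thesis using True unfolding su_def n[symmetric] by simp
qed (auto simp: su_def n)

text \<open>Invariance is given for the real form only. A generator is
  \<open>(A - \<i> B) / 2\<close> with \<open>A\<close> and \<open>B\<close> in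
  \<open>su p q\<close>; skewness of both, with the form conjugate linear in the second argument,
  yields its adjoint.\<close>

lemma (in sl_module) unitary_form_gl:
  assumes h: "unitary_form p h" and n: "n = p + q"
  shows "unitary_gl scale V n (\<lambda>i j. act (gl_unit n i j)) p h"
proof -
  have [simp]: "n - p = q" using n by simp
  note H = h[unfolded unitary_form_def]
  note H_add = H[THEN conjunct1, rule_format]
    and H_scale = H[THEN conjunct2, THEN conjunct1, rule_format]
    and H_sym = H[THEN conjunct2, THEN conjunct2, THEN conjunct1, rule_format]
    and H_pos = H[THEN conjunct2, THEN conjunct2, THEN conjunct2, THEN conjunct1, rule_format]
    and H_su = H[THEN conjunct2, THEN conjunct2, THEN conjunct2, THEN conjunct2, rule_format]
  show ?thesis
  proof
    fix i j v w assume ij: "i < n" "j < n" and v: "v \<in> V" and w: "w \<in> V"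
    define s :: complex where "s = (if (i < p) = (j < p) then 1 else - 1)"
    let ?E = "gl_unit n i j" and ?E' = "gl_unit n j i"
    have sl: "?E \<in> sl n" "?E' \<in> sl n" using ij by (auto simp: gl_unit_sl)
    define A where "A = ?E + (- s) \<cdot>\<^sub>m ?E'"
    define B where "B = \<i> \<cdot>\<^sub>m ?E + (\<i> * s) \<cdot>\<^sub>m ?E'"
    have A: "A \<in> su p q"
      unfolding su_iff[OF n]
    proof (intro conjI allI impI)
      show "A \<in> sl n" unfolding A_def by (intro sl_add sl_smult sl)
      fix a b assume ab: "a < n" "b < n"
      show "A $$ (b, a) = (if (a < p) = (b < p) then - 1 else 1) * cnj (A $$ (a, b))"
      proof (cases "i = j")
        case True
        then show ?thesis using ab by (cases "a = b"; cases "a = i"; cases "b = i") (simp_all add: A_def s_def gl_unit_index)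
      next
        case False
        then show ?thesis using ab
          by (cases "a = i \<and> b = j"; cases "a = j \<and> b = i") (auto simp: A_def s_def gl_unit_index)
      qed
    qed
    have B: "B \<in> su p q"
      unfolding su_iff[OF n]
    proof (intro conjI allI impI)
      show "B \<in> sl n" unfolding B_def by (intro sl_add sl_smult sl)
      fix a b assume ab: "a < n" "b < n"
      show "B $$ (b, a) = (if (a < p) = (b < p) then - 1 else 1) * cnj (B $$ (a, b))"
      proof (cases "i = j")
        case True
        then show ?thesis using ab by (cases "a = b"; cases "a = i"; cases "b = i") (simp_all add: B_def s_def gl_unit_index)
      next
        case False
        then show ?thesis using ab
          by (cases "a = i \<and> b = j"; cases "a = j \<and> b = i") (auto simp: B_def s_def gl_unit_index)
      qed
    qed
    have actA: "act A u = act ?E u + scale (- s) (act ?E' u)" if "u \<in> V" for u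
      using that sl by (simp add: A_def add_act sl_smult scale_act del: scale_minus_left)
    have actB: "act B u = scale \<i> (act ?E u) + scale (\<i> * s) (act ?E' u)" if "u \<in> V" for u
      using that sl by (simp add: B_def add_act sl_smult scale_act)
    have V: "act ?E u \<in> V" "act ?E' u \<in> V" if "u \<in> V" for u
      using that sl by (auto intro: act_closed)
    have r_add: "h a (b + c) = h a b + h a c" if "a \<in> V" "b \<in> V" "c \<in> V" for a b c
      using that H_sym[OF subspace_add[OF subspace_V that(2,3)] that(1)] H_sym[OF that(2,1)] H_sym[OF that(3,1)]
        H_add[OF that(2,3,1)] by simp
    have r_scale: "h a (scale c b) = cnj c * h a b" if "a \<in> V" "b \<in> V" for a b c
      using that H_sym[OF subspace_scale[OF subspace_V that(2)] that(1)] H_sym[OF that(2,1)]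
        H_scale[OF that(2,1)] by simp
    note sc = subspace_scale[OF subspace_V]
    have cs: "cnj s = s" by (simp add: s_def)
    have "h (act A v) w = - h v (act A w)" using A v w by (intro H_su) simp_all
    then have 1: "h (act ?E v) w - s * h (act ?E' v) w = - (h v (act ?E w) - s * h v (act ?E' w))"
      using v w by (simp add: actA H_add H_scale r_add r_scale V sc cs del: scale_minus_left)
    have "h (act B v) w = - h v (act B w)" using B v w by (intro H_su) simp_all
    then have "\<i> * (h (act ?E v) w + s * h (act ?E' v) w) = \<i> * (h v (act ?E w) + s * h v (act ?E' w))"
      using v w by (simp add: actB H_add H_scale r_add r_scale V sc cs algebra_simps)
    then have 2: "h (act ?E v) w + s * h (act ?E' v) w = h v (act ?E w) + s * h v (act ?E' w)"
      by simp
    have "2 * h (act ?E v) w = 2 * (s * h v (act ?E' w))"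
    proof -
      have "2 * h (act ?E v) w = (h (act ?E v) w - s * h (act ?E' v) w) + (h (act ?E v) w + s * h (act ?E' v) w)"
        by simp
      then show ?thesis unfolding 1 2 by simp
    qed
    then show "h (act ?E v) w = (if (i < p) = (j < p) then 1 else - 1) * h v (act ?E' w)"
      by (simp add: s_def)
  qed (fact H_add H_scale H_sym H_pos)+
qed

theorem unitary_param_bound:
  assumes u: "unitary_param p q L" and L: "length L = p + q"
    and ij: "i0 < p" "p \<le> j0" "j0 < p + q"
    and gapi: "\<And>i. i0 < i \<Longrightarrow> i < p \<Longrightarrow> L ! i0 - L ! i \<ge> 2"
    and gapj: "\<And>j. p \<le> j \<Longrightarrow> j < j0 \<Longrightarrow> L ! j - L ! j0 \<ge> 2"
  shows "L ! i0 - L ! j0 \<le> 1"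
proof -
  define n where "n = p + q"
  define lam where "lam = map2 (-) L (rho n)"
  have lam: "lam ! i = L ! i - ((real n - 1) / 2 - real i)" if "i < n" for i
    using that L by (simp add: lam_def rho_def n_def)
  obtain V act h where isL: "is_L seq_scale p q lam V act" and h: "sl_module.unitary_form seq_scale n V act p h"
    using u unfolding unitary_param_def lam_def n_def by blast
  interpret M: sl_module seq_scale n V act
    using isL by (simp add: is_L_def n_def)
  interpret U: unitary_gl seq_scale V n "\<lambda>i j. act (gl_unit n i j)" p h
    using h n_def by (rule M.unitary_form_gl)
  obtain v where v: "M.highest_weight_vector lam v"
    using isL unfolding is_L_def n_def by blast
  \<comment> \<open>Removing traces from the matrix units shifts all weights by their mean, which
    cancels in differences.\<close>
  define avg where "avg = (\<Sum>i<n. lam ! i) / n"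
  have raise: "act (gl_unit n i j) v = 0" if "i < j" "j < n" for i j
    using v that by (simp add: M.highest_weight_vector_def gl_unit_root)
  have weight: "act (gl_unit n i i) v = seq_scale (of_real (lam ! i - avg)) v" if "i < n" for i
  proof -
    have "(\<Sum>k<n. complex_of_real (lam ! k) * gl_unit n i i $$ (k, k))
        = (\<Sum>k<n. (if k = i then complex_of_real (lam ! k) else 0) - complex_of_real (lam ! k) / of_nat n)"
      by (intro sum.cong refl) (auto simp: gl_unit_index algebra_simps)
    also have "\<dots> = of_real (lam ! i - avg)"
      using that by (simp add: sum_subtractf avg_def sum_divide_distrib)
    finally have "(\<Sum>k<n. complex_of_real (lam ! k) * gl_unit n i i $$ (k, k)) = of_real (lam ! i - avg)" .
    moreover have "diagonal_mat (gl_unit n i i)"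
      by (auto simp: diagonal_mat_def gl_unit_index)
    ultimately show ?thesis
      using v that gl_unit_sl[OF that that] unfolding M.highest_weight_vector_def by auto
  qed
  \<comment> \<open>Subtracting the index is adding \<open>rho\<close> up to a constant, so the gaps
    demanded by \<open>highest_weight_bound\<close> are differences of coordinates of the
    parameter.\<close>
  have sh: "lam ! i - avg - i = L ! i - ((real n - 1) / 2 + avg)" if "i < n" for i
    using lam[OF that] by simp
  have "(lam ! i0 - avg - i0) - (lam ! j0 - avg - j0) \<le> 1"
  proof (rule U.highest_weight_bound[of v "\<lambda>i. lam ! i - avg"])
    show "v \<in> V" "v \<noteq> 0" using v by (auto simp: M.highest_weight_vector_def)
    show "i0 < p" "p \<le> j0" "j0 < n" using ij by (auto simp: n_def)
    show "(lam ! i0 - avg - i0) - (lam ! i - avg - i) \<ge> 2" if "i0 < i" "i < p" for i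
      using gapi[OF that] that sh[of i0] sh[of i] by (simp add: n_def)
    show "(lam ! j - avg - j) - (lam ! j0 - avg - j0) \<ge> 2" if "p \<le> j" "j < j0" for j
      using gapj[OF that] that sh[of j0] sh[of j] ij by (simp add: n_def)
  qed (use raise weight in auto)
  then show ?thesis
    using sh[of i0] sh[of j0] ij by (simp add: n_def)
qed

section \<open>The Fischer inner product\<close>

text \<open>A monomial is the multiset of its variables, so the convolution product of
  \<open>poly_mapping\<close> is multiplication of polynomials. Variables are arbitrary natural
  numbers; one type serves all matrix sizes.\<close>

type_synonym mpoly = "nat multiset \<Rightarrow>\<^sub>0 complex"

lemma mpoly_induct [case_names zero monom add]:
  assumes "P (0 :: mpoly)" "\<And>\<alpha> c. P (Poly_Mapping.single \<alpha> c)" "\<And>f g. P f \<Longrightarrow> P g \<Longrightarrow> P (f + g)"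
  shows "P f"
proof (induction f rule: update_induct)
  case (update f a b)
  have "Poly_Mapping.update a b f = f + Poly_Mapping.single a b"
    using update.hyps by (intro poly_mapping_eqI) (auto simp: lookup_update lookup_add lookup_single when_def in_keys_iff)
  then show ?case using update assms by simp
qed (fact assms)

definition mconst :: "complex \<Rightarrow> mpoly" where
  "mconst c = Poly_Mapping.single {#} c"

definition mvar :: "nat \<Rightarrow> mpoly" where
  "mvar x = Poly_Mapping.single {#x#} 1"

lift_definition pderivative :: "nat \<Rightarrow> mpoly \<Rightarrow> mpoly" is
  "\<lambda>x f \<alpha>. of_nat (Suc (count \<alpha> x)) * f (add_mset x \<alpha>)"
proof -
  fix x and f :: "nat multiset \<Rightarrow> complex" assume "finite {\<alpha>. f \<alpha> \<noteq> 0}"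
  then have "finite (add_mset x -` {\<alpha>. f \<alpha> \<noteq> 0})" by (intro finite_vimageI) (auto intro: injI)
  then show "finite {\<alpha>. of_nat (Suc (count \<alpha> x)) * f (add_mset x \<alpha>) \<noteq> 0}"
    by (rule rev_finite_subset) auto
qed

lemmas lookup_pderivative = pderivative.rep_eq

lemma mconst_simps: "mconst 0 = 0" "mconst 1 = 1" "mconst (a + b) = mconst a + mconst b"
  "mconst (a * b) = mconst a * mconst b" "mconst (- a) = - mconst a" "mconst (a - b) = mconst a - mconst b"
  using mult_single[of "{#}" a "{#}" b, symmetric]
  by (simp_all add: mconst_def single_add single_uminus single_diff single_one[folded zero_multiset_def])

lemma lookup_mconst_mult: "Poly_Mapping.lookup (mconst c * f) \<alpha> = c * Poly_Mapping.lookup f \<alpha>"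
  by (induction f rule: mpoly_induct)
    (auto simp: mconst_def mult_single lookup_single when_def lookup_add distrib_left)

lemma lookup_mvar_mult: "Poly_Mapping.lookup (mvar x * f) \<alpha> = (if x \<in># \<alpha> then Poly_Mapping.lookup f (\<alpha> - {#x#}) else 0)"
proof (induction f rule: mpoly_induct)
  case (monom \<beta> c)
  show ?case by (auto simp: mvar_def mult_single lookup_single when_def)
qed (auto simp: lookup_add distrib_left)

lemma vector_space_mpoly: "vector_space (\<lambda>c. (*) (mconst c))"
  by unfold_locales (auto simp: mconst_simps algebra_simps)

lemma pderivative_add: "pderivative x (f + g) = pderivative x f + pderivative x g"
  by (intro poly_mapping_eqI) (simp add: lookup_pderivative lookup_add algebra_simps)

lemma pderivative_zero: "pderivative x 0 = 0"
  by (intro poly_mapping_eqI) (simp add: lookup_pderivative)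

lemma pderivative_single:
  "pderivative x (Poly_Mapping.single \<alpha> c) = Poly_Mapping.single (\<alpha> - {#x#}) (of_nat (count \<alpha> x) * c)"
proof (intro poly_mapping_eqI)
  fix \<beta>
  show "Poly_Mapping.lookup (pderivative x (Poly_Mapping.single \<alpha> c)) \<beta>
      = Poly_Mapping.lookup (Poly_Mapping.single (\<alpha> - {#x#}) (of_nat (count \<alpha> x) * c)) \<beta>"
    by (cases "x \<in># \<alpha>") (auto simp: lookup_pderivative lookup_single when_def not_in_iff)
qed

lemma pderivative_mult: "pderivative x (f * g) = pderivative x f * g + f * pderivative x g"
proof (induction f rule: mpoly_induct)
  case (monom \<alpha> a)
  show ?case
  proof (induction g rule: mpoly_induct)
    case (monom \<beta> b)
    have 1: "Poly_Mapping.single (\<alpha> - {#x#} + \<beta>) (of_nat (count \<alpha> x) * a * b)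
        = Poly_Mapping.single (\<alpha> + \<beta> - {#x#}) (of_nat (count \<alpha> x) * a * b)"
      by (cases "x \<in># \<alpha>") (auto simp: not_in_iff)
    have 2: "Poly_Mapping.single (\<alpha> + (\<beta> - {#x#})) (a * (of_nat (count \<beta> x) * b))
        = Poly_Mapping.single (\<alpha> + \<beta> - {#x#}) (a * (of_nat (count \<beta> x) * b))"
      by (cases "x \<in># \<beta>") (auto simp: not_in_iff)
    show ?case
      unfolding mult_single pderivative_single 1 2 single_add[symmetric] by (simp add: algebra_simps)
  qed (simp_all add: pderivative_zero pderivative_add distrib_left algebra_simps)
qed (simp_all add: pderivative_zero pderivative_add distrib_right algebra_simps)

lemma pderivative_commute: "pderivative x (pderivative y f) = pderivative y (pderivative x f)"
  by (intro poly_mapping_eqI) (auto simp: lookup_pderivative add_mset_commute)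

lemma pderivative_mconst_mult: "pderivative x (mconst c * f) = mconst c * pderivative x f"
  by (intro poly_mapping_eqI) (simp add: lookup_pderivative lookup_mconst_mult)

lemma pderivative_mvar: "pderivative x (mvar y) = (if x = y then 1 else 0)"
  by (auto simp: mvar_def pderivative_single single_one[folded zero_multiset_def])

lemma pderivative_uminus: "pderivative x (- f) = - pderivative x f"
  using pderivative_mconst_mult[of x "-1" f] by (simp add: mconst_simps)

definition mfact :: "nat multiset \<Rightarrow> real" where
  "mfact \<alpha> = (\<Prod>x\<in>set_mset \<alpha>. fact (count \<alpha> x))"

lemma mfact_pos: "mfact \<alpha> > 0"
  by (auto simp: mfact_def intro!: prod_pos)

lemma mfact_add_mset: "mfact (add_mset x \<alpha>) = real (Suc (count \<alpha> x)) * mfact \<alpha>"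
proof -
  have 1: "mfact \<beta> = (\<Prod>y\<in>insert x (set_mset \<alpha>). fact (count \<beta> y))"
    if "set_mset \<beta> \<subseteq> insert x (set_mset \<alpha>)" for \<beta>
    unfolding mfact_def using that by (intro prod.mono_neutral_left) (auto simp: not_in_iff)
  have "mfact (add_mset x \<alpha>) = fact (count (add_mset x \<alpha>) x) * (\<Prod>y\<in>set_mset \<alpha> - {x}. fact (count (add_mset x \<alpha>) y))"
    unfolding 1[of "add_mset x \<alpha>", simplified] by (subst prod.insert_remove) auto
  also have "(\<Prod>y\<in>set_mset \<alpha> - {x}. fact (count (add_mset x \<alpha>) y)) = (\<Prod>y\<in>set_mset \<alpha> - {x}. fact (count \<alpha> y) :: real)"
    by (intro prod.cong) auto
  also have "fact (count (add_mset x \<alpha>) x) * (\<Prod>y\<in>set_mset \<alpha> - {x}. fact (count \<alpha> y) :: real)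
      = real (Suc (count \<alpha> x)) * (fact (count \<alpha> x) * (\<Prod>y\<in>set_mset \<alpha> - {x}. fact (count \<alpha> y)))"
    by (simp add: algebra_simps)
  also have "fact (count \<alpha> x) * (\<Prod>y\<in>set_mset \<alpha> - {x}. fact (count \<alpha> y)) = mfact \<alpha>"
    by (subst 1) (auto simp: prod.insert_remove)
  finally show ?thesis .
qed

text \<open>Distinct monomials are orthogonal, and the squared norm of a monomial is the product of
  the factorials of its exponents.\<close>

definition fischer :: "mpoly \<Rightarrow> mpoly \<Rightarrow> complex" where
  "fischer f g = (\<Sum>\<alpha>\<in>Poly_Mapping.keys f. of_real (mfact \<alpha>) * Poly_Mapping.lookup f \<alpha> * cnj (Poly_Mapping.lookup g \<alpha>))"

lemma fischer_eq:
  assumes "finite A" "Poly_Mapping.keys f \<subseteq> A"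
  shows "fischer f g = (\<Sum>\<alpha>\<in>A. of_real (mfact \<alpha>) * Poly_Mapping.lookup f \<alpha> * cnj (Poly_Mapping.lookup g \<alpha>))"
  unfolding fischer_def using assms by (intro sum.mono_neutral_left) (auto simp: in_keys_iff)

lemma fischer_add: "fischer (f + g) h = fischer f h + fischer g h"
proof -
  let ?A = "Poly_Mapping.keys f \<union> Poly_Mapping.keys g"
  have "Poly_Mapping.keys (f + g) \<subseteq> ?A" by (rule Poly_Mapping.keys_add)
  then show ?thesis
    using fischer_eq[of ?A "f + g" h] fischer_eq[of ?A f h] fischer_eq[of ?A g h]
    by (simp add: lookup_add sum.distrib[symmetric] algebra_simps)
qed

lemma keys_mconst_mult: "Poly_Mapping.keys (mconst c * f) \<subseteq> Poly_Mapping.keys f"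
  by (auto simp: in_keys_iff lookup_mconst_mult)

lemma fischer_mconst_mult: "fischer (mconst c * f) g = c * fischer f g"
  using fischer_eq[of "Poly_Mapping.keys f" "mconst c * f" g] keys_mconst_mult[of c f]
  by (simp add: fischer_def lookup_mconst_mult sum_distrib_left) (simp add: mult.left_commute mult.assoc)

lemma fischer_sym: "fischer g f = cnj (fischer f g)"
proof -
  let ?A = "Poly_Mapping.keys f \<union> Poly_Mapping.keys g"
  show ?thesis
    using fischer_eq[of ?A f g] fischer_eq[of ?A g f] by (simp add: algebra_simps)
qed

lemma fischer_pos:
  assumes "f \<noteq> 0"
  shows "Re (fischer f f) > 0"
proof -
  have "fischer f f = (\<Sum>\<alpha>\<in>Poly_Mapping.keys f. of_real (mfact \<alpha> * (cmod (Poly_Mapping.lookup f \<alpha>))\<^sup>2))"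
    unfolding fischer_def by (intro sum.cong refl) (simp add: complex_norm_square[symmetric] mult.assoc)
  then have "Re (fischer f f) = (\<Sum>\<alpha>\<in>Poly_Mapping.keys f. mfact \<alpha> * (cmod (Poly_Mapping.lookup f \<alpha>))\<^sup>2)"
    by simp
  also have "\<dots> > 0"
    using assms by (intro sum_pos) (auto simp: mfact_pos in_keys_iff)
  finally show ?thesis .
qed

lemma keys_mvar_mult: "Poly_Mapping.keys (mvar x * f) = add_mset x ` Poly_Mapping.keys f"
  by (auto simp: in_keys_iff lookup_mvar_mult split: if_splits intro!: image_eqI[of _ _ "_ - {#x#}"])

text \<open>Raising an exponent multiplies the squared norm of a monomial by the new exponent, which
  is the factor produced by differentiation. All adjointness in the oscillator representation comes
  from here.\<close>

lemma fischer_mvar_mult: "fischer (mvar x * f) g = fischer f (pderivative x g)"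
  unfolding fischer_def keys_mvar_mult
  by (subst sum.reindex)
    (auto simp: lookup_mvar_mult lookup_pderivative mfact_add_mset intro!: sum.cong inj_onI simp del: of_nat_Suc)

section \<open>Derivations and determinants\<close>

lemma permutes_less: "\<pi> permutes {0..<r} \<Longrightarrow> i < r \<Longrightarrow> \<pi> i < (r::nat)"
  using permutes_in_image[of \<pi> "{0..<r}" i] by auto

lemma det_expand: "det (mat r r M) = (\<Sum>\<pi>\<in>{\<pi>. \<pi> permutes {0..<r}}. signof \<pi> * (\<Prod>i=0..<r. M (i, \<pi> i)))"
  for M :: "nat \<times> nat \<Rightarrow> 'a::comm_ring_1"
proof -
  have "(\<Prod>i=0..<r. mat r r M $$ (i, \<pi> i)) = (\<Prod>i=0..<r. M (i, \<pi> i))" if "\<pi> permutes {0..<r}" for \<pi>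
    using that by (intro prod.cong refl) (simp add: permutes_less)
  then show ?thesis by (simp add: det_def'[of _ r])
qed

text \<open>Covers partial derivatives and polarizations at once. Eigenvalues are ring elements, so
  weights of products of minors can be added without a scalar action.\<close>

locale derivation =
  fixes d :: "'a::comm_ring_1 \<Rightarrow> 'a"
  assumes add: "d (f + g) = d f + d g"
    and mult: "d (f * g) = d f * g + f * d g"
begin

lemma zero: "d 0 = 0"
  using add[of 0 0] by simp

lemma one: "d 1 = 0"
  using mult[of 1 1] by simp

lemma minus: "d (- f) = - d f"
  using add[of f "- f"] zero by (simp add: eq_neg_iff_add_eq_0 add.commute)

lemma sum: "d (\<Sum>i\<in>I. f i) = (\<Sum>i\<in>I. d (f i))"
  by (induction I rule: infinite_finite_induct) (auto simp: zero add)

lemma prod: "finite I \<Longrightarrow> d (\<Prod>i\<in>I. f i) = (\<Sum>s\<in>I. \<Prod>i\<in>I. if i = s then d (f i) else f i)"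
proof (induction I rule: finite_induct)
  case (insert x I)
  have *: "(\<Prod>i\<in>I. if i = x then d (f i) else f i) = (\<Prod>i\<in>I. f i)"
    using insert.hyps by (intro prod.cong) auto
  have **: "(\<Sum>s\<in>I. \<Prod>i\<in>insert x I. if i = s then d (f i) else f i)
      = (\<Sum>s\<in>I. f x * (\<Prod>i\<in>I. if i = s then d (f i) else f i))"
    using insert.hyps by (intro sum.cong refl) auto
  have "d (\<Prod>i\<in>insert x I. f i) = d (f x) * (\<Prod>i\<in>I. f i) + f x * (\<Sum>s\<in>I. \<Prod>i\<in>I. if i = s then d (f i) else f i)"
    using insert by (simp add: mult)
  then show ?case
    unfolding sum.insert[OF insert.hyps] ** sum_distrib_left
    by (simp add: prod.insert[OF insert.hyps] *)
qed (simp add: one)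

lemma signof: "d (signof \<pi> * f) = signof \<pi> * d f"
  by (simp add: sign_def minus)

text \<open>In each term of the Leibniz expansion the derivation hits one factor; collecting the
  terms by the row of that factor gives one determinant per row.\<close>

lemma det:
  "d (det (mat r r M)) = (\<Sum>s<r. det (mat r r (\<lambda>(i, j). if i = s then d (M (i, j)) else M (i, j))))"
proof -
  have "d (det (mat r r M)) = (\<Sum>\<pi>\<in>{\<pi>. \<pi> permutes {0..<r}}. signof \<pi> * d (\<Prod>i=0..<r. M (i, \<pi> i)))"
    unfolding det_expand sum signof ..
  also have "\<dots> = (\<Sum>\<pi>\<in>{\<pi>. \<pi> permutes {0..<r}}. \<Sum>s\<in>{0..<r}. signof \<pi> * (\<Prod>i=0..<r. if i = s then d (M (i, \<pi> i)) else M (i, \<pi> i)))"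
    by (simp only: prod[OF finite_atLeastLessThan] sum_distrib_left)
  also have "\<dots> = (\<Sum>s\<in>{0..<r}. \<Sum>\<pi>\<in>{\<pi>. \<pi> permutes {0..<r}}. signof \<pi> * (\<Prod>i=0..<r. if i = s then d (M (i, \<pi> i)) else M (i, \<pi> i)))"
    by (rule sum.swap)
  also have "\<dots> = (\<Sum>s<r. det (mat r r (\<lambda>(i, j). if i = s then d (M (i, j)) else M (i, j))))"
    by (simp only: det_expand atLeast0LessThan split_conv)
  finally show ?thesis .
qed

lemma eigen_mult: "d f = a * f \<Longrightarrow> d g = b * g \<Longrightarrow> d (f * g) = (a + b) * (f * g)"
  by (simp add: mult algebra_simps)

lemma eigen_power: "d f = a * f \<Longrightarrow> d (f ^ e) = (of_nat e * a) * f ^ e"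
proof (induction e)
  case (Suc e)
  then show ?case using eigen_mult[OF Suc.prems Suc.IH[OF Suc.prems]] by (simp add: distrib_right)
qed (simp add: one)

lemma eigen_prod: "(\<And>i. i \<in> I \<Longrightarrow> d (f i) = a i * f i) \<Longrightarrow> d (\<Prod>i\<in>I. f i) = (\<Sum>i\<in>I. a i) * (\<Prod>i\<in>I. f i)"
  by (induction I rule: infinite_finite_induct) (auto simp: one eigen_mult)

end

lemma derivation_pderivative: "derivation (pderivative x)"
  by unfold_locales (auto simp: pderivative_add pderivative_mult)

section \<open>Unitary highest weight modules\<close>

lemma foldr_commute:
  assumes "\<And>a b x. S a (S b x) = S b (S a x)"
  shows "foldr S as (foldr S bs x) = foldr S bs (foldr S as x)"
proof -
  have "foldr S as (S b x) = S b (foldr S as x)" for b x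
    by (induction as) (simp_all add: assms)
  then show ?thesis by (induction bs) simp_all
qed

locale highest_weight_gl = unitary_gl scale UNIV n E p h
  for scale :: "complex \<Rightarrow> 'v::ab_group_add \<Rightarrow> 'v" and n E p h +
  fixes f :: 'v and wt :: "nat \<Rightarrow> real"
  assumes f_nonzero: "f \<noteq> 0"
    and raise_f: "\<And>i j. i < j \<Longrightarrow> j < n \<Longrightarrow> E i j f = 0"
    and weight_f: "\<And>i. i < n \<Longrightarrow> E i i f = scale (of_real (wt i)) f"
begin

text \<open>The submodule generated by \<open>f\<close>. Only lowering operators occur in the rules,
  so an induction never has to go up in weight.\<close>

inductive_set N :: "'v set" where
  N_f: "f \<in> N"
| N_add: "x \<in> N \<Longrightarrow> y \<in> N \<Longrightarrow> x + y \<in> N"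
| N_scale: "x \<in> N \<Longrightarrow> scale c x \<in> N"
| N_lower: "x \<in> N \<Longrightarrow> j < i \<Longrightarrow> i < n \<Longrightarrow> E i j x \<in> N"

lemma subspace_N: "subspace N"
  using N_scale[OF N_f, of 0] by (intro subspaceI) (auto intro: N_add N_scale)

text \<open>A generator is moved past the outermost lowering operator. The commutator consists of
  generators applied to the smaller vector \<open>x\<close>, which the induction hypothesis covers
  for all index pairs.\<close>

lemma N_E: "x \<in> N \<Longrightarrow> i < n \<Longrightarrow> j < n \<Longrightarrow> E i j x \<in> N"
proof (induction arbitrary: i j rule: N.induct)
  case N_f
  then show ?case
    using subspace_0[OF subspace_N]
    by (cases i j rule: linorder_cases) (auto simp: raise_f weight_f intro: N.intros)
next
  case (N_lower x l k)
  have "E i j (E k l x) = E k l (E i j x) + ((if j = k then E i l x else 0) - (if i = l then E k j x else 0))"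
    using bracket[of i j k l x] N_lower by (simp add: algebra_simps)
  moreover have "E k l (E i j x) \<in> N" "E i l x \<in> N" "E k j x \<in> N"
    using N_lower by (auto intro: N.N_lower)
  ultimately show ?case
    using subspace_0[OF subspace_N] by (auto intro!: subspace_add[OF subspace_N] subspace_diff[OF subspace_N])
qed (auto simp: add scal intro: N.intros)

definition act :: "complex mat \<Rightarrow> 'v \<Rightarrow> 'v" where
  "act X x = (\<Sum>i<n. \<Sum>j<n. scale (X $$ (i, j)) (E i j x))"

lemma E_sum: "i < n \<Longrightarrow> j < n \<Longrightarrow> E i j (\<Sum>a\<in>I. g a) = (\<Sum>a\<in>I. E i j (g a))"
  by (rule sums) auto

lemma act_act: "act X (act Y x) = (\<Sum>i<n. \<Sum>j<n. \<Sum>k<n. \<Sum>l<n. scale (X $$ (i, j) * Y $$ (k, l)) (E i j (E k l x)))"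
  unfolding act_def by (intro sum.cong refl) (simp add: E_sum scal scale_sum_right)

lemma act_bracket_N:
  assumes "X \<in> carrier_mat n n" "Y \<in> carrier_mat n n"
  shows "act (X * Y - Y * X) x = act X (act Y x) - act Y (act X x)"
proof -
  have prod: "(A * B) $$ (i, l) = (\<Sum>j<n. A $$ (i, j) * B $$ (j, l))"
    if "A \<in> carrier_mat n n" "B \<in> carrier_mat n n" "i < n" "l < n" for A B :: "complex mat" and i l
    using that by (auto simp: scalar_prod_def atLeast0LessThan)
  have "act Y (act X x) = (\<Sum>k<n. \<Sum>l<n. \<Sum>i<n. \<Sum>j<n. scale (X $$ (i, j) * Y $$ (k, l)) (E k l (E i j x)))"
    unfolding act_act by (simp add: mult.commute)
  also have "\<dots> = (\<Sum>k<n. \<Sum>i<n. \<Sum>l<n. \<Sum>j<n. scale (X $$ (i, j) * Y $$ (k, l)) (E k l (E i j x)))"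
    by (intro sum.cong refl sum.swap)
  also have "\<dots> = (\<Sum>i<n. \<Sum>k<n. \<Sum>l<n. \<Sum>j<n. scale (X $$ (i, j) * Y $$ (k, l)) (E k l (E i j x)))"
    by (rule sum.swap)
  also have "\<dots> = (\<Sum>i<n. \<Sum>k<n. \<Sum>j<n. \<Sum>l<n. scale (X $$ (i, j) * Y $$ (k, l)) (E k l (E i j x)))"
    by (intro sum.cong refl sum.swap)
  also have "\<dots> = (\<Sum>i<n. \<Sum>j<n. \<Sum>k<n. \<Sum>l<n. scale (X $$ (i, j) * Y $$ (k, l)) (E k l (E i j x)))"
    by (intro sum.cong refl sum.swap)
  finally have "act X (act Y x) - act Y (act X x) =
    (\<Sum>i<n. \<Sum>j<n. \<Sum>k<n. \<Sum>l<n. scale (X $$ (i, j) * Y $$ (k, l)) (E i j (E k l x) - E k l (E i j x)))"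
    unfolding act_act by (simp add: sum_subtractf scale_right_diff_distrib)
  also have "\<dots> = (\<Sum>i<n. \<Sum>j<n. \<Sum>k<n. \<Sum>l<n. (if j = k then scale (X $$ (i, j) * Y $$ (k, l)) (E i l x) else 0)
      - (if i = l then scale (X $$ (i, j) * Y $$ (k, l)) (E k j x) else 0))"
    by (intro sum.cong refl) (simp add: bracket scale_right_diff_distrib)
  also have "\<dots> = (\<Sum>i<n. \<Sum>j<n. \<Sum>k<n. \<Sum>l<n. if j = k then scale (X $$ (i, j) * Y $$ (k, l)) (E i l x) else 0)
      - (\<Sum>i<n. \<Sum>j<n. \<Sum>k<n. \<Sum>l<n. if i = l then scale (X $$ (i, j) * Y $$ (k, l)) (E k j x) else 0)"
    by (simp only: sum_subtractf)
  also have "(\<Sum>i<n. \<Sum>j<n. \<Sum>k<n. \<Sum>l<n. if j = k then scale (X $$ (i, j) * Y $$ (k, l)) (E i l x) else 0)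
      = (\<Sum>i<n. \<Sum>j<n. \<Sum>l<n. scale (X $$ (i, j) * Y $$ (j, l)) (E i l x))"
  proof (rule sum.cong[OF refl], rule sum.cong[OF refl])
    fix i j assume "j \<in> {..<n}"
    have "(\<Sum>k<n. \<Sum>l<n. if j = k then scale (X $$ (i, j) * Y $$ (k, l)) (E i l x) else 0)
        = (\<Sum>k<n. if j = k then \<Sum>l<n. scale (X $$ (i, j) * Y $$ (k, l)) (E i l x) else 0)"
      by (intro sum.cong refl) simp
    then show "(\<Sum>k<n. \<Sum>l<n. if j = k then scale (X $$ (i, j) * Y $$ (k, l)) (E i l x) else 0)
        = (\<Sum>l<n. scale (X $$ (i, j) * Y $$ (j, l)) (E i l x))"
      using \<open>j \<in> {..<n}\<close> by simp
  qed
  also have "\<dots> = (\<Sum>i<n. \<Sum>l<n. \<Sum>j<n. scale (X $$ (i, j) * Y $$ (j, l)) (E i l x))"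
    by (intro sum.cong refl sum.swap)
  also have "\<dots> = (\<Sum>i<n. \<Sum>l<n. scale ((X * Y) $$ (i, l)) (E i l x))"
    using assms by (intro sum.cong refl) (simp add: prod scale_sum_left del: index_mult_mat)
  also have "(\<Sum>i<n. \<Sum>j<n. \<Sum>k<n. \<Sum>l<n. if i = l then scale (X $$ (i, j) * Y $$ (k, l)) (E k j x) else 0)
      = (\<Sum>i<n. \<Sum>j<n. \<Sum>k<n. scale (Y $$ (k, i) * X $$ (i, j)) (E k j x))"
    by (intro sum.cong refl) (simp add: mult.commute)
  also have "\<dots> = (\<Sum>i<n. \<Sum>k<n. \<Sum>j<n. scale (Y $$ (k, i) * X $$ (i, j)) (E k j x))"
    by (intro sum.cong refl sum.swap)
  also have "\<dots> = (\<Sum>k<n. \<Sum>i<n. \<Sum>j<n. scale (Y $$ (k, i) * X $$ (i, j)) (E k j x))"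
    by (rule sum.swap)
  also have "\<dots> = (\<Sum>k<n. \<Sum>j<n. \<Sum>i<n. scale (Y $$ (k, i) * X $$ (i, j)) (E k j x))"
    by (intro sum.cong refl sum.swap)
  also have "\<dots> = (\<Sum>k<n. \<Sum>j<n. scale ((Y * X) $$ (k, j)) (E k j x))"
    using assms by (intro sum.cong refl) (simp add: prod scale_sum_left del: index_mult_mat)
  also have "(\<Sum>i<n. \<Sum>l<n. scale ((X * Y) $$ (i, l)) (E i l x)) - (\<Sum>k<n. \<Sum>j<n. scale ((Y * X) $$ (k, j)) (E k j x))
      = act (X * Y - Y * X) x"
    using assms by (simp add: act_def sum_subtractf[symmetric] scale_left_diff_distrib)
  finally show ?thesis ..
qed

sublocale N: sl_module scale n N act
proof
  show "subspace N" by (rule subspace_N)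
  show "act X v \<in> N" if "v \<in> N" for X v
    unfolding act_def using that by (auto intro!: subspace_sum[OF subspace_N] N_scale N_E)
  show "act (X * Y - Y * X) v = act X (act Y v) - act Y (act X v)" if "X \<in> sl n" "Y \<in> sl n" for X Y v
    using that by (intro act_bracket_N) (auto simp: sl_def)
  show "act X (v + w) = act X v + act X w" for X v w
    by (simp add: act_def add scale_right_distrib sum.distrib)
  show "act X (scale c v) = scale c (act X v)" for X c v
    by (simp add: act_def scal scale_sum_right mult.commute)
  show "act (X + Y) v = act X v + act Y v" if "X \<in> sl n" "Y \<in> sl n" for X Y v
    using that by (auto simp: sl_def act_def scale_left_distrib sum.distrib)
  show "act (c \<cdot>\<^sub>m X) v = scale c (act X v)" if "X \<in> sl n" for X c v
    using that by (auto simp: sl_def act_def scale_sum_right)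
qed

lemma act_diagonal:
  assumes "X \<in> carrier_mat n n" "diagonal_mat X"
  shows "act X x = (\<Sum>i<n. scale (X $$ (i, i)) (E i i x))"
proof -
  have "(\<Sum>j<n. scale (X $$ (i, j)) (E i j x)) = (\<Sum>j<n. if j = i then scale (X $$ (i, i)) (E i i x) else 0)"
    if "i < n" for i
    using assms that by (intro sum.cong refl) (auto simp: diagonal_mat_def)
  then show ?thesis by (simp add: act_def)
qed

lemma act_root_vector: "i < n \<Longrightarrow> j < n \<Longrightarrow> act (root_vector n i j) x = E i j x"
proof -
  assume ij: "i < n" "j < n"
  have "act (root_vector n i j) x = (\<Sum>k<n. \<Sum>l<n. if l = j then if k = i then E i j x else 0 else 0)"
    unfolding act_def by (intro sum.cong refl) (auto simp: root_vector_def)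
  then show ?thesis using ij by simp
qed

lemma root_vector_sl: "i < n \<Longrightarrow> j < n \<Longrightarrow> i \<noteq> j \<Longrightarrow> root_vector n i j \<in> sl n"
  using gl_unit_sl[of i n j] by (simp add: gl_unit_root)

lemma h_add_right: "h w (x + y) = h w x + h w y"
  using h_add[of x y w] h_sym[of "x + y" w] h_sym[of x w] h_sym[of y w] by simp

lemma h_scale_right: "h w (scale c x) = cnj c * h w x"
  using h_scale[of x w c] h_sym[of "scale c x" w] h_sym[of x w] by simp

lemma h_act:
  assumes X: "X \<in> su p q" and n: "n = p + q"
  shows "h (act X v) w = - h v (act X w)"
proof -
  have "h (act X v) w = (\<Sum>i<n. \<Sum>j<n. X $$ (i, j) * h (E i j v) w)"
    by (simp add: act_def h_sum_left h_scale)
  also have "\<dots> = (\<Sum>i<n. \<Sum>j<n. - (cnj (X $$ (j, i)) * h v (E j i w)))"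
  proof (intro sum.cong refl)
    fix i j assume "i \<in> {..<n}" "j \<in> {..<n}"
    then have ij: "i < n" "j < n" by auto
    have su: "X $$ (i, j) = (if (j < p) = (i < p) then - 1 else 1) * cnj (X $$ (j, i))"
      using X ij unfolding su_iff[OF n] by blast
    have adj: "h (E i j v) w = (if (i < p) = (j < p) then 1 else - 1) * h v (E j i w)"
      using ij by (intro h_adj) auto
    show "X $$ (i, j) * h (E i j v) w = - (cnj (X $$ (j, i)) * h v (E j i w))"
      unfolding su adj by (cases "i < p"; cases "j < p") simp_all
  qed
  also have "\<dots> = - (\<Sum>j<n. \<Sum>i<n. cnj (X $$ (j, i)) * h v (E j i w))"
    by (subst sum.swap) (simp add: sum_negf)
  also have "\<dots> = - h v (act X w)"
    by (simp add: act_def h_sum_right h_scale_right)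
  finally show ?thesis .
qed

lemma unitary_form_N:
  assumes n: "n = p + q"
  shows "N.unitary_form p h"
proof -
  have "n - p = q" using n by simp
  then show ?thesis
    unfolding N.unitary_form_def using h_act[OF _ n]
    by (auto simp: h_add h_scale h_pos) (rule h_sym; simp)
qed

lemma highest_weight_vector_N:
  assumes wt: "\<And>i. i < n \<Longrightarrow> wt i = lam ! i - t"
  shows "N.highest_weight_vector lam f"
  unfolding N.highest_weight_vector_def
proof (intro conjI allI impI ballI)
  show "f \<in> N" "f \<noteq> 0" by (rule N_f) (rule f_nonzero)
  show "act (root_vector n i j) f = 0" if "i < j \<and> j < n" for i j
    using that by (simp add: act_root_vector raise_f)
  fix H :: "complex mat" assume H: "H \<in> sl n" "diagonal_mat H"
  then have tr: "(\<Sum>i<n. H $$ (i, i)) = 0" by (simp add: sl_def)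
  have "act H f = (\<Sum>i<n. scale (H $$ (i, i) * of_real (lam ! i - t)) f)"
    using H by (simp add: act_diagonal sl_carrier weight_f wt)
  also have "\<dots> = scale (\<Sum>i<n. complex_of_real (lam ! i) * H $$ (i, i) - of_real t * H $$ (i, i)) f"
    unfolding scale_sum_left by (intro sum.cong refl arg_cong[where f = "\<lambda>c. scale c f"]) (simp add: algebra_simps)
  also have "(\<Sum>i<n. complex_of_real (lam ! i) * H $$ (i, i) - of_real t * H $$ (i, i)) = (\<Sum>i<n. complex_of_real (lam ! i) * H $$ (i, i))"
    by (simp add: sum_subtractf sum_distrib_left[symmetric] tr)
  finally show "act H f = scale (\<Sum>i<n. complex_of_real (lam ! i) * H $$ (i, i)) f" .
qed

text \<open>The coordinates of \<open>rho\<close>. They sum to 0 and fall by one per index, so each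
  lowering operator decreases the eigenvalue of \<open>T\<close> by a positive integer.\<close>

definition grade :: "nat \<Rightarrow> real" where
  "grade i = (real n - 1) / 2 - real i"

definition T :: "'v \<Rightarrow> 'v" where
  "T x = (\<Sum>i<n. scale (of_real (grade i)) (E i i x))"

text \<open>Call the drop of the \<open>T\<close>-eigenvalue below that of \<open>f\<close> the
  depth. On vectors of depth \<open>d\<close> the operator \<open>S a\<close> is multiplication by
  \<open>a - d\<close>: it kills depth \<open>a\<close> and multiplies \<open>f\<close> by
  \<open>a\<close>.\<close>

definition S :: "nat \<Rightarrow> 'v \<Rightarrow> 'v" where
  "S a x = T x - scale (of_real ((\<Sum>i<n. grade i * wt i) - real a)) x"

lemma T_add: "T (x + y) = T x + T y"
  by (simp add: T_def add scale_right_distrib sum.distrib)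

lemma T_scale: "T (scale c x) = scale c (T x)"
  by (simp add: T_def scal scale_sum_right mult.commute)

lemma T_diff: "T (x - y) = T x - T y"
  using T_add[of "x - y" y] by (simp add: algebra_simps)

lemma T_f: "T f = scale (of_real (\<Sum>i<n. grade i * wt i)) f"
  by (simp add: T_def weight_f scale_sum_left)

lemma T_E: "i < n \<Longrightarrow> j < n \<Longrightarrow> T (E i j x) = E i j (T x) + scale (of_real (grade i - grade j)) (E i j x)"
proof -
  assume ij: "i < n" "j < n"
  have "T (E i j x) = (\<Sum>k<n. scale (of_real (grade k)) (E i j (E k k x))
      + (if k = i then scale (of_real (grade i)) (E i j x) else 0) - (if k = j then scale (of_real (grade j)) (E i j x) else 0))"
    unfolding T_def
  proof (intro sum.cong refl)
    fix k assume "k \<in> {..<n}"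
    then have "E k k (E i j x) = E i j (E k k x) + (if k = i then E k j x else 0) - (if k = j then E i k x else 0)"
      using bracket[of k k i j x] ij by (simp add: algebra_simps)
    then show "scale (of_real (grade k)) (E k k (E i j x)) = scale (of_real (grade k)) (E i j (E k k x))
      + (if k = i then scale (of_real (grade i)) (E i j x) else 0) - (if k = j then scale (of_real (grade j)) (E i j x) else 0)"
      by (auto simp: scale_right_distrib scale_right_diff_distrib)
  qed
  also have "\<dots> = E i j (T x) + scale (of_real (grade i)) (E i j x) - scale (of_real (grade j)) (E i j x)"
    using ij by (simp add: T_def sum.distrib sum_subtractf E_sum scal)
  finally show ?thesis by (simp add: scale_left_diff_distrib)
qed

lemma S_add: "S a (x + y) = S a x + S a y"
  by (simp add: S_def T_add scale_right_distrib)

lemma S_scale: "S a (scale c x) = scale c (S a x)"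
  by (simp add: S_def T_scale scale_right_diff_distrib mult.commute)

lemma S_commute: "S a (S b x) = S b (S a x)"
  by (simp add: S_def T_diff T_scale scale_right_diff_distrib mult.commute)

lemma S_f: "S a f = scale (of_nat a) f"
  by (simp add: S_def T_f scale_left_diff_distrib[symmetric])

lemma S_lower: "j < i \<Longrightarrow> i < n \<Longrightarrow> S (a + (i - j)) (E i j x) = E i j (S a x)"
proof -
  assume ij: "j < i" "i < n"
  let ?c = "\<Sum>i<n. grade i * wt i"
  have "E i j (S a x) = E i j (T x) - scale (of_real (?c - real a)) (E i j x)"
    using ij by (simp add: S_def diff scal)
  moreover have "S (a + (i - j)) (E i j x) = E i j (T x) + scale (of_real (grade i - grade j)) (E i j x)
      - scale (of_real (?c - real (a + (i - j)))) (E i j x)"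
    unfolding S_def using T_E[of i j x] ij by simp
  moreover have "scale (of_real (grade i - grade j)) (E i j x) - scale (of_real (?c - real (a + (i - j)))) (E i j x)
      = scale (of_real ((grade i - grade j) - (?c - real (a + (i - j))))) (E i j x)"
    by (simp only: of_real_diff scale_left_diff_distrib)
  moreover have "(grade i - grade j) - (?c - real (a + (i - j))) = - (?c - real a)"
    using ij by (simp add: grade_def of_nat_diff)
  ultimately show ?thesis
    by (simp only: of_real_minus scale_minus_left diff_conv_add_uminus add.assoc)
qed

abbreviation SS :: "nat list \<Rightarrow> 'v \<Rightarrow> 'v" where
  "SS as \<equiv> foldr S as"

lemma SS_add: "SS as (x + y) = SS as x + SS as y"
  by (induction as) (simp_all add: S_add)

lemma SS_scale: "SS as (scale c x) = scale c (SS as x)"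
  by (induction as) (simp_all add: S_scale)

lemma SS_f: "SS as f = scale (of_nat (prod_list as)) f"
  by (induction as) (simp_all add: S_scale S_f mult.commute)

lemma SS_lower: "j < i \<Longrightarrow> i < n \<Longrightarrow> SS (map (\<lambda>a. a + (i - j)) as) (E i j x) = E i j (SS as x)"
proof (induction as)
  case (Cons a as)
  show ?case
    by (simp only: list.map foldr.simps comp_apply Cons.IH[OF Cons.prems] S_lower[OF Cons.prems])
qed simp

lemma h_T: "h (T x) y = h x (T y)"
  by (simp add: T_def h_sum_left h_sum_right h_scale h_scale_right h_adj)

lemma h_S: "h (S a x) y = h x (S a y)"
proof -
  define c where "c = - ((\<Sum>i<n. grade i * wt i) - real a)"
  have S: "S a z = T z + scale (of_real c) z" for z
    by (simp only: S_def c_def of_real_minus scale_minus_left diff_conv_add_uminus)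
  show ?thesis
    unfolding S by (simp add: h_add h_add_right h_scale h_scale_right h_T)
qed

lemma h_SS: "h (SS as x) y = h x (SS as y)"
proof (induction as arbitrary: x y)
  case (Cons a as)
  have "h (SS (a # as) x) y = h x (SS as (S a y))" by (simp add: h_S Cons)
  also have "SS as (S a y) = SS (a # as) y"
    using foldr_commute[of S as "[a]" y] by (simp add: S_commute)
  finally show ?case .
qed simp

text \<open>A product of the shifts \<open>S a\<close> with \<open>a \<noteq> 0\<close> kills the components of \<open>x\<close> in the weight spaces below
  the highest one, so it projects to the line through \<open>f\<close> up to a factor.\<close>

lemma SS_projects: "x \<in> N \<Longrightarrow> \<exists>as b. 0 \<notin> set as \<and> SS as x = scale b f"
proof (induction rule: N.induct)
  case N_f
  show ?case by (intro exI[of _ "[]"] exI[of _ 1]) simp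
next
  case (N_add x y)
  then obtain as b bs c where 1: "0 \<notin> set as" "SS as x = scale b f" "0 \<notin> set bs" "SS bs y = scale c f" by blast
  have "SS (as @ bs) (x + y) = SS bs (SS as x) + SS as (SS bs y)"
    using foldr_commute[of S as bs x] by (simp add: SS_add S_commute)
  also have "\<dots> = scale (b * of_nat (prod_list bs) + c * of_nat (prod_list as)) f"
    by (simp add: 1 SS_scale SS_f scale_left_distrib)
  finally show ?case using 1(1,3)
    by (intro exI[of _ "as @ bs"] exI[of _ "b * of_nat (prod_list bs) + c * of_nat (prod_list as)"]) simp
next
  case (N_scale x c)
  then obtain as b where "0 \<notin> set as" "SS as x = scale b f" by blast
  then show ?case by (intro exI[of _ as] exI[of _ "c * b"]) (simp add: SS_scale)
next
  case (N_lower x j i)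
  then obtain as b where 1: "0 \<notin> set as" "SS as x = scale b f" by blast
  \<comment> \<open>\<open>E i j f\<close> has depth \<open>i - j\<close>, so one additional factor
    removes it. Shifting the list obtained for \<open>x\<close> by the same amount moves its factors
    past \<open>E i j\<close>.\<close>
  have "S (0 + (i - j)) (E i j f) = E i j (S 0 f)" using N_lower by (intro S_lower)
  then have "S (i - j) (E i j f) = 0" using N_lower by (simp add: S_f zero)
  moreover have "SS (map (\<lambda>a. a + (i - j)) as) (E i j x) = E i j (scale b f)"
    unfolding 1(2)[symmetric] using N_lower by (intro SS_lower)
  ultimately have "SS ((i - j) # map (\<lambda>a. a + (i - j)) as) (E i j x) = scale 0 f"
    using N_lower by (simp only: foldr.simps comp_apply) (simp add: scal S_scale)
  then show ?case using N_lower
    by (intro exI[of _ "(i - j) # map (\<lambda>a. a + (i - j)) as"] exI[of _ 0]) auto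
qed

lemma N_least:
  assumes "N.stable (sl n) W" "f \<in> W"
  shows "N \<subseteq> W"
proof
  have W: "subspace W" and st: "\<And>X w. X \<in> sl n \<Longrightarrow> w \<in> W \<Longrightarrow> act X w \<in> W"
    using assms(1) by (auto simp: N.stable_def)
  fix x assume "x \<in> N"
  then show "x \<in> W"
  proof (induction rule: N.induct)
    case (N_lower x j i)
    then show ?case
      using st[OF root_vector_sl[of i j], of x] by (simp add: act_root_vector)
  qed (auto simp: assms(2) intro: subspace_add[OF W] subspace_scale[OF W])
qed

text \<open>A stable \<open>W\<close> is closed under the shifts, and a product of shifts sends any
  \<open>w \<in> W\<close> to a multiple of \<open>f\<close>. If \<open>f \<notin> W\<close> these
  multiples are 0; as the shifts are self-adjoint with nonzero eigenvalue on \<open>f\<close>,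
  \<open>W\<close> is orthogonal to \<open>f\<close>. Adjointness of the generators extends this to
  all of \<open>N\<close>, and positivity gives \<open>W = {0}\<close>.\<close>

lemma irreducible_N: "N.irreducible_module"
  unfolding N.irreducible_module_def
proof (intro conjI allI impI)
  show "N \<noteq> {0}" using N_f f_nonzero by blast
  fix W assume stab: "N.stable (sl n) W"
  then have W: "subspace W" "W \<subseteq> N" and st: "\<And>X w. X \<in> sl n \<Longrightarrow> w \<in> W \<Longrightarrow> act X w \<in> W"
    by (auto simp: N.stable_def)
  have E_W: "E i j w \<in> W" if "i < n" "j < n" "i \<noteq> j" "w \<in> W" for i j w
    using st[OF root_vector_sl[OF that(1-3)] that(4)] that by (simp add: act_root_vector)
  \<comment> \<open>\<open>T\<close> is the action of a traceless diagonal matrix, so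
    \<open>W\<close>, which is stable under \<open>sl n\<close>, is stable under the shifts
    too.\<close>
  define H where "H = mat n n (\<lambda>(i, j). if i = j then complex_of_real (grade i) else 0)"
  have "(\<Sum>i<m. real i) = real m * (real m - 1) / 2" for m
    by (induction m) (auto simp: field_simps)
  then have "(\<Sum>i<n. grade i) = 0"
    by (simp add: grade_def sum_subtractf)
  then have "(\<Sum>i<n. complex_of_real (grade i)) = 0"
    by (metis of_real_0 of_real_sum)
  then have H: "H \<in> sl n" by (simp add: sl_def H_def)
  have "T w = act H w" for w
    by (subst act_diagonal) (auto simp: H_def T_def diagonal_mat_def intro!: sum.cong)
  then have T_W: "T w \<in> W" if "w \<in> W" for w using st[OF H that] by simp
  have SS_W: "SS as w \<in> W" if "w \<in> W" for w as
    using that by (induction as) (auto simp: S_def intro!: subspace_diff[OF W(1)] subspace_scale[OF W(1)] T_W)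
  show "W = {0} \<or> W = N"
  proof (cases "f \<in> W")
    case True
    then show ?thesis using N_least[OF stab] W(2) by blast
  next
    case False
    have orth: "h w f = 0" if w: "w \<in> W" for w
    proof -
      obtain as b where as: "0 \<notin> set as" "SS as w = scale b f" using SS_projects w W(2) by blast
      have "b = 0"
      proof (rule ccontr)
        assume "b \<noteq> 0"
        then have "f = scale (1 / b) (SS as w)" by (simp add: as)
        then have "f \<in> W" using subspace_scale[OF W(1) SS_W[OF w]] by metis
        then show False using False by simp
      qed
      then have "h (SS as w) f = 0" by (simp add: as h_zero_left)
      then have "of_nat (prod_list as) * h w f = 0" by (simp add: h_SS SS_f h_scale_right)
      then show ?thesis using as(1) by (simp add: prod_list_zero_iff)
    qed
    have "\<forall>w\<in>W. h w x = 0" if "x \<in> N" for x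
      using that
    proof (induction rule: N.induct)
      case (N_lower x j i)
      show ?case
      proof
        fix w assume w: "w \<in> W"
        have "h (E j i w) x = (if (j < p) = (i < p) then 1 else - 1) * h w (E i j x)"
          using N_lower by (intro h_adj) auto
        moreover have "h (E j i w) x = 0" using N_lower E_W[of j i w] w by auto
        ultimately show "h w (E i j x) = 0" by (auto split: if_splits)
      qed
    qed (auto simp: orth h_add_right h_scale_right)
    then have "w = 0" if "w \<in> W" for w
      using that W(2) h_pos[of w] by fastforce
    then show ?thesis using subspace_0[OF W(1)] by auto
  qed
qed

lemma locally_k_finite_N:
  assumes n: "n = p + q"
    and fin: "\<And>x. \<exists>W B. x \<in> W \<and> subspace W \<and> finite B \<and> W \<subseteq> span B \<and>
      (\<forall>i<n. \<forall>j<n. (i < p) = (j < p) \<longrightarrow> (\<forall>w\<in>W. E i j w \<in> W))"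
  shows "N.locally_k_finite p"
  unfolding N.locally_k_finite_def
proof
  fix x assume x: "x \<in> N"
  obtain W B where W: "x \<in> W" "subspace W" "finite B" "W \<subseteq> span B"
    and E_W: "\<forall>i<n. \<forall>j<n. (i < p) = (j < p) \<longrightarrow> (\<forall>w\<in>W. E i j w \<in> W)"
    using fin[of x] by (elim exE conjE)
  have "act X w \<in> W" if X: "X \<in> k_alg p (n - p)" and w: "w \<in> W" for X w
  proof -
    have np: "p + (n - p) = n" using n by simp
    have "scale (X $$ (i, j)) (E i j w) \<in> W" if "i < n" "j < n" for i j
    proof (cases "(i < p) = (j < p)")
      case True
      then have "E i j w \<in> W" using E_W that w by blast
      then show ?thesis by (rule subspace_scale[OF W(2)])
    next
      case False
      then have "X $$ (i, j) = 0" using X that unfolding k_alg_def np by blast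
      then show ?thesis using subspace_0[OF W(2)] by simp
    qed
    then show ?thesis unfolding act_def by (intro subspace_sum[OF W(2)]) auto
  qed
  moreover have "act X w \<in> N" if "X \<in> k_alg p (n - p)" "w \<in> N" for X w
    using that n by (intro N.act_closed) (auto simp: k_alg_def)
  ultimately have "N.stable (k_alg p (n - p)) (N \<inter> W)"
    by (auto simp: N.stable_def intro!: subspace_inter[OF subspace_N W(2)])
  then show "\<exists>W. x \<in> W \<and> N.stable (k_alg p (n - p)) W \<and> (\<exists>B. finite B \<and> W \<subseteq> span B)"
    using x W by blast
qed

end

text \<open>\<open>unitary_param\<close> asks for a module on complex sequences, whereas the
  constructed one consists of polynomials. All structure is pushed forward along an injective linear
  map.\<close>

lemma is_L_transport:
  fixes scale :: "complex \<Rightarrow> 'v::ab_group_add \<Rightarrow> 'v" and \<phi> :: "'v \<Rightarrow> nat \<Rightarrow> complex"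
  assumes L: "is_L scale p q lam V act" and h: "sl_module.unitary_form scale (p + q) V act p h"
    and \<phi>: "inj \<phi>" "\<And>x y. \<phi> (x + y) = \<phi> x + \<phi> y" "\<And>c x. \<phi> (scale c x) = seq_scale c (\<phi> x)"
  shows "\<exists>V' act'. is_L seq_scale p q lam V' act' \<and>
    (\<exists>h'. sl_module.unitary_form seq_scale (p + q) V' act' p h')"
proof -
  define n where "n = p + q"
  define \<psi> where "\<psi> = inv_into UNIV \<phi>"
  define V' where "V' = \<phi> ` V"
  define act' where "act' X y = \<phi> (act X (\<psi> y))" for X y
  define h' where "h' y z = h (\<psi> y) (\<psi> z)" for y z
  have inv[simp]: "\<psi> (\<phi> x) = x" for x using \<phi>(1) by (simp add: \<psi>_def)
  note lin = \<phi>(2,3)[symmetric]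
  interpret M: sl_module scale n V act using L by (simp add: is_L_def n_def)
  interpret S: vector_space seq_scale by (rule vector_space_seq_scale)
  have zero: "\<phi> 0 = 0" using \<phi>(2)[of 0 0] by simp
  have sub: "S.subspace (\<phi> ` W)" if "M.subspace W" for W
    using that by (intro S.subspaceI) (auto simp: lin zero[symmetric] M.subspace_0 M.subspace_add M.subspace_scale simp del: zero)
  have sub': "M.subspace (\<phi> -` W)" if "S.subspace W" for W
    using that by (intro M.subspaceI) (auto simp: \<phi>(2,3) zero S.subspace_0 S.subspace_add S.subspace_scale)
  have diff: "\<phi> x - \<phi> y = \<phi> (x - y)" for x y
    using \<phi>(2)[of "x - y" y] by simp
  have act': "act' X (\<phi> x) = \<phi> (act X x)" for X x by (simp add: act'_def)
  have h'h: "h' (\<phi> x) (\<phi> y) = h x y" for x y by (simp add: h'_def)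
  interpret M': sl_module seq_scale n V' act'
  proof
    show "S.subspace V'" unfolding V'_def by (intro sub M.subspace_V)
  next
    fix X v assume "X \<in> sl n" "v \<in> V'"
    then show "act' X v \<in> V'" by (auto simp: V'_def act' M.act_closed)
  next
    fix X v w assume "X \<in> sl n" "v \<in> V'" "w \<in> V'"
    then show "act' X (v + w) = act' X v + act' X w" by (auto simp: V'_def act' lin M.act_add)
  next
    fix X c v assume "X \<in> sl n" "v \<in> V'"
    then show "act' X (seq_scale c v) = seq_scale c (act' X v)" by (auto simp: V'_def act' lin M.act_scale)
  next
    fix X Y v assume "X \<in> sl n" "Y \<in> sl n" "v \<in> V'"
    then show "act' (X + Y) v = act' X v + act' Y v" by (auto simp: V'_def act' lin M.add_act)
  next
    fix X c v assume "X \<in> sl n" "v \<in> V'"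
    then show "act' (c \<cdot>\<^sub>m X) v = seq_scale c (act' X v)" by (auto simp: V'_def act' lin M.scale_act)
  next
    fix X Y v assume "X \<in> sl n" "Y \<in> sl n" "v \<in> V'"
    then show "act' (X * Y - Y * X) v = act' X (act' Y v) - act' Y (act' X v)"
      by (auto simp: V'_def act' diff M.act_bracket)
  qed
  have eq0: "\<phi> x = 0 \<longleftrightarrow> x = 0" for x
    using \<phi>(1) zero by (metis injD)
  have preimage: "\<phi> -` W \<subseteq> V" if "W \<subseteq> V'" for W
    using that \<phi>(1) unfolding V'_def by (auto dest: injD)
  have irr: "M'.irreducible_module"
    unfolding M'.irreducible_module_def
  proof (intro conjI allI impI)
    have Mirr: "V \<noteq> {0}" "\<And>W. M.stable (sl n) W \<Longrightarrow> W = {0} \<or> W = V"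
      using L by (auto simp: is_L_def n_def M.irreducible_module_def[unfolded n_def])
    then obtain x where "x \<in> V" "x \<noteq> 0" using M.subspace_0[OF M.subspace_V] by blast
    then show "V' \<noteq> {0}" unfolding V'_def using eq0 by blast
    fix W assume W: "M'.stable (sl n) W"
    then have "M.stable (sl n) (\<phi> -` W)"
      using preimage[of W] unfolding M.stable_def M'.stable_def by (auto simp: sub' act'[symmetric])
    then have "\<phi> -` W = {0} \<or> \<phi> -` W = V" by (rule Mirr)
    moreover have "W = \<phi> ` (\<phi> -` W)"
    proof -
      have "W \<subseteq> \<phi> ` V" using W unfolding M'.stable_def by (simp add: V'_def)
      then show ?thesis by (auto simp: image_vimage_eq)
    qed
    ultimately show "W = {0} \<or> W = V'" unfolding V'_def using zero by (metis image_empty image_insert)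
  qed
  have fin: "M'.locally_k_finite p"
    unfolding M'.locally_k_finite_def
  proof
    fix v assume "v \<in> V'"
    then obtain x where x: "x \<in> V" "v = \<phi> x" by (auto simp: V'_def)
    have "M.locally_k_finite p" using L by (simp add: is_L_def n_def)
    then obtain W B where W: "x \<in> W" "M.stable (k_alg p (n - p)) W" "finite B" "W \<subseteq> M.span B"
      using x(1) unfolding M.locally_k_finite_def by blast
    have "M.span B \<subseteq> \<phi> -` S.span (\<phi> ` B)"
      by (intro M.span_minimal sub' S.subspace_span) (auto intro: S.span_base)
    then have "\<phi> ` W \<subseteq> S.span (\<phi> ` B)" using W(4) by blast
    moreover have "M'.stable (k_alg p (n - p)) (\<phi> ` W)"
      using W(2) unfolding M.stable_def M'.stable_def by (auto simp: sub V'_def act')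
    ultimately show "\<exists>W. v \<in> W \<and> M'.stable (k_alg p (n - p)) W \<and> (\<exists>B. finite B \<and> W \<subseteq> S.span B)"
      using x W(1,3) by blast
  qed
  obtain v where v: "M.highest_weight_vector lam v" using L by (auto simp: is_L_def n_def)
  have "M'.highest_weight_vector lam (\<phi> v)"
    using v unfolding M.highest_weight_vector_def M'.highest_weight_vector_def
    by (auto simp: V'_def act' lin eq0 zero)
  then have "is_L seq_scale p q lam V' act'"
    using irr fin M'.sl_module_axioms unfolding is_L_def n_def by blast
  moreover have "M'.unitary_form p h'"
    unfolding M'.unitary_form_def
  proof (intro conjI ballI allI impI)
    note H = h[folded n_def, unfolded M.unitary_form_def]
    fix u v w assume V': "u \<in> V'" "v \<in> V'" "w \<in> V'"
    then show "h' (u + v) w = h' u w + h' v w"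
      using H[THEN conjunct1] by (auto simp: V'_def lin h'h)
    obtain x y where xy: "x \<in> V" "y \<in> V" "v = \<phi> x" "w = \<phi> y"
      using V' by (auto simp: V'_def)
    show "h' w v = cnj (h' v w)"
      unfolding xy(3,4) h'h
      by (rule H[THEN conjunct2, THEN conjunct2, THEN conjunct1, rule_format]) (fact xy)+
  next
    note H = h[folded n_def, unfolded M.unitary_form_def]
    fix c v w assume "v \<in> V'" "w \<in> V'"
    then show "h' (seq_scale c v) w = c * h' v w"
      using H[THEN conjunct2, THEN conjunct1] by (auto simp: V'_def lin h'h)
  next
    note H = h[folded n_def, unfolded M.unitary_form_def]
    fix v assume "v \<in> V'" "v \<noteq> 0"
    then show "0 < Re (h' v v)"
      using H[THEN conjunct2, THEN conjunct2, THEN conjunct2, THEN conjunct1] by (auto simp: V'_def h'h eq0)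
  next
    note H = h[folded n_def, unfolded M.unitary_form_def]
    fix X v w assume "X \<in> su p (n - p)" "v \<in> V'" "w \<in> V'"
    then show "h' (act' X v) w = - h' v (act' X w)"
      using H[THEN conjunct2, THEN conjunct2, THEN conjunct2, THEN conjunct2] by (auto simp: V'_def act' h'h)
  qed
  ultimately show ?thesis unfolding n_def by blast
qed

section \<open>The oscillator representation\<close>

definition zvar :: "nat \<Rightarrow> nat \<Rightarrow> nat" where
  "zvar i a = prod_encode (i, a)"

lemma zvar_eq[simp]: "zvar i a = zvar j b \<longleftrightarrow> i = j \<and> a = b"
  by (simp add: zvar_def)

text \<open>Canonical pairs: \<open>[fock_Q i a, fock_P j b]\<close> is \<open>1\<close> or \<open>0\<close> for all indices, so the operators
  \<open>fock_E\<close> satisfy the relations of \<open>gl(n)\<close>.\<close>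

definition fock_P :: "nat \<Rightarrow> nat \<Rightarrow> nat \<Rightarrow> mpoly \<Rightarrow> mpoly" where
  "fock_P p i a f = (if i < p then - pderivative (zvar i a) f else mvar (zvar i a) * f)"

definition fock_Q :: "nat \<Rightarrow> nat \<Rightarrow> nat \<Rightarrow> mpoly \<Rightarrow> mpoly" where
  "fock_Q p i a f = (if i < p then mvar (zvar i a) * f else pderivative (zvar i a) f)"

definition fock_E :: "nat \<Rightarrow> nat \<Rightarrow> nat \<Rightarrow> nat \<Rightarrow> mpoly \<Rightarrow> mpoly" where
  "fock_E p k i j f = (\<Sum>a<k. fock_P p i a (fock_Q p j a f))"

lemma pderivative_mvar_mult: "pderivative x (mvar y * f) = (if x = y then f else 0) + mvar y * pderivative x f"
  by (simp add: pderivative_mult pderivative_mvar)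

lemma fock_P_add: "fock_P p i a (f + g) = fock_P p i a f + fock_P p i a g"
  by (simp add: fock_P_def pderivative_add distrib_left)

lemma fock_Q_add: "fock_Q p i a (f + g) = fock_Q p i a f + fock_Q p i a g"
  by (simp add: fock_Q_def pderivative_add distrib_left)

lemma fock_P_zero: "fock_P p i a 0 = 0"
  by (simp add: fock_P_def pderivative_zero)

lemma fock_Q_zero: "fock_Q p i a 0 = 0"
  by (simp add: fock_Q_def pderivative_zero)

lemma fock_P_mconst: "fock_P p i a (mconst c * f) = mconst c * fock_P p i a f"
  by (simp add: fock_P_def pderivative_mconst_mult mult.left_commute)

lemma fock_Q_mconst: "fock_Q p i a (mconst c * f) = mconst c * fock_Q p i a f"
  by (simp add: fock_Q_def pderivative_mconst_mult mult.left_commute)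

lemma fock_P_sum: "fock_P p i a (\<Sum>b\<in>I. f b) = (\<Sum>b\<in>I. fock_P p i a (f b))"
  by (induction I rule: infinite_finite_induct) (simp_all add: fock_P_add fock_P_zero)

lemma fock_Q_sum: "fock_Q p i a (\<Sum>b\<in>I. f b) = (\<Sum>b\<in>I. fock_Q p i a (f b))"
  by (induction I rule: infinite_finite_induct) (simp_all add: fock_Q_add fock_Q_zero)

lemma fock_ccr: "fock_Q p i a (fock_P p j b f) = fock_P p j b (fock_Q p i a f) + (if i = j \<and> a = b then f else 0)"
  by (cases "i < p"; cases "j < p")
    (auto simp: fock_P_def fock_Q_def pderivative_mvar_mult pderivative_uminus mult.left_commute
      pderivative_commute[of "zvar i a"])

lemma fock_P_commute: "fock_P p i a (fock_P p j b f) = fock_P p j b (fock_P p i a f)"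
  by (cases "i < p"; cases "j < p")
    (auto simp: fock_P_def pderivative_mvar_mult pderivative_uminus mult.left_commute
      pderivative_commute[of "zvar i a" "zvar j b"])

lemma fock_Q_commute: "fock_Q p i a (fock_Q p j b f) = fock_Q p j b (fock_Q p i a f)"
  by (cases "i < p"; cases "j < p")
    (auto simp: fock_Q_def pderivative_mvar_mult pderivative_uminus mult.left_commute
      pderivative_commute[of "zvar i a" "zvar j b"])

text \<open>Normal ordering: the quartic part is unchanged when the two index pairs are exchanged,
  because the operators \<open>fock_P\<close> commute among themselves and so do the
  \<open>fock_Q\<close>. Only the contraction contributes to the bracket.\<close>

lemma fock_E_fock_E:
  "fock_E p k i j (fock_E p k c d f)
    = (\<Sum>a<k. \<Sum>b<k. fock_P p i a (fock_P p c b (fock_Q p j a (fock_Q p d b f)))) + (if j = c then fock_E p k i d f else 0)"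
proof -
  have "fock_E p k i j (fock_E p k c d f)
      = (\<Sum>a<k. \<Sum>b<k. fock_P p i a (fock_P p c b (fock_Q p j a (fock_Q p d b f)))
          + (if b = a then if j = c then fock_P p i a (fock_Q p d a f) else 0 else 0))"
    unfolding fock_E_def fock_P_sum fock_Q_sum fock_ccr
    by (intro sum.cong refl) (auto simp: fock_P_add fock_P_zero)
  also have "\<dots> = (\<Sum>a<k. (\<Sum>b<k. fock_P p i a (fock_P p c b (fock_Q p j a (fock_Q p d b f))))
          + (if j = c then fock_P p i a (fock_Q p d a f) else 0))"
    by (intro sum.cong refl) (simp add: sum.distrib)
  finally show ?thesis by (simp add: sum.distrib fock_E_def)
qed

lemma fock_bracket:
  "fock_E p k i j (fock_E p k c d f) - fock_E p k c d (fock_E p k i j f)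
    = (if j = c then fock_E p k i d f else 0) - (if i = d then fock_E p k c j f else 0)"
proof -
  have "(\<Sum>a<k. \<Sum>b<k. fock_P p i a (fock_P p c b (fock_Q p j a (fock_Q p d b f))))
      = (\<Sum>b<k. \<Sum>a<k. fock_P p c b (fock_P p i a (fock_Q p d b (fock_Q p j a f))))"
    by (subst sum.swap) (simp only: fock_P_commute[of p i] fock_Q_commute[of p j])
  then show ?thesis unfolding fock_E_fock_E by (auto simp: algebra_simps)
qed

lemma fischer_zero: "fischer 0 g = 0"
  by (simp add: fischer_def)

lemma fischer_sum: "fischer (\<Sum>i\<in>I. f i) g = (\<Sum>i\<in>I. fischer (f i) g)"
  by (induction I rule: infinite_finite_induct) (simp_all add: fischer_add fischer_zero)

lemma fischer_sum_right: "fischer g (\<Sum>i\<in>I. f i) = (\<Sum>i\<in>I. fischer g (f i))"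
  by (subst fischer_sym) (simp add: fischer_sum fischer_sym[of g])

lemma fischer_uminus: "fischer (- f) g = - fischer f g"
  using fischer_mconst_mult[of "-1" f g] by (simp add: mconst_simps)

lemma fischer_uminus_right: "fischer g (- f) = - fischer g f"
  by (subst fischer_sym) (simp add: fischer_uminus fischer_sym[of g])

lemma fischer_pderivative: "fischer (pderivative x f) g = fischer f (mvar x * g)"
  using fischer_mvar_mult[of x g f] fischer_sym[of "mvar x * g" f] fischer_sym[of g "pderivative x f"] by simp

lemma fischer_fock_P: "fischer (fock_P p i a f) g = (if i < p then - 1 else 1) * fischer f (fock_Q p i a g)"
  by (simp add: fock_P_def fock_Q_def fischer_uminus fischer_pderivative fischer_mvar_mult)

lemma fischer_fock_Q: "fischer (fock_Q p i a f) g = (if i < p then - 1 else 1) * fischer f (fock_P p i a g)"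
  by (simp add: fock_P_def fock_Q_def fischer_uminus_right fischer_pderivative fischer_mvar_mult)

text \<open>Up to a sign, \<open>fock_P\<close> and \<open>fock_Q\<close> of the same index are
  adjoint, and the sign is negative for rows of the first block. The product of two such signs is
  negative exactly for the noncompact generators.\<close>

lemma unitary_gl_fock: "unitary_gl (\<lambda>c. (*) (mconst c)) UNIV n (fock_E p k) p fischer"
proof -
  interpret vector_space "\<lambda>c. (*) (mconst c)" by (rule vector_space_mpoly)
  show ?thesis
  proof
    show "subspace UNIV" by (rule subspace_UNIV)
    show "fischer (fock_E p k i j v) w = (if (i < p) = (j < p) then 1 else - 1) * fischer v (fock_E p k j i w)" for i j v w
      by (simp add: fock_E_def fischer_sum fischer_sum_right fischer_fock_P fischer_fock_Q sum_negf)
  qed (auto simp: fock_E_def fock_P_add fock_Q_add sum.distrib fock_P_mconst fock_Q_mconst sum_distrib_left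
      fock_bracket[unfolded fock_E_def] fischer_add fischer_mconst_mult fischer_pos intro: fischer_sym)
qed

text \<open>The classical polarization operator: the derivation that replaces the variables of row
  \<open>w\<close> by those of row \<open>u\<close>, in the first \<open>k\<close> columns.\<close>

definition polarization :: "nat \<Rightarrow> nat \<Rightarrow> nat \<Rightarrow> mpoly \<Rightarrow> mpoly" where
  "polarization k u w f = (\<Sum>a<k. mvar (zvar u a) * pderivative (zvar w a) f)"

lemma derivation_polarization: "derivation (polarization k u w)"
  by unfold_locales
    (simp_all add: polarization_def pderivative_add pderivative_mult distrib_left sum.distrib
      sum_distrib_left sum_distrib_right mult_ac)

lemma polarization_mvar: "polarization k u w (mvar (zvar i a)) = (if i = w \<and> a < k then mvar (zvar u a) else 0)"
proof -
  have "polarization k u w (mvar (zvar i a)) = (\<Sum>b<k. if b = a then if i = w then mvar (zvar u a) else 0 else 0)"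
    unfolding polarization_def by (intro sum.cong refl) (auto simp: pderivative_mvar)
  then show ?thesis by simp
qed

lemma fock_E_compact_p: "i < p \<Longrightarrow> j < p \<Longrightarrow>
  fock_E p k i j f = - polarization k j i f - (if i = j then of_nat k * f else 0)"
  by (simp add: fock_E_def fock_P_def fock_Q_def polarization_def pderivative_mvar_mult sum_negf sum.distrib sum_subtractf)

lemma fock_E_compact_q: "p \<le> i \<Longrightarrow> p \<le> j \<Longrightarrow> fock_E p k i j f = polarization k i j f"
  by (simp add: fock_E_def fock_P_def fock_Q_def polarization_def)

section \<open>Minors of the matrix of variables\<close>

definition minor :: "(nat \<Rightarrow> nat) \<Rightarrow> (nat \<Rightarrow> nat) \<Rightarrow> nat \<Rightarrow> mpoly" where
  "minor \<rho> \<sigma> r = det (mat r r (\<lambda>(s, t). mvar (zvar (\<rho> s) (\<sigma> t))))"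

lemma det_zero_row:
  fixes M :: "nat \<times> nat \<Rightarrow> 'a::comm_ring_1"
  assumes "s < r" "\<And>t. t < r \<Longrightarrow> M (s, t) = 0"
  shows "det (mat r r M) = 0"
proof -
  have "(\<Prod>i=0..<r. M (i, \<pi> i)) = 0" if "\<pi> permutes {0..<r}" for \<pi>
    using assms permutes_less[OF that assms(1)] by (intro prod_zero bexI[of _ s]) auto
  then show ?thesis by (simp add: det_expand)
qed

text \<open>Replacing row \<open>w\<close> of a minor by row \<open>u\<close> creates two equal rows
  if \<open>u\<close> occurs already, gives 0 if \<open>w\<close> does not occur, and changes
  nothing if \<open>u = w\<close> occurs.\<close>

lemma polarization_minor:
  assumes inj: "inj_on \<rho> {..<r}" and \<sigma>: "\<And>t. t < r \<Longrightarrow> \<sigma> t < k"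
  shows "u \<noteq> w \<Longrightarrow> (w \<in> \<rho> ` {..<r} \<Longrightarrow> u \<in> \<rho> ` {..<r}) \<Longrightarrow> polarization k u w (minor \<rho> \<sigma> r) = 0"
    and "polarization k w w (minor \<rho> \<sigma> r) = (if w \<in> \<rho> ` {..<r} then minor \<rho> \<sigma> r else 0)"
proof -
  interpret derivation "polarization k u w" for u w by (rule derivation_polarization)
  define A where "A u w s = mat r r (\<lambda>(i, j). if i = s then polarization k u w (mvar (zvar (\<rho> i) (\<sigma> j))) else mvar (zvar (\<rho> i) (\<sigma> j)))"
    for u w s
  have D: "polarization k u w (minor \<rho> \<sigma> r) = (\<Sum>s<r. det (A u w s))" for u w
    unfolding minor_def det A_def by (intro sum.cong refl arg_cong[where f = det]) (auto simp: mat_eq_iff)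
  have A: "A u w s = mat r r (\<lambda>(i, j). if i = s then (if \<rho> i = w then mvar (zvar u (\<sigma> j)) else 0) else mvar (zvar (\<rho> i) (\<sigma> j)))"
    for u w s
    unfolding A_def using \<sigma> by (intro eq_matI) (auto simp: polarization_mvar)
  have zero: "det (A u w s) = 0" if "s < r" "\<rho> s \<noteq> w" for u w s
    unfolding A using that by (intro det_zero_row[of s]) auto
  show "polarization k u w (minor \<rho> \<sigma> r) = 0" if ne: "u \<noteq> w" and im: "w \<in> \<rho> ` {..<r} \<Longrightarrow> u \<in> \<rho> ` {..<r}"
    unfolding D
  proof (intro sum.neutral ballI)
    fix s assume s: "s \<in> {..<r}"
    show "det (A u w s) = 0"
    proof (cases "\<rho> s = w")
      case True
      then obtain s' where s': "s' < r" "u = \<rho> s'" using im s by auto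
      then have "s' \<noteq> s" using True ne by auto
      moreover have "row (A u w s) s = row (A u w s) s'"
        using s s' \<open>s' \<noteq> s\<close> True unfolding A by (intro eq_vecI) auto
      ultimately show ?thesis
        using s s' by (intro det_identical_rows[of _ r s s']) (auto simp: A_def)
    qed (use zero s in auto)
  qed
  show "polarization k w w (minor \<rho> \<sigma> r) = (if w \<in> \<rho> ` {..<r} then minor \<rho> \<sigma> r else 0)"
  proof (cases "w \<in> \<rho> ` {..<r}")
    case True
    then obtain s where s: "s < r" "w = \<rho> s" by auto
    have "(\<Sum>s'<r. det (A w w s')) = (\<Sum>s'<r. if s' = s then minor \<rho> \<sigma> r else 0)"
    proof (intro sum.cong refl)
      fix s' assume s': "s' \<in> {..<r}"
      show "det (A w w s') = (if s' = s then minor \<rho> \<sigma> r else 0)"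
      proof (cases "s' = s")
        case True
        have "A w w s = mat r r (\<lambda>(s, t). mvar (zvar (\<rho> s) (\<sigma> t)))"
          unfolding A using s by (intro eq_matI) auto
        then show ?thesis using True by (simp add: minor_def)
      next
        case False
        then have "\<rho> s' \<noteq> w" using inj s s' by (auto dest: inj_onD)
        then show ?thesis using False zero s' by simp
      qed
    qed
    then show ?thesis using True s by (simp add: D)
  next
    case False
    then show ?thesis unfolding D by (auto intro!: sum.neutral zero)
  qed
qed

lemma pderivative_minor:
  assumes "\<And>s t. s < r \<Longrightarrow> t < r \<Longrightarrow> x \<noteq> zvar (\<rho> s) (\<sigma> t)" "0 < r"
  shows "pderivative x (minor \<rho> \<sigma> r) = 0"
proof -
  interpret derivation "pderivative x" by (rule derivation_pderivative)
  show ?thesis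
    unfolding minor_def det using assms by (intro sum.neutral ballI det_zero_row) (auto simp: pderivative_mvar)
qed

lemma prod_single:
  "finite I \<Longrightarrow> (\<Prod>i\<in>I. mvar (x i)) = Poly_Mapping.single (\<Sum>i\<in>I. {#x i#}) 1"
  by (induction I rule: finite_induct)
    (simp_all add: single_one[folded zero_multiset_def] mvar_def mult_single)

text \<open>Different permutations give different monomials, so the monomial of the identity
  survives with coefficient 1.\<close>

lemma minor_nonzero:
  assumes inj: "inj_on \<rho> {..<r}" "inj_on \<sigma> {..<r}"
  shows "minor \<rho> \<sigma> r \<noteq> 0"
proof -
  define m where "m \<pi> = (\<Sum>i=0..<r. {#zvar (\<rho> i) (\<sigma> (\<pi> i))#})" for \<pi> :: "nat \<Rightarrow> nat"
  have set_m: "set_mset (m \<pi>) = (\<lambda>i. zvar (\<rho> i) (\<sigma> (\<pi> i))) ` {0..<r}" for \<pi>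
    by (auto simp: m_def set_mset_sum)
  have m: "m \<pi> = m id \<longleftrightarrow> \<pi> = id" if \<pi>: "\<pi> permutes {0..<r}" for \<pi>
  proof
    assume *: "m \<pi> = m id"
    have "\<pi> i = i" if "i < r" for i
    proof -
      have "zvar (\<rho> i) (\<sigma> (\<pi> i)) \<in> set_mset (m id)"
        using that unfolding *[symmetric] set_m by auto
      then obtain j where "j < r" "\<rho> i = \<rho> j" "\<sigma> (\<pi> i) = \<sigma> j" by (auto simp: set_m)
      then show ?thesis using inj that permutes_less[OF \<pi> that] by (auto dest!: inj_onD)
    qed
    moreover have "\<pi> i = i" if "\<not> i < r" for i
      using permutes_not_in[OF \<pi>, of i] that by simp
    ultimately show "\<pi> = id" by (auto simp: fun_eq_iff)
  qed simp
  have "minor \<rho> \<sigma> r = (\<Sum>\<pi>\<in>{\<pi>. \<pi> permutes {0..<r}}. signof \<pi> * Poly_Mapping.single (m \<pi>) 1)"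
    unfolding minor_def det_expand by (simp add: prod_single m_def)
  then have "Poly_Mapping.lookup (minor \<rho> \<sigma> r) (m id)
      = (\<Sum>\<pi>\<in>{\<pi>. \<pi> permutes {0..<r}}. Poly_Mapping.lookup (signof \<pi> * Poly_Mapping.single (m \<pi>) 1) (m id))"
    by (simp add: lookup_sum)
  also have "\<dots> = (\<Sum>\<pi>\<in>{\<pi>. \<pi> permutes {0..<r}}. if \<pi> = id then 1 else 0)"
    by (intro sum.cong refl) (auto simp: m lookup_single when_def sign_def sign_id)
  also have "\<dots> = 1"
    by (simp add: finite_permutations permutes_id)
  finally show ?thesis by auto
qed

section \<open>The highest weight vector in the oscillator representation\<close>

locale fock_highest_weight =
  fixes p q n k l l' :: nat and e e' :: "nat \<Rightarrow> nat"
  assumes n: "n = p + q" and ll: "l + l' \<le> k"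
    and e: "\<And>r. r \<in> {1..<p} \<Longrightarrow> e r \<noteq> 0 \<Longrightarrow> r \<le> l"
    and e': "\<And>r. r \<in> {1..<q} \<Longrightarrow> e' r \<noteq> 0 \<Longrightarrow> r \<le> l'"
begin

text \<open>In the first block \<open>fock_E\<close> acts by transposed polarizations: raising
  replaces a row by a later one. So the last \<open>r\<close> rows of that block are used here, and
  the first \<open>r\<close> rows of the second block in \<open>yminor\<close>.\<close>

definition xminor :: "nat \<Rightarrow> mpoly" where
  "xminor r = minor (\<lambda>s. p - 1 - s) (\<lambda>t. t) r"

definition yminor :: "nat \<Rightarrow> mpoly" where
  "yminor r = minor (\<lambda>s. p + s) (\<lambda>t. k - 1 - t) r"

definition xpart :: mpoly where
  "xpart = (\<Prod>r\<in>{1..<p}. xminor r ^ e r)"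

definition ypart :: mpoly where
  "ypart = (\<Prod>r\<in>{1..<q}. yminor r ^ e' r)"

lemma inj_x: "r < p \<Longrightarrow> inj_on (\<lambda>s. p - 1 - s) {..<r}"
  by (auto simp: inj_on_def)

lemma inj_y: "inj_on (\<lambda>s. p + s) {..<r}"
  by (auto simp: inj_on_def)

lemma rows_x: "r < p \<Longrightarrow> i \<in> (\<lambda>s. p - 1 - s) ` {..<r} \<longleftrightarrow> p - r \<le> i \<and> i < p"
  by (auto intro!: image_eqI[of _ _ "p - 1 - i"])

lemma rows_y: "i \<in> (\<lambda>s. p + s) ` {..<r} \<longleftrightarrow> p \<le> i \<and> i < p + r"
  by (auto intro!: image_eqI[of _ _ "i - p"])

lemma nonzero: "xpart * ypart \<noteq> 0"
proof -
  have "xminor r ^ e r \<noteq> 0" if "r \<in> {1..<p}" for r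
    using that minor_nonzero[OF inj_x, of r] by (simp add: xminor_def)
  moreover have "yminor r ^ e' r \<noteq> 0" if "r \<in> {1..<q}" for r
  proof (cases "e' r = 0")
    case False
    then have "r \<le> k" using e'[OF that] ll by simp
    then have "inj_on (\<lambda>t. k - 1 - t) {..<r}" by (auto simp: inj_on_def)
    then show ?thesis using minor_nonzero[OF inj_y, of _ r] by (simp add: yminor_def)
  qed simp
  ultimately show ?thesis by (auto simp: xpart_def ypart_def)
qed

text \<open>The premise \<open>d > 0\<close> leaves out minors with exponent 0, which may have more
  columns than the \<open>k\<close> available.\<close>

lemma polarization_power:
  assumes "d > 0 \<Longrightarrow> polarization k u w f = c * f"
  shows "polarization k u w (f ^ d) = (of_nat d * c) * f ^ d"
proof -
  interpret derivation "polarization k u w" by (rule derivation_polarization)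
  show ?thesis using assms eigen_power[of f c d] by (cases "d = 0") (auto simp: one)
qed

lemma polarization_parts:
  assumes "\<And>r. r \<in> {1..<p} \<Longrightarrow> e r > 0 \<Longrightarrow> polarization k u w (xminor r) = a r * xminor r"
    and "\<And>r. r \<in> {1..<q} \<Longrightarrow> e' r > 0 \<Longrightarrow> polarization k u w (yminor r) = b r * yminor r"
  shows "polarization k u w (xpart * ypart)
    = ((\<Sum>r\<in>{1..<p}. of_nat (e r) * a r) + (\<Sum>r\<in>{1..<q}. of_nat (e' r) * b r)) * (xpart * ypart)"
proof -
  interpret derivation "polarization k u w" by (rule derivation_polarization)
  show ?thesis
    unfolding xpart_def ypart_def using assms
    by (intro eigen_mult eigen_prod polarization_power) auto
qed

lemma polarization_xminor:
  assumes "r \<in> {1..<p}" "e r > 0"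
  shows "u \<noteq> w \<Longrightarrow> (p - r \<le> w \<and> w < p \<Longrightarrow> p - r \<le> u \<and> u < p) \<Longrightarrow> polarization k u w (xminor r) = 0"
    and "polarization k w w (xminor r) = (if p - r \<le> w \<and> w < p then 1 else 0) * xminor r"
proof -
  have r: "r < p" "r \<le> k" using assms e[OF assms(1)] ll by auto
  note P = polarization_minor[OF inj_x[OF r(1)], of "\<lambda>t. t" k, folded xminor_def, unfolded rows_x[OF r(1)]]
  show "polarization k u w (xminor r) = 0" if "u \<noteq> w" "p - r \<le> w \<and> w < p \<Longrightarrow> p - r \<le> u \<and> u < p"
    using r(2) that by (intro P(1)) simp_all
  show "polarization k w w (xminor r) = (if p - r \<le> w \<and> w < p then 1 else 0) * xminor r"
    using r(2) by (subst P(2)) simp_all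
qed

lemma polarization_yminor:
  assumes "r \<in> {1..<q}" "e' r > 0"
  shows "u \<noteq> w \<Longrightarrow> (p \<le> w \<and> w < p + r \<Longrightarrow> p \<le> u \<and> u < p + r) \<Longrightarrow> polarization k u w (yminor r) = 0"
    and "polarization k w w (yminor r) = (if p \<le> w \<and> w < p + r then 1 else 0) * yminor r"
proof -
  have r: "r \<le> k" using assms e'[OF assms(1)] ll by auto
  note P = polarization_minor[OF inj_y[of r], of "\<lambda>t. k - 1 - t" k, folded yminor_def, unfolded rows_y]
  show "polarization k u w (yminor r) = 0" if "u \<noteq> w" "p \<le> w \<and> w < p + r \<Longrightarrow> p \<le> u \<and> u < p + r"
    using r that by (intro P(1)) simp_all
  show "polarization k w w (yminor r) = (if p \<le> w \<and> w < p + r then 1 else 0) * yminor r"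
    using r by (subst P(2)) simp_all
qed

lemma raise_p: "i < j \<Longrightarrow> j < p \<Longrightarrow> fock_E p k i j (xpart * ypart) = 0"
  using polarization_parts[of j i "\<lambda>_. 0" "\<lambda>_. 0"] polarization_xminor(1)[of _ j i] polarization_yminor(1)[of _ j i]
  by (simp add: fock_E_compact_p)

lemma raise_q: "p \<le> i \<Longrightarrow> i < j \<Longrightarrow> fock_E p k i j (xpart * ypart) = 0"
  using polarization_parts[of i j "\<lambda>_. 0" "\<lambda>_. 0"] polarization_xminor(1)[of _ i j] polarization_yminor(1)[of _ i j]
  by (simp add: fock_E_compact_q)

lemma pderivative_prod_power:
  assumes "\<And>r. r \<in> I \<Longrightarrow> d r > 0 \<Longrightarrow> pderivative x (f r) = 0"
  shows "pderivative x (\<Prod>r\<in>I. f r ^ d r) = 0"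
proof -
  interpret derivation "pderivative x" by (rule derivation_pderivative)
  have "pderivative x (f r ^ d r) = 0 * f r ^ d r" if "r \<in> I" for r
    using assms[OF that] eigen_power[of "f r" 0 "d r"] by (cases "d r = 0") (auto simp: one)
  from eigen_prod[OF this] show ?thesis by simp
qed

lemma pderivative_xpart: "p \<le> i \<or> l \<le> a \<Longrightarrow> pderivative (zvar i a) xpart = 0"
  unfolding xpart_def xminor_def using e
  by (intro pderivative_prod_power pderivative_minor) fastforce+

lemma pderivative_ypart: "i < p \<or> a + l' < k \<Longrightarrow> pderivative (zvar i a) ypart = 0"
  unfolding ypart_def yminor_def using e'
  by (intro pderivative_prod_power pderivative_minor) fastforce+

text \<open>The two families of minors use disjoint sets of columns because \<open>l + l' \<le> k\<close>.\<close>

lemma raise_pq: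
  assumes ij: "i < p" "p \<le> j"
  shows "fock_E p k i j (xpart * ypart) = 0"
proof -
  have "pderivative (zvar i a) (pderivative (zvar j a) (xpart * ypart)) = 0" for a
  proof -
    have "pderivative (zvar i a) (pderivative (zvar j a) (xpart * ypart))
        = pderivative (zvar i a) xpart * pderivative (zvar j a) ypart"
      using ij by (simp add: pderivative_mult pderivative_xpart pderivative_ypart pderivative_zero
          pderivative_commute[of "zvar i a" "zvar j a"])
    also have "\<dots> = 0"
      using ij ll by (cases "a < l") (simp_all add: pderivative_ypart pderivative_xpart)
    finally show ?thesis .
  qed
  then show ?thesis using ij by (simp add: fock_E_def fock_P_def fock_Q_def)
qed

lemma raise: "i < j \<Longrightarrow> j < n \<Longrightarrow> fock_E p k i j (xpart * ypart) = 0"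
  using raise_p raise_q raise_pq by (meson leI)

lemma of_nat_mconst: "of_nat m = mconst (of_nat m)"
  by (induction m) (simp_all add: mconst_simps)

text \<open>Row \<open>i\<close> occurs in the minors of size at least \<open>p - i\<close>, and
  normal ordering contributes \<open>- k\<close>. For \<open>i = 0\<close> no minor occurs, so the
  first weight is \<open>- k\<close>, while the last weight of the second block is 0; this is where
  \<open>k = \<lambda>\<^sub>n - \<lambda>\<^sub>1\<close> comes from.\<close>

lemma weight_p:
  assumes "i < p"
  shows "fock_E p k i i (xpart * ypart) = mconst (- of_nat ((\<Sum>r\<in>{p - i..<p}. e r) + k)) * (xpart * ypart)"
proof -
  have "polarization k i i (xpart * ypart) = ((\<Sum>r\<in>{1..<p}. of_nat (e r) * (if p - r \<le> i \<and> i < p then 1 else 0))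
      + (\<Sum>r\<in>{1..<q}. of_nat (e' r) * 0)) * (xpart * ypart)"
    using assms by (intro polarization_parts) (auto simp: polarization_xminor(2) polarization_yminor(2))
  also have "(\<Sum>r\<in>{1..<p}. of_nat (e r) * (if p - r \<le> i \<and> i < p then 1 else 0)) = (\<Sum>r\<in>{p - i..<p}. of_nat (e r) :: mpoly)"
    using assms by (intro sum.mono_neutral_cong_right) auto
  finally show ?thesis using assms
    by (simp add: fock_E_compact_p mconst_simps of_nat_mconst[symmetric] of_nat_sum[symmetric] algebra_simps del: of_nat_sum)
qed

lemma weight_q:
  assumes "p \<le> i" "i < n"
  shows "fock_E p k i i (xpart * ypart) = mconst (of_nat (\<Sum>r\<in>{i - p + 1..<q}. e' r)) * (xpart * ypart)"
proof -
  have "polarization k i i (xpart * ypart) = ((\<Sum>r\<in>{1..<p}. of_nat (e r) * 0)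
      + (\<Sum>r\<in>{1..<q}. of_nat (e' r) * (if p \<le> i \<and> i < p + r then 1 else 0))) * (xpart * ypart)"
    using assms by (intro polarization_parts) (auto simp: polarization_xminor(2) polarization_yminor(2))
  also have "(\<Sum>r\<in>{1..<q}. of_nat (e' r) * (if p \<le> i \<and> i < p + r then 1 else 0)) = (\<Sum>r\<in>{i - p + 1..<q}. of_nat (e' r) :: mpoly)"
    using assms by (intro sum.mono_neutral_cong_right) auto
  finally show ?thesis using assms
    by (simp add: fock_E_compact_q of_nat_mconst[symmetric] of_nat_sum[symmetric] del: of_nat_sum)
qed

end

section \<open>Local finiteness and embedding into sequences\<close>

lemma keys_pderivative: "\<alpha> \<in> Poly_Mapping.keys (pderivative x f) \<Longrightarrow> add_mset x \<alpha> \<in> Poly_Mapping.keys f"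
  by (auto simp: in_keys_iff lookup_pderivative)

text \<open>Compact generators contain one multiplication and one derivative, hence do not increase
  the degree. Polynomials of bounded degree in finitely many variables form the required
  space.\<close>

lemma fock_locally_finite:
  "\<exists>W B. x \<in> W \<and> module.subspace (\<lambda>c. (*) (mconst c)) W \<and> finite B \<and> W \<subseteq> module.span (\<lambda>c. (*) (mconst c)) B \<and>
    (\<forall>i<n. \<forall>j<n. (i < p) = (j < p) \<longrightarrow> (\<forall>w\<in>W. fock_E p k i j w \<in> W))"
proof -
  interpret vector_space "\<lambda>c. (*) (mconst c)" by (rule vector_space_mpoly)
  \<comment> \<open>The polynomial \<open>x\<close> is arbitrary and may contain variables outside
    the matrix, so its own variables are added.\<close>
  define A where "A = case_prod zvar ` ({..<n} \<times> {..<k}) \<union> (\<Union>\<alpha>\<in>Poly_Mapping.keys x. set_mset \<alpha>)"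
  have A: "finite A" by (auto simp: A_def)
  have zA: "zvar i a \<in> A" if "i < n" "a < k" for i a using that by (auto simp: A_def)
  obtain d where d: "\<And>\<alpha>. \<alpha> \<in> Poly_Mapping.keys x \<Longrightarrow> size \<alpha> \<le> d"
    using finite_nat_set_iff_bounded_le[of "size ` Poly_Mapping.keys x"] by auto
  define K where "K = {\<alpha>. set_mset \<alpha> \<subseteq> A \<and> size \<alpha> \<le> d}"
  have "K \<subseteq> (\<Union>m\<in>{..d}. multisets_of_size A m)" by (auto simp: K_def multisets_of_size_def)
  moreover have "finite (\<Union>m\<in>{..d}. multisets_of_size A m)"
    using finite_multisets_of_size[OF A] by blast
  ultimately have K: "finite K" by (rule finite_subset)
  define W where "W = {f :: mpoly. Poly_Mapping.keys f \<subseteq> K}"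
  have sub: "subspace W"
  proof (rule subspaceI)
    show "0 \<in> W" by (simp add: W_def)
    show "f + g \<in> W" if "f \<in> W" "g \<in> W" for f g
      using that Poly_Mapping.keys_add[of f g] unfolding W_def by blast
    show "mconst c * f \<in> W" if "f \<in> W" for c f
      using that keys_mconst_mult[of c f] unfolding W_def by blast
  qed
  have sum_W: "(\<Sum>a\<in>I. f a) \<in> W" if "\<And>a. a \<in> I \<Longrightarrow> f a \<in> W" for I and f :: "nat \<Rightarrow> mpoly"
    using that by (rule subspace_sum[OF sub])
  have "x \<in> W" using d by (auto simp: W_def K_def A_def)
  moreover have "W \<subseteq> span ((\<lambda>\<alpha>. Poly_Mapping.single \<alpha> 1) ` K)"
  proof
    fix f assume f: "f \<in> W"
    have "f = (\<Sum>\<alpha>\<in>Poly_Mapping.keys f. mconst (Poly_Mapping.lookup f \<alpha>) * Poly_Mapping.single \<alpha> 1)"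
      by (intro poly_mapping_eqI) (simp add: lookup_sum lookup_mconst_mult lookup_single when_def sum.delta in_keys_iff if_distrib cong: if_cong)
    also have "\<dots> \<in> span ((\<lambda>\<alpha>. Poly_Mapping.single \<alpha> 1) ` K)"
      using f by (intro span_sum span_scale span_base) (auto simp: W_def)
    finally show "f \<in> span ((\<lambda>\<alpha>. Poly_Mapping.single \<alpha> 1) ` K)" .
  qed
  moreover have "fock_E p k i j w \<in> W" if ij: "i < n" "j < n" "(i < p) = (j < p)" and w: "w \<in> W" for i j w
    unfolding fock_E_def
  proof (rule sum_W)
    fix a assume "a \<in> {..<k}"
    then have z: "zvar i a \<in> A" "zvar j a \<in> A" using ij zA by auto
    show "fock_P p i a (fock_Q p j a w) \<in> W"
    proof (cases "i < p")
      case True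
      have "\<alpha> \<in> K" if \<alpha>: "\<alpha> \<in> Poly_Mapping.keys (pderivative (zvar i a) (mvar (zvar j a) * w))" for \<alpha>
      proof -
        obtain \<beta> where \<beta>: "add_mset (zvar i a) \<alpha> = add_mset (zvar j a) \<beta>" "\<beta> \<in> Poly_Mapping.keys w"
          using keys_pderivative[OF \<alpha>] by (auto simp: keys_mvar_mult)
        have "set_mset (add_mset (zvar i a) \<alpha>) \<subseteq> A" "size (add_mset (zvar i a) \<alpha>) \<le> Suc d"
          unfolding \<beta>(1) using \<beta>(2) w z by (auto simp: W_def K_def)
        then show ?thesis by (simp add: K_def)
      qed
      then show ?thesis using True ij by (auto simp: W_def fock_P_def fock_Q_def)
    next
      case False
      have "\<alpha> \<in> K" if \<alpha>: "\<alpha> \<in> Poly_Mapping.keys (mvar (zvar i a) * pderivative (zvar j a) w)" for \<alpha>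
      proof -
        obtain \<beta> where \<beta>: "\<alpha> = add_mset (zvar i a) \<beta>" "\<beta> \<in> Poly_Mapping.keys (pderivative (zvar j a) w)"
          using \<alpha> by (auto simp: keys_mvar_mult)
        have "add_mset (zvar j a) \<beta> \<in> K" using keys_pderivative[OF \<beta>(2)] w by (auto simp: W_def)
        then show ?thesis using z by (auto simp: K_def \<beta>(1))
      qed
      then show ?thesis using False ij by (auto simp: W_def fock_P_def fock_Q_def)
    qed
  qed
  ultimately show ?thesis using sub K by blast
qed

text \<open>The sequence lists the coefficients along an enumeration of lists of variables. Every
  monomial comes from some list; repetitions do no harm to injectivity.\<close>

lemma mpoly_embedding:
  "\<exists>\<phi> :: mpoly \<Rightarrow> nat \<Rightarrow> complex. inj \<phi> \<and> (\<forall>f g. \<phi> (f + g) = \<phi> f + \<phi> g) \<and>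
    (\<forall>c f. \<phi> (mconst c * f) = seq_scale c (\<phi> f))"
proof -
  define \<phi> :: "mpoly \<Rightarrow> nat \<Rightarrow> complex" where "\<phi> f i = Poly_Mapping.lookup f (mset (from_nat i))" for f i
  have "f = g" if *: "\<phi> f = \<phi> g" for f g
  proof (rule poly_mapping_eqI)
    fix \<alpha> :: "nat multiset"
    obtain xs where "\<alpha> = mset xs" using ex_mset by metis
    then show "Poly_Mapping.lookup f \<alpha> = Poly_Mapping.lookup g \<alpha>"
      using fun_cong[OF *, of "to_nat xs"] by (simp add: \<phi>_def)
  qed
  then have "inj \<phi>" by (rule injI)
  then show ?thesis
    by (intro exI[of _ \<phi>]) (simp add: \<phi>_def fun_eq_iff lookup_add lookup_mconst_mult seq_scale_def)
qed

lemma Ints_less_imp_add1_le: "x - y \<in> \<int> \<Longrightarrow> y < x \<Longrightarrow> y + 1 \<le> (x::real)"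
proof -
  assume "x - y \<in> \<int>" "y < x"
  then obtain z where z: "x - y = of_int z" "0 < real_of_int z" by (auto elim!: Ints_cases)
  then have "1 \<le> z" by simp
  then have "1 \<le> real_of_int z" by simp
  then show ?thesis using z by simp
qed

lemma k_dominant_nth:
  assumes "k_dominant_regular p L"
  shows "i < j \<Longrightarrow> j < p \<Longrightarrow> j < length L \<Longrightarrow> L ! i > L ! j"
    and "p \<le> i \<Longrightarrow> i < j \<Longrightarrow> j < length L \<Longrightarrow> L ! i > L ! j"
proof -
  show "L ! i > L ! j" if "i < j" "j < p" "j < length L"
    using assms that sorted_wrt_nth_less[of "(>)" "take p L" i j] by (simp add: k_dominant_regular_def)
  show "L ! i > L ! j" if "p \<le> i" "i < j" "j < length L"
    using assms that sorted_wrt_nth_less[of "(>)" "drop p L" "i - p" "j - p"] by (simp add: k_dominant_regular_def)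
qed

lemma sum_telescope_nat:
  fixes g :: "nat \<Rightarrow> real"
  shows "d < m \<Longrightarrow> (\<Sum>r\<in>{d + 1..<m}. g (r - 1) - g r) = g d - g (m - 1)"
proof (induction m)
  case (Suc m)
  show ?case
  proof (cases "d = m")
    case False
    then have "d < m" using Suc.prems by simp
    then have "{d + 1..<Suc m} = insert m {d + 1..<m}" by auto
    then show ?thesis using Suc.IH[OF \<open>d < m\<close>] \<open>d < m\<close> by simp
  qed simp
qed simp

section \<open>Sufficiency of the bound\<close>

theorem unitary_param_of_bound:
  assumes L: "length L = p + q" and k: "k_dominant_regular p L" and int: "integral_param L"
    and ij: "i0 < p" "p \<le> j0" "j0 < p + q"
    and stri: "\<And>i. i \<le> i0 \<Longrightarrow> L ! i = L ! 0 - real i"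
    and strj: "\<And>j. j0 \<le> j \<Longrightarrow> j < p + q \<Longrightarrow> L ! j = L ! j0 - real (j - j0)"
    and bound: "L ! i0 - L ! j0 \<le> 1"
  shows "unitary_param p q L"
proof -
  define n where "n = p + q"
  define l l' where "l = p - 1 - i0" and "l' = j0 - p"
  have intL: "L ! i - L ! j \<in> \<int>" if "i < n" "j < n" for i j
    using int that L by (simp add: integral_param_def n_def)
  have nat_real: "real (nat \<lfloor>x\<rfloor>) = x" if "x \<in> \<int>" "0 \<le> x" for x :: real
    using that by (auto elim!: Ints_cases)
  have step: "L ! (i + 1) + 1 \<le> L ! i" if "i + 1 < p \<or> p \<le> i" "i + 1 < n" for i
    using k_dominant_nth[OF k, of i "i + 1"] that L intL[of i "i + 1"]
    by (intro Ints_less_imp_add1_le) (auto simp: n_def)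
  \<comment> \<open>The exponents are the differences of consecutive coordinates of the highest
    weight; the \<open>- 1\<close> is the contribution of \<open>rho\<close>. Inside a string they
    vanish, which limits the sizes of the minors to \<open>l\<close> and \<open>l'\<close>.\<close>
  define e where "e r = nat \<lfloor>L ! (p - 1 - r) - L ! (p - r) - 1\<rfloor>" for r
  define e' where "e' r = nat \<lfloor>L ! (p + r - 1) - L ! (p + r) - 1\<rfloor>" for r
  define k where "k = nat \<lfloor>L ! (n - 1) + real (n - 1) - L ! 0\<rfloor>"
  have e: "real (e r) = L ! (p - 1 - r) - L ! (p - r) - 1" if "r \<in> {1..<p}" for r
  proof -
    have *: "p - 1 - r + 1 = p - r" and "p - r < p" "p - r < n" using that n_def by auto
    have "L ! (p - 1 - r) - L ! (p - r) - 1 \<in> \<int>"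
      using that n_def by (intro Ints_diff[OF intL Ints_1]) auto
    moreover have "0 \<le> L ! (p - 1 - r) - L ! (p - r) - 1"
      using step[of "p - 1 - r", unfolded *] \<open>p - r < p\<close> \<open>p - r < n\<close> by simp
    ultimately show ?thesis unfolding e_def by (rule nat_real)
  qed
  have e': "real (e' r) = L ! (p + r - 1) - L ! (p + r) - 1" if "r \<in> {1..<q}" for r
  proof -
    have *: "p + r - 1 + 1 = p + r" and "p \<le> p + r - 1" "p + r < n" using that n_def by auto
    have "L ! (p + r - 1) - L ! (p + r) - 1 \<in> \<int>"
      using that n_def by (intro Ints_diff[OF intL Ints_1]) auto
    moreover have "0 \<le> L ! (p + r - 1) - L ! (p + r) - 1"
      using step[of "p + r - 1", unfolded *] \<open>p \<le> p + r - 1\<close> \<open>p + r < n\<close> by simp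
    ultimately show ?thesis unfolding e'_def by (rule nat_real)
  qed
  have ends: "L ! 0 = L ! i0 + real i0" "L ! (n - 1) = L ! j0 - real (n - 1 - j0)"
    using stri[of i0] strj[of "n - 1"] ij n_def by auto
  \<comment> \<open>Along the strings the right-hand side equals
    \<open>L ! j0 - L ! i0 + (j0 - i0)\<close>, and \<open>l + l' = j0 - i0 - 1\<close>: the bound
    is precisely the condition that both sets of columns fit.\<close>
  have "real l + real l' \<le> L ! (n - 1) + real (n - 1) - L ! 0"
    using bound ij unfolding ends by (simp add: l_def l'_def n_def of_nat_diff)
  moreover have "L ! (n - 1) + real (n - 1) - L ! 0 \<in> \<int>"
    using Ints_add[OF intL[of "n - 1" 0] Ints_of_nat[of "n - 1"]] ij n_def by (simp add: algebra_simps)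
  ultimately have kk: "real k = L ! (n - 1) + real (n - 1) - L ! 0" and "real l + real l' \<le> real k"
    using nat_real unfolding k_def by (auto simp: nat_real)
  interpret F: fock_highest_weight p q n k l l' e e'
  proof
    show "n = p + q" by (rule n_def)
    show "l + l' \<le> k" using \<open>real l + real l' \<le> real k\<close> by linarith
    show "r \<le> l" if "r \<in> {1..<p}" "e r \<noteq> 0" for r
    proof (rule ccontr)
      assume "\<not> r \<le> l"
      then have "p - r \<le> i0" "p - 1 - r \<le> i0" using that by (auto simp: l_def)
      then have "real (e r) = 0"
        unfolding e[OF that(1)] using stri[of "p - r"] stri[of "p - 1 - r"] that by (simp add: of_nat_diff)
      then show False using that(2) by simp
    qed
    show "r \<le> l'" if "r \<in> {1..<q}" "e' r \<noteq> 0" for r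
    proof (rule ccontr)
      assume "\<not> r \<le> l'"
      then have "j0 \<le> p + r - 1" "p + r < p + q" using that by (auto simp: l'_def)
      then obtain t where t: "p + r - 1 = j0 + t" using le_Suc_ex by blast
      then have t': "p + r = Suc (j0 + t)" using that by auto
      have "real (e' r) = 0"
        unfolding e'[OF that(1)] t unfolding t'
        using strj[of "Suc (j0 + t)"] strj[of "j0 + t"] \<open>p + r < p + q\<close> t' by simp
      then show False using that(2) by simp
    qed
  qed
  define f where "f = F.xpart * F.ypart"
  define lam where "lam = map2 (-) L (rho n)"
  have lam: "lam ! i = L ! i - ((real n - 1) / 2 - real i)" if "i < n" for i
    using that L by (simp add: lam_def rho_def n_def)
  \<comment> \<open>Weights of \<open>sl(n)\<close> matter up to a constant; this choice gives the
    last coordinate 0, as for the vector built from minors.\<close>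
  define wt where "wt i = lam ! i - lam ! (n - 1)" for i
  have wt: "wt i = L ! i + real i - L ! (n - 1) - real (n - 1)" if "i < n" for i
    using lam[of i] lam[of "n - 1"] that by (simp add: wt_def)
  have weight: "fock_E p k i i f = mconst (of_real (wt i)) * f" if i: "i < n" for i
  proof (cases "i < p")
    case True
    define d where "d = p - 1 - i"
    have d: "d < p" "p - i = d + 1" "p - 1 - d = i" using True by (auto simp: d_def)
    define g where "g r = - (L ! (p - 1 - r) - real r)" for r
    have "real (\<Sum>r\<in>{d + 1..<p}. e r) = (\<Sum>r\<in>{d + 1..<p}. g (r - 1) - g r)"
      unfolding of_nat_sum
    proof (intro sum.cong refl)
      fix r assume r: "r \<in> {d + 1..<p}"
      then have "p - 1 - (r - 1) = p - r" by auto
      then show "real (e r) = g (r - 1) - g r"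
        using r by (subst e) (auto simp: g_def of_nat_diff)
    qed
    also have "\<dots> = g d - g (p - 1)" using d(1) by (rule sum_telescope_nat)
    also have "\<dots> = L ! 0 - L ! i - real i"
      using True by (simp add: g_def d(3)) (simp add: d_def of_nat_diff)
    finally have "real (\<Sum>r\<in>{p - i..<p}. e r) + real k = - wt i"
      using kk wt[OF i] d(2) by simp
    then have "of_real (wt i) = - complex_of_nat ((\<Sum>r\<in>{p - i..<p}. e r) + k)"
      by (metis add.inverse_inverse of_nat_add of_real_minus of_real_of_nat_eq)
    then show ?thesis using F.weight_p[OF True] by (simp add: f_def)
  next
    case False
    define d where "d = i - p"
    have d: "d < q" "i = p + d" using False i by (auto simp: d_def n_def)
    define g where "g r = L ! (p + r) + real r" for r
    have "real (\<Sum>r\<in>{d + 1..<q}. e' r) = (\<Sum>r\<in>{d + 1..<q}. g (r - 1) - g r)"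
      unfolding of_nat_sum
    proof (intro sum.cong refl)
      fix r assume r: "r \<in> {d + 1..<q}"
      then have "p + (r - 1) = p + r - 1" by auto
      then show "real (e' r) = g (r - 1) - g r"
        using r by (subst e') (auto simp: g_def of_nat_diff)
    qed
    also have "\<dots> = g d - g (q - 1)" using d(1) by (rule sum_telescope_nat)
    also have "\<dots> = wt i"
    proof -
      have "p + (q - 1) = n - 1" "real (n - 1) = real p + real (q - 1)" using d by (auto simp: n_def)
      then show ?thesis using wt[OF i] d(2) by (simp add: g_def)
    qed
    finally have "of_real (wt i) = complex_of_nat (\<Sum>r\<in>{d + 1..<q}. e' r)"
      by (metis of_real_of_nat_eq)
    then show ?thesis using F.weight_q[of i] False i by (simp add: f_def d_def)
  qed
  interpret U: unitary_gl "\<lambda>c. (*) (mconst c)" UNIV n "fock_E p k" p fischer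
    by (rule unitary_gl_fock)
  interpret M: highest_weight_gl "\<lambda>c. (*) (mconst c)" n "fock_E p k" p fischer f wt
    using F.nonzero[folded f_def] by unfold_locales (auto simp: F.raise[folded f_def] weight)
  have "is_L (\<lambda>c. (*) (mconst c)) p q lam M.N M.act"
    unfolding is_L_def n_def[symmetric]
    using M.N.sl_module_axioms M.irreducible_N M.locally_k_finite_N[OF n_def fock_locally_finite]
      M.highest_weight_vector_N[OF wt_def] by blast
  moreover have "M.N.unitary_form p fischer" using n_def by (rule M.unitary_form_N)
  moreover obtain \<phi> :: "mpoly \<Rightarrow> nat \<Rightarrow> complex" where "inj \<phi>" "\<And>f g. \<phi> (f + g) = \<phi> f + \<phi> g"
    "\<And>c f. \<phi> (mconst c * f) = seq_scale c (\<phi> f)" using mpoly_embedding by blast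
  ultimately have "\<exists>V' act'. is_L seq_scale p q lam V' act' \<and>
    (\<exists>h'. sl_module.unitary_form seq_scale (p + q) V' act' p h')"
    unfolding n_def by (intro is_L_transport) auto
  then show ?thesis unfolding unitary_param_def lam_def n_def by blast
qed

section \<open>Unitary conjugates\<close>

lemma desc_unique:
  assumes "sorted_wrt (>) xs" "sorted_wrt (>) ys" "mset xs = mset ys"
  shows "xs = (ys :: real list)"
proof -
  have "rev xs = rev ys"
    using assms by (intro strict_sorted_equal) (auto simp: sorted_wrt_rev dest: mset_eq_setD)
  then show ?thesis by simp
qed

text \<open>Half-open slices with indices from 0, as opposed to the closed ones with indices from 1
  in \<open>segment\<close>; they concatenate without case distinctions on empty pieces.\<close>

definition chunk :: "'a list \<Rightarrow> nat \<Rightarrow> nat \<Rightarrow> 'a list" where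
  "chunk D i j = take (j - i) (drop i D)"

lemma length_chunk: "j \<le> length D \<Longrightarrow> length (chunk D i j) = j - i"
  by (auto simp: chunk_def)

lemma nth_chunk: "j \<le> length D \<Longrightarrow> t < j - i \<Longrightarrow> chunk D i j ! t = D ! (i + t)"
  by (auto simp: chunk_def)

lemma chunk_append: "i \<le> j \<Longrightarrow> j \<le> k \<Longrightarrow> chunk D i j @ chunk D j k = chunk D i k"
  using take_add[of "j - i" "k - j" "drop i D"] by (simp add: chunk_def)

lemma chunk_from_0: "chunk D 0 i = take i D"
  by (simp add: chunk_def)

lemma chunk_to_length: "length D \<le> n \<Longrightarrow> chunk D i n = drop i D"
  by (simp add: chunk_def)

text \<open>\<open>D\<close> is cut at three places into \<open>U, A, B, R\<close>; the first block
  is \<open>A @ R\<close>, the second \<open>U @ B\<close>. All string conjugates have this form,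
  with \<open>A @ B\<close> a string.\<close>

definition interleave :: "real list \<Rightarrow> nat \<Rightarrow> nat \<Rightarrow> nat \<Rightarrow> real list" where
  "interleave D lo mid hi = (chunk D lo mid @ drop hi D) @ (take lo D @ chunk D mid hi)"

definition string_on :: "real list \<Rightarrow> nat \<Rightarrow> nat \<Rightarrow> bool" where
  "string_on D i j \<longleftrightarrow> (\<forall>t. i \<le> t \<and> t + 1 < j \<longrightarrow> D ! (t + 1) = D ! t - 1)"

lemma string_on_nth: "string_on D i j \<Longrightarrow> i + t < j \<Longrightarrow> D ! (i + t) = D ! i - real t"
proof (induction t)
  case (Suc t)
  then show ?case unfolding string_on_def using Suc.IH by (auto dest!: spec[of _ "i + t"])
qed simp

lemma string_onI: "(\<And>t. i + t < j \<Longrightarrow> D ! (i + t) = x - real t) \<Longrightarrow> string_on D i j"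
proof (unfold string_on_def, intro allI impI)
  fix t assume *: "\<And>t. i + t < j \<Longrightarrow> D ! (i + t) = x - real t" and t: "i \<le> t \<and> t + 1 < j"
  show "D ! (t + 1) = D ! t - 1"
    using *[of "t - i"] *[of "t + 1 - i"] t by (simp add: of_nat_diff)
qed

lemma p_prime_eqI:
  assumes "1 \<le> k" "k \<le> p" "string_on L 0 k" "k < p \<Longrightarrow> L ! k \<noteq> L ! (k - 1) - 1"
  shows "p_prime p L = k"
  unfolding p_prime_def
proof (rule Max_eqI)
  have "coord L (i + 1) = coord L i - 1" if "i \<in> {1..<k}" for i
    using assms(3)[unfolded string_on_def, rule_format, of "i - 1"] that by (simp add: coord_def)
  then show "k \<in> {k \<in> {1..p}. \<forall>i\<in>{1..<k}. coord L (i + 1) = coord L i - 1}"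
    using assms by simp
  fix m assume m: "m \<in> {k \<in> {1..p}. \<forall>i\<in>{1..<k}. coord L (i + 1) = coord L i - 1}"
  show "m \<le> k"
  proof (rule ccontr)
    assume "\<not> m \<le> k"
    then have "k \<in> {1..<m}" using assms by auto
    then have "coord L (k + 1) = coord L k - 1" using m by blast
    then show False using assms \<open>\<not> m \<le> k\<close> m by (simp add: coord_def)
  qed
qed simp

lemma q_prime_eqI:
  assumes k: "1 \<le> k" "k \<le> q" and j: "j + k = p + q" and str: "string_on L j (p + q)"
    and gap: "k < q \<Longrightarrow> L ! j \<noteq> L ! (j - 1) - 1"
  shows "q_prime p q L = k"
proof -
  let ?S = "{k \<in> {1..q}. \<forall>i\<in>{p + q - k + 1..<p + q}. coord L (i + 1) = coord L i - 1}"
  have "coord L (i + 1) = coord L i - 1" if "i \<in> {j + 1..<p + q}" for i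
  proof -
    obtain t where t: "i = Suc t" "j \<le> t" using \<open>i \<in> _\<close> by (cases i) auto
    then have "L ! (t + 1) = L ! t - 1" using str \<open>i \<in> _\<close> by (simp add: string_on_def)
    then show ?thesis by (simp add: coord_def t)
  qed
  moreover have "p + q - k + 1 = j + 1" using j by linarith
  ultimately have "k \<in> ?S" using k by (simp only: mem_Collect_eq atLeastAtMost_iff) blast
  moreover have "m \<le> k" if m: "m \<in> ?S" for m
  proof (rule ccontr)
    assume "\<not> m \<le> k"
    have "m \<le> q" using m by (simp only: mem_Collect_eq atLeastAtMost_iff)
    have "j \<in> {p + q - m + 1..<p + q}" "k < q" "0 < j"
      using \<open>\<not> m \<le> k\<close> \<open>m \<le> q\<close> j k by auto
    then have "coord L (j + 1) = coord L j - 1" using m by blast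
    then show False using gap[OF \<open>k < q\<close>] by (simp add: coord_def)
  qed
  ultimately show ?thesis unfolding q_prime_def by (intro Max_eqI) auto
qed

lemma initial_string:
  assumes "1 \<le> (p::nat)"
  obtains k where "1 \<le> k" "k \<le> p" "string_on L 0 k" "k < p \<Longrightarrow> L ! k \<noteq> L ! (k - 1) - 1"
proof -
  define S where "S = {k \<in> {1..p}. string_on L 0 k}"
  have S: "finite S" "1 \<in> S" using assms by (auto simp: S_def string_on_def)
  obtain m where M: "m \<in> S" "\<And>x. x \<in> S \<Longrightarrow> x \<le> m"
    using Max_in[of S] Max_ge[of S] S by blast
  show ?thesis
  proof (rule that[of "m"])
    assume "m < p"
    show "L ! m \<noteq> L ! (m - 1) - 1"
    proof
      assume *: "L ! m = L ! (m - 1) - 1"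
      have "string_on L 0 (m + 1)"
        unfolding string_on_def
      proof (intro allI impI)
        fix t assume "0 \<le> t \<and> t + 1 < m + 1"
        then show "L ! (t + 1) = L ! t - 1"
          using M * by (cases "t + 1 = m") (auto simp: S_def string_on_def)
      qed
      then have "m + 1 \<in> S" using \<open>m < p\<close> by (auto simp: S_def)
      then show False using M(2)[of "m + 1"] by simp
    qed
  qed (use M in \<open>auto simp: S_def\<close>)
qed

lemma final_string:
  assumes "1 \<le> (q::nat)"
  obtains j where "p \<le> j" "j < p + q" "string_on L j (p + q)" "p < j \<Longrightarrow> L ! j \<noteq> L ! (j - 1) - 1"
proof -
  define S where "S = {j \<in> {p..<p + q}. string_on L j (p + q)}"
  have S: "finite S" "p + q - 1 \<in> S" using assms by (auto simp: S_def string_on_def)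
  obtain m where M: "m \<in> S" "\<And>x. x \<in> S \<Longrightarrow> m \<le> x"
    using Min_in[of S] Min_le[of S] S by blast
  show ?thesis
  proof (rule that[of m])
    assume "p < m"
    show "L ! m \<noteq> L ! (m - 1) - 1"
    proof
      assume *: "L ! m = L ! (m - 1) - 1"
      have "string_on L (m - 1) (p + q)"
        unfolding string_on_def
      proof (intro allI impI)
        fix t assume t: "m - 1 \<le> t \<and> t + 1 < p + q"
        show "L ! (t + 1) = L ! t - 1"
          using * M t \<open>p < m\<close> by (cases "t = m - 1") (auto simp: S_def string_on_def)
      qed
      then have "m - 1 \<in> S" using \<open>p < m\<close> M by (auto simp: S_def)
      then show False using M(2)[of "m - 1"] \<open>p < m\<close> by simp
    qed
  qed (use M in \<open>auto simp: S_def\<close>)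
qed

text \<open>Let \<open>A\<close> be the maximal string at the start of the first block and
  \<open>B\<close> the one at the end of the second. Unless the whole first block lies below the
  second, the bound forces \<open>B\<close> to continue \<open>A\<close> without a gap, and the
  other coordinates lie beyond this joint string on the appropriate sides. Sorting then determines
  \<open>D\<close>.\<close>

lemma unitary_conjugate_shape:
  assumes p: "1 \<le> p" and q: "1 \<le> q" and lenD: "length D = p + q"
    and D: "g_dominant_regular D" and int: "integral_param D"
    and mset: "mset L = mset D" and k: "k_dominant_regular p L" and uni: "unitary_param p q L"
  shows "L = drop q D @ take q D \<or> (\<exists>lo mid hi. lo < q \<and> q < hi \<and> lo < mid \<and> mid < hi \<and> hi \<le> p + q \<and> lo + hi = q + mid \<and>
    string_on D lo hi \<and> L = interleave D lo mid hi)"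
proof -
  define n where "n = p + q"
  have len: "length L = n" using mset lenD by (metis n_def size_mset)
  have distD: "distinct D"
    using D strict_sorted_iff[of "rev D"] by (simp add: g_dominant_regular_def sorted_wrt_rev)
  then have distL: "distinct L" using mset by (metis mset_eq_imp_distinct_iff)
  have inj: "L ! i = L ! j \<longleftrightarrow> i = j" if "i < n" "j < n" for i j
    using that distL len by (simp add: nth_eq_iff_index_eq)
  have intL: "L ! i - L ! j \<in> \<int>" if "i < n" "j < n" for i j
    using int mset that len unfolding integral_param_def by (metis mset_eq_setD nth_mem)
  note kd = k_dominant_nth[OF k]
  obtain p' where p': "1 \<le> p'" "p' \<le> p" "string_on L 0 p'" "p' < p \<Longrightarrow> L ! p' \<noteq> L ! (p' - 1) - 1"
    using initial_string[OF p] by metis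
  obtain j0 where j0: "p \<le> j0" "j0 < p + q" "string_on L j0 (p + q)" "p < j0 \<Longrightarrow> L ! j0 \<noteq> L ! (j0 - 1) - 1"
    using final_string[OF q] by metis
  define i0 where "i0 = p' - 1"
  have ij: "i0 < p" "p \<le> j0" "j0 < n" "i0 < n" "p + q = n"
    using p' j0 by (auto simp: i0_def n_def)
  define u where "u = j0 - p"
  have u: "j0 = p + u" "u < q" using ij by (auto simp: u_def)
  have top: "L ! t = L ! 0 - real t" if "t \<le> i0" for t
    using string_on_nth[OF p'(3), of t] that p' by (simp add: i0_def)
  have bot: "L ! (j0 + t) = L ! j0 - real t" if "j0 + t < n" for t
    using string_on_nth[OF j0(3), of t] that by (simp add: n_def)
  have le0: "L ! i \<le> L ! 0" if "i < p" for i
    using kd(1)[of 0 i] that len ij by (cases "i = 0") auto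
  have gen: "L ! (n - 1) \<le> L ! j" if "p \<le> j" "j < n" for j
  proof -
    have "j < n - 1 \<or> j = n - 1" using that by linarith
    then show ?thesis using kd(2)[of j "n - 1"] that len by auto
  qed
  \<comment> \<open>By integrality the drop after \<open>i0\<close> is at least 1, and it is not 1
    because the string is maximal.\<close>
  have gapi: "L ! i0 - L ! i \<ge> 2" if "i0 < i" "i < p" for i
  proof -
    have "L ! (i0 + 1) < L ! i0" using kd(1)[of i0 "i0 + 1"] that len n_def by simp
    then have "L ! (i0 + 1) + 1 \<le> L ! i0"
      using intL[of i0 "i0 + 1"] that n_def by (intro Ints_less_imp_add1_le) auto
    moreover have "L ! (i0 + 1) + 1 \<noteq> L ! i0"
    proof -
      have "p' < p" "i0 + 1 = p'" using that p' by (auto simp: i0_def)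
      then show ?thesis using p'(4) by (auto simp: i0_def)
    qed
    ultimately have "L ! (i0 + 1) + 1 < L ! i0" by simp
    moreover have "L ! i0 - (L ! (i0 + 1) + 1) \<in> \<int>"
      using Ints_diff[OF intL[of i0 "i0 + 1"] Ints_1] that n_def by (simp add: algebra_simps)
    ultimately have "L ! (i0 + 1) + 1 + 1 \<le> L ! i0" by (intro Ints_less_imp_add1_le)
    moreover have "L ! i \<le> L ! (i0 + 1)"
      using kd(1)[of "i0 + 1" i] that len n_def by (cases "i = i0 + 1") auto
    ultimately show ?thesis by simp
  qed
  have gapj: "L ! j - L ! j0 \<ge> 2" if "p \<le> j" "j < j0" for j
  proof -
    have j1: "p \<le> j0 - 1" "j0 - 1 < j0" using that by auto
    have "L ! j0 < L ! (j0 - 1)" using kd(2)[OF j1] ij len by simp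
    then have "L ! j0 + 1 \<le> L ! (j0 - 1)"
      using intL[of "j0 - 1" j0] ij by (intro Ints_less_imp_add1_le) auto
    moreover have "L ! j0 + 1 \<noteq> L ! (j0 - 1)" using j0(4) that by auto
    ultimately have "L ! j0 + 1 < L ! (j0 - 1)" by simp
    moreover have "L ! (j0 - 1) - (L ! j0 + 1) \<in> \<int>"
      using Ints_diff[OF intL[of "j0 - 1" j0] Ints_1] ij by (simp add: algebra_simps)
    ultimately have "L ! j0 + 1 + 1 \<le> L ! (j0 - 1)" by (intro Ints_less_imp_add1_le)
    moreover have "L ! (j0 - 1) \<le> L ! j"
    proof -
      have "j < j0 - 1 \<or> j = j0 - 1" "j0 - 1 < length L" using that len ij by linarith+
      then show ?thesis using kd(2)[of j "j0 - 1"] that by (auto simp del: One_nat_def)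
    qed
    ultimately show ?thesis by simp
  qed
  have bound: "L ! i0 - L ! j0 \<le> 1"
    using uni len ij(1-3) gapi gapj unfolding n_def by (intro unitary_param_bound) auto
  \<comment> \<open>The string takes every integer step between its ends, so a coordinate in this
    range would occur twice.\<close>
  have not_top: "\<not> (L ! i0 \<le> L ! j \<and> L ! j \<le> L ! 0)" if "p \<le> j" "j < n" for j
  proof
    assume *: "L ! i0 \<le> L ! j \<and> L ! j \<le> L ! 0"
    have "L ! 0 - L ! j \<in> \<int>" using that ij by (intro intL) auto
    then obtain z where z: "L ! 0 - L ! j = of_int z" by (elim Ints_cases)
    have "0 \<le> z" using * z by simp
    moreover have "of_int z \<le> real i0" using * z top[of i0] by simp
    then have "z \<le> int i0" by linarith
    ultimately have "L ! nat z = L ! j" using top[of "nat z"] z by simp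
    then show False using inj[of "nat z" j] that ij \<open>z \<le> int i0\<close> \<open>0 \<le> z\<close> by auto
  qed
  have not_bot: "\<not> (L ! (n - 1) \<le> L ! i \<and> L ! i \<le> L ! j0)" if "i < p" for i
  proof
    assume *: "L ! (n - 1) \<le> L ! i \<and> L ! i \<le> L ! j0"
    have "L ! j0 - L ! i \<in> \<int>" using that ij by (intro intL) auto
    then obtain z where z: "L ! j0 - L ! i = of_int z" by (elim Ints_cases)
    have "0 \<le> z" using * z by simp
    moreover have "L ! (n - 1) = L ! j0 - real (n - 1 - j0)" using bot[of "n - 1 - j0"] ij by simp
    then have "of_int z \<le> real (n - 1 - j0)" using * z by simp
    then have z': "z \<le> int (n - 1 - j0)" by linarith
    ultimately have "L ! (j0 + nat z) = L ! i" using bot[of "nat z"] z ij by auto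
    then show False using inj[of "j0 + nat z" i] that ij z' \<open>0 \<le> z\<close> by auto
  qed
  show ?thesis
  proof (cases "L ! 0 < L ! (n - 1)")
    case True
    have "sorted_wrt (>) (drop p L @ take p L)"
    proof (unfold sorted_wrt_append, intro conjI ballI)
      show "sorted_wrt (>) (drop p L)" "sorted_wrt (>) (take p L)"
        using k by (auto simp: k_dominant_regular_def)
      fix x y assume "x \<in> set (drop p L)" "y \<in> set (take p L)"
      then obtain i j where "x = L ! (p + j)" "p + j < n" "y = L ! i" "i < p"
        using len by (auto simp: in_set_conv_nth)
      then show "y < x" using le0[of i] gen[of "p + j"] True by simp
    qed
    moreover have "mset (drop p L @ take p L) = mset D"
      using mset by (metis append_take_drop_id mset_append union_commute)
    ultimately have "drop p L @ take p L = D"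
      using D by (intro desc_unique) (auto simp: g_dominant_regular_def)
    then have "L = drop q D @ take q D"
      using len n_def by auto
    then show ?thesis ..
  next
    case False
    \<comment> \<open>Otherwise \<open>L ! i0 \<le> L ! j0\<close>. As \<open>L ! j0\<close> cannot
      lie within the upper string, it exceeds \<open>L ! 0\<close>; as \<open>L ! 0\<close> cannot
      lie within the lower string, it is below \<open>L ! (n - 1)\<close>, the case already
      treated.\<close>
    have "L ! i0 = L ! j0 + 1"
    proof (rule ccontr)
      assume "L ! i0 \<noteq> L ! j0 + 1"
      then have "L ! i0 < L ! j0 + 1" using bound by simp
      then have "L ! i0 \<le> L ! j0"
        using Ints_less_imp_add1_le[of "L ! j0 + 1" "L ! i0"] Ints_add[OF intL[of j0 i0] Ints_1] ij
        by (simp add: algebra_simps)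
      then have "L ! 0 < L ! j0" using not_top[of j0] ij by auto
      then have "L ! 0 < L ! (n - 1)" using not_bot[of 0] ij by auto
      then show False using False by simp
    qed
    note adj = this
    define A where "A = take p' L"
    define R where "R = drop p' (take p L)"
    define U where "U = take u (drop p L)"
    define B where "B = drop u (drop p L)"
    have L: "L = A @ R @ U @ B"
      using p' by (simp add: A_def R_def U_def B_def take_take[symmetric] append_take_drop_id
        del: drop_drop) (metis append.assoc append_take_drop_id min.absorb1 take_take)
    have lens: "length A = p'" "length U = u" "length B = q - u"
      using len p' u by (auto simp: A_def U_def B_def n_def)
    have A: "\<exists>t\<le>i0. x = L ! t" if "x \<in> set A" for x
    proof -
      obtain m where m: "m < length A" "x = A ! m" using \<open>x \<in> set A\<close> by (auto simp: in_set_conv_nth)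
      then show ?thesis using p' len by (intro exI[of _ m]) (auto simp: A_def i0_def)
    qed
    have R: "\<exists>t. i0 < t \<and> t < p \<and> x = L ! t" if "x \<in> set R" for x
    proof -
      obtain m where m: "m < length R" "x = R ! m" using \<open>x \<in> set R\<close> by (auto simp: in_set_conv_nth)
      then show ?thesis using p' len by (intro exI[of _ "p' + m"]) (auto simp: R_def i0_def n_def)
    qed
    have U: "\<exists>t. p \<le> t \<and> t < j0 \<and> x = L ! t" if "x \<in> set U" for x
    proof -
      obtain m where m: "m < length U" "x = U ! m" using \<open>x \<in> set U\<close> by (auto simp: in_set_conv_nth)
      then show ?thesis using u len by (intro exI[of _ "p + m"]) (auto simp: U_def n_def)
    qed
    have B: "\<exists>t. j0 \<le> t \<and> t < n \<and> x = L ! t" if "x \<in> set B" for x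
    proof -
      obtain m where m: "m < length B" "x = B ! m" using \<open>x \<in> set B\<close> by (auto simp: in_set_conv_nth)
      then show ?thesis using u len by (intro exI[of _ "j0 + m"]) (auto simp: B_def n_def ac_simps)
    qed
    have Aval: "L ! i0 \<le> x \<and> x \<le> L ! 0" if "x \<in> set A" for x
    proof -
      obtain t where "t \<le> i0" "x = L ! t" using A[OF \<open>x \<in> set A\<close>] by blast
      then show ?thesis using top[of t] top[of i0] by simp
    qed
    have Bval: "L ! (n - 1) \<le> x \<and> x \<le> L ! j0" if "x \<in> set B" for x
    proof -
      obtain t where "j0 \<le> t" "t < n" "x = L ! t" using B[OF \<open>x \<in> set B\<close>] by blast
      then show ?thesis using gen[of t] bot[of "t - j0"] ij by auto
    qed
    have Uval: "L ! 0 < x" if "x \<in> set U" for x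
    proof -
      obtain t where t: "p \<le> t" "t < j0" "x = L ! t" using U[OF \<open>x \<in> set U\<close>] by blast
      then show ?thesis using gapj[of t] adj not_top[of t] ij by auto
    qed
    have Rval: "x < L ! (n - 1)" if "x \<in> set R" for x
    proof -
      obtain t where t: "i0 < t" "t < p" "x = L ! t" using R[OF \<open>x \<in> set R\<close>] by blast
      then show ?thesis using gapi[of t] adj not_bot[of t] by auto
    qed
    have sortedL: "sorted_wrt (>) (A @ R)" "sorted_wrt (>) (U @ B)"
      using k p' unfolding A_def R_def U_def B_def k_dominant_regular_def
      by (metis append_take_drop_id min.absorb1 take_take, metis append_take_drop_id)
    have n1: "L ! (n - 1) \<le> L ! j0" using gen[of j0] ij by simp
    have i01: "L ! i0 \<le> L ! 0" using le0[of i0] ij by simp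
    have "sorted_wrt (>) (U @ A @ B @ R)"
      unfolding sorted_wrt_append
    proof (intro conjI ballI)
      show "sorted_wrt (>) U" "sorted_wrt (>) A" "sorted_wrt (>) B" "sorted_wrt (>) R"
        using sortedL by (auto simp: sorted_wrt_append)
      show "y < x" if "x \<in> set B" "y \<in> set R" for x y using Bval[OF that(1)] Rval[OF that(2)] by simp
      show "y < x" if "x \<in> set A" "y \<in> set (B @ R)" for x y
        using that Aval[of x] Bval[of y] Rval[of y] n1 adj by auto
      show "y < x" if "x \<in> set U" "y \<in> set (A @ B @ R)" for x y
        using that Uval[of x] Aval[of y] Bval[of y] Rval[of y] n1 adj i01 by auto
    qed
    moreover have "mset (U @ A @ B @ R) = mset D" unfolding mset[symmetric] by (subst L) simp
    ultimately have DL: "D = U @ A @ B @ R"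
      using D by (intro desc_unique[symmetric]) (auto simp: g_dominant_regular_def)
    \<comment> \<open>The cuts are at the lengths of \<open>U\<close>, \<open>U @ A\<close> and
      \<open>U @ A @ B\<close>; the last is \<open>u + p' + (q - u) = p' + q\<close>.\<close>
    have a: "u < q" "q < p' + q" "p' + q \<le> p + q" "u + (p' + q) = q + (u + p')"
      using p' u by auto
    have "string_on D u (p' + q)"
    proof (rule string_onI)
      fix t assume t: "u + t < p' + q"
      have "D ! (u + t) = (U @ ((A @ B) @ R)) ! (length U + t)"
        by (simp add: DL lens)
      also have "\<dots> = ((A @ B) @ R) ! t"
        by (rule nth_append_length_plus)
      also have "\<dots> = (A @ B) ! t"
      proof -
        have "t < length (A @ B)" unfolding length_append lens using t u by linarith
        then show ?thesis by (simp only: nth_append if_True)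
      qed
      also have "\<dots> = L ! 0 - real t"
      proof (cases "t < p'")
        case True
        then show ?thesis using lens top[of t] by (simp add: nth_append) (simp add: A_def i0_def)
      next
        case False
        then obtain t' where t': "t = p' + t'" using le_Suc_ex not_less by blast
        have "(A @ B) ! t = L ! (j0 + t')"
          using t t' lens len u by (simp add: nth_append) (simp add: B_def n_def ac_simps)
        also have "\<dots> = L ! j0 - real t'"
          using t t' u by (intro bot) (auto simp: n_def)
        also have "\<dots> = L ! 0 - real t"
          using adj top[of i0] t' p' by (simp add: i0_def of_nat_diff)
        finally show ?thesis .
      qed
      finally show "D ! (u + t) = L ! 0 - real t" .
    qed
    moreover have "L = interleave D u (u + p') (p' + q)"
      unfolding interleave_def chunk_def DL using lens u by (subst L) simp
    ultimately show ?thesis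
      using a p' by (intro disjI2 exI[of _ u] exI[of _ "u + p'"] exI[of _ "p' + q"]) auto
  qed
qed


section \<open>The converse: unitarity of the interleaved parameters\<close>

lemma interleave_nth:
  assumes D: "length D = n" and abc: "lo \<le> mid" "mid \<le> hi" "hi \<le> n" and p: "p + hi = n + (mid - lo)"
  shows "i < mid - lo \<Longrightarrow> interleave D lo mid hi ! i = D ! (lo + i)"
    and "mid - lo + i < p \<Longrightarrow> interleave D lo mid hi ! (mid - lo + i) = D ! (hi + i)"
    and "j < lo \<Longrightarrow> interleave D lo mid hi ! (p + j) = D ! j"
    and "mid + j < hi \<Longrightarrow> interleave D lo mid hi ! (p + lo + j) = D ! (mid + j)"
    and "length (interleave D lo mid hi) = n"
    and "take p (interleave D lo mid hi) = chunk D lo mid @ drop hi D"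
    and "drop p (interleave D lo mid hi) = take lo D @ chunk D mid hi"
proof -
  have len: "length (chunk D lo mid) = mid - lo" "length (chunk D mid hi) = hi - mid"
    "length (chunk D lo mid @ drop hi D) = p" "length (take lo D) = lo"
    using assms by (auto simp: length_chunk)
  show "take p (interleave D lo mid hi) = chunk D lo mid @ drop hi D"
    "drop p (interleave D lo mid hi) = take lo D @ chunk D mid hi"
    unfolding interleave_def using len(3) by (metis append_eq_conv_conj)+
  show "length (interleave D lo mid hi) = n"
    unfolding interleave_def length_append len using len(3) assms by simp
  show "interleave D lo mid hi ! i = D ! (lo + i)" if "i < mid - lo"
    unfolding interleave_def using that len D abc by (simp add: nth_append nth_chunk)
  have a: "(chunk D lo mid @ drop hi D) ! (mid - lo + i) = D ! (hi + i)" if "mid - lo + i < p"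
    using nth_append_length_plus[of "chunk D lo mid" "drop hi D" i] len D abc by simp
  show "interleave D lo mid hi ! (mid - lo + i) = D ! (hi + i)" if "mid - lo + i < p"
    unfolding interleave_def using that a len(3) by (subst nth_append) auto
  have b: "interleave D lo mid hi ! (p + j) = (take lo D @ chunk D mid hi) ! j" for j
    unfolding interleave_def len(3)[symmetric] by (rule nth_append_length_plus)
  show "interleave D lo mid hi ! (p + j) = D ! j" if "j < lo"
    unfolding b using that len by (subst nth_append) simp
  show "interleave D lo mid hi ! (p + lo + j) = D ! (mid + j)" if "mid + j < hi"
    unfolding add.assoc b
    using nth_append_length_plus[of "take lo D" "chunk D mid hi" j] len D abc that by (simp add: nth_chunk)
qed

lemma mset_interleave:
  assumes "lo \<le> mid" "mid \<le> hi"
  shows "mset (interleave D lo mid hi) = mset D"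
proof -
  have "D = take lo D @ chunk D lo mid @ chunk D mid hi @ drop hi D"
    using chunk_append[OF assms, of D] chunk_append[of 0 lo hi D] assms
    by (simp add: chunk_from_0 append_assoc[symmetric] del: append_assoc)
  then have "mset D = mset (take lo D @ chunk D lo mid @ chunk D mid hi @ drop hi D)" by simp
  then show ?thesis by (simp add: interleave_def)
qed

text \<open>Here \<open>A\<close> and \<open>B\<close> are adjacent pieces of one string, so the
  bound holds with equality. The number that would prolong \<open>A\<close> downwards is the first
  entry of \<open>B\<close>, and the one that would prolong \<open>B\<close> upwards is the last
  entry of \<open>A\<close>; each sits in the other block, which determines \<open>p'\<close> and
  \<open>q'\<close>.\<close>

lemma interleave_unitary:
  assumes lenD: "length D = p + q" and D: "g_dominant_regular D" and int: "integral_param D"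
    and abc: "lo < mid" "mid < hi" "hi \<le> p + q" "lo + hi = q + mid"
    and str: "string_on D lo hi" and L: "L = interleave D lo mid hi"
  shows "L \<in> unitary_conjugates p q D"
    and "p_prime p L = mid - lo" and "q_prime p q L = hi - mid"
    and "coord L (p_prime p L) = D ! (mid - 1)"
    and "coord L (p + q - q_prime p q L + 1) = D ! mid"
proof -
  define n where "n = p + q"
  have sD: "sorted_wrt (>) D" using D by (simp add: g_dominant_regular_def)
  have dec: "D ! j < D ! i" if "i < j" "j < n" for i j
    using sorted_wrt_nth_less[OF sD, of i j] that lenD by (simp add: n_def)
  have pe: "p + hi = n + (mid - lo)" using abc by (simp add: n_def)
  note nths = interleave_nth[of D n lo mid hi p, folded L]
  have args: "length D = n" "lo \<le> mid" "mid \<le> hi" "hi \<le> n" using abc lenD by (auto simp: n_def)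
  note nths = nths[OF args pe]
  have mset: "mset L = mset D" unfolding L using abc by (intro mset_interleave) auto
  have kd: "k_dominant_regular p L"
    unfolding k_dominant_regular_def nths(6,7)
  proof
    have s: "sorted_wrt (>) (chunk D i j)" for i j
      unfolding chunk_def using sD by (intro sorted_wrt_take sorted_wrt_drop)
    have chunk_nth: "\<exists>t. i \<le> t \<and> t < j \<and> x = D ! t" if "x \<in> set (chunk D i j)" "j \<le> n" for x i j
    proof -
      obtain m where "m < length (chunk D i j)" "x = chunk D i j ! m"
        using \<open>x \<in> set _\<close> by (auto simp: in_set_conv_nth)
      then show ?thesis using \<open>j \<le> n\<close> args by (intro exI[of _ "i + m"]) (auto simp: length_chunk nth_chunk)
    qed
    have comb: "sorted_wrt (>) (chunk D i j @ chunk D k l)" if "j \<le> k" "j \<le> n" "l \<le> n" for i j k l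
      unfolding sorted_wrt_append
    proof (intro conjI s ballI)
      fix x y assume "x \<in> set (chunk D i j)" "y \<in> set (chunk D k l)"
      then show "y < x" using chunk_nth[of x i j] chunk_nth[of y k l] that dec by fastforce
    qed
    show "sorted_wrt (>) (chunk D lo mid @ drop hi D)"
      using comb[of mid hi n lo] args by (simp add: chunk_to_length)
    show "sorted_wrt (>) (take lo D @ chunk D mid hi)"
      using comb[of lo mid hi 0] args by (simp add: chunk_from_0)
  qed
  define a where "a = mid - lo"
  have a: "mid = lo + a" "0 < a" "a \<le> p" using abc by (auto simp: a_def)
  define g where "g = hi - mid"
  have g: "hi = mid + g" "0 < g" "g \<le> q" "p + lo + g = n" using abc by (auto simp: g_def n_def)
  have strD: "D ! (lo + t) = D ! lo - real t" if "lo + t < hi" for t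
    using string_on_nth[OF str that] .
  have top: "L ! t = D ! lo - real t" if "t < a" for t
    using nths(1)[of t] strD[of t] that a g by simp
  have bot: "L ! (p + lo + t) = D ! mid - real t" if "t < g" for t
    using nths(4)[of t] strD[of "a + t"] strD[of a] that a g by (simp add: add.assoc)
  have adj: "D ! (mid - 1) = D ! mid + 1"
    using strD[of "a - 1"] strD[of a] a g by (simp add: of_nat_diff)
  show pp: "p_prime p L = mid - lo"
    unfolding a_def[symmetric]
  proof (rule p_prime_eqI)
    show "string_on L 0 a" using top by (intro string_onI[of 0 a L "D ! lo"]) simp
    show "L ! a \<noteq> L ! (a - 1) - 1" if "a < p"
    proof -
      have "L ! a = D ! hi" using nths(2)[of 0] that by (simp add: a_def)
      moreover have "L ! (a - 1) = D ! (mid - 1)" using nths(1)[of "a - 1"] a by simp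
      moreover have "hi < n" using that a g by (simp add: n_def)
      then have "D ! hi < D ! mid" using dec[of mid hi] abc by simp
      ultimately show ?thesis using adj by simp
    qed
  qed (use a in auto)
  show qq: "q_prime p q L = hi - mid"
    unfolding g_def[symmetric]
  proof (rule q_prime_eqI)
    show "1 \<le> g" "g \<le> q" "p + lo + g = p + q" using g by (auto simp: n_def)
    show "string_on L (p + lo) (p + q)"
      using bot g by (intro string_onI[of "p + lo" _ L "D ! mid"]) (simp add: n_def)
    show "L ! (p + lo) \<noteq> L ! (p + lo - 1) - 1" if "g < q"
    proof -
      have al: "0 < lo" using that g by (simp add: n_def)
      then have "L ! (p + lo - 1) = D ! (lo - 1)" using nths(3)[of "lo - 1"] by simp
      moreover have "L ! (p + lo) = D ! mid" using bot[of 0] g by simp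
      moreover have "D ! (mid - 1) < D ! (lo - 1)"
        using al a g by (intro dec) (auto simp: n_def)
      ultimately show ?thesis using adj by simp
    qed
  qed
  show "coord L (p_prime p L) = D ! (mid - 1)"
    unfolding pp coord_def using nths(1)[of "mid - lo - 1"] a by simp
  have "p + q - (hi - mid) = p + lo" using g by (simp add: n_def)
  then show "coord L (p + q - q_prime p q L + 1) = D ! mid"
    unfolding qq coord_def using bot[of 0] g by simp
  have "unitary_param p q L"
  proof (rule unitary_param_of_bound[of _ _ _ "a - 1" "p + lo"])
    show "length L = p + q" using nths(5) by (simp add: n_def)
    show "k_dominant_regular p L" by fact
    show "integral_param L"
      using int mset by (metis integral_param_def mset_eq_setD)
    show "a - 1 < p" "p \<le> p + lo" "p + lo < p + q" using a g by (auto simp: n_def)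
    show "L ! i = L ! 0 - real i" if "i \<le> a - 1" for i
      using top[of i] top[of 0] that a by simp
    show "L ! j = L ! (p + lo) - real (j - (p + lo))" if "p + lo \<le> j" "j < p + q" for j
      using bot[of "j - (p + lo)"] bot[of 0] that g by (simp add: n_def)
    show "L ! (a - 1) - L ! (p + lo) \<le> 1"
      using adj bot[of 0] nths(1)[of "a - 1"] a g by simp
  qed
  then show "L \<in> unitary_conjugates p q D" by (simp add: unitary_conjugates_def mset kd)
qed

text \<open>One-element strings at the two extreme positions suffice: every coordinate of the first
  block is below every one of the second, so the difference in the bound is negative.\<close>

lemma antidominant_unitary:
  assumes p: "1 \<le> p" and q: "1 \<le> q" and lenD: "length D = p + q"
    and D: "g_dominant_regular D" and int: "integral_param D"
  shows "drop q D @ take q D \<in> unitary_conjugates p q D"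
proof -
  let ?L = "drop q D @ take q D"
  have sD: "sorted_wrt (>) D" using D by (simp add: g_dominant_regular_def)
  have mset: "mset ?L = mset D" by (metis append_take_drop_id mset_append union_commute)
  have kd: "k_dominant_regular p ?L"
    using sD lenD by (simp add: k_dominant_regular_def sorted_wrt_take sorted_wrt_drop)
  have "unitary_param p q ?L"
  proof (rule unitary_param_of_bound[of _ _ _ 0 "p + q - 1"])
    show "length ?L = p + q" using lenD by simp
    show "k_dominant_regular p ?L" by fact
    show "integral_param ?L"
      using int mset by (metis integral_param_def mset_eq_setD)
    have "?L ! 0 = D ! q" "?L ! (p + (q - 1)) = D ! (q - 1)"
      using lenD p q nth_append_length_plus[of "drop q D" "take q D" "q - 1"] by (simp_all add: nth_append)
    moreover have "D ! q < D ! (q - 1)"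
      using sorted_wrt_nth_less[OF sD, of "q - 1" q] lenD p q by simp
    ultimately show "?L ! 0 - ?L ! (p + q - 1) \<le> 1" using q by simp
    show "?L ! j = ?L ! (p + q - 1) - real (j - (p + q - 1))" if "p + q - 1 \<le> j" "j < p + q" for j
    proof -
      have "j = p + q - 1" using that by linarith
      then show ?thesis by simp
    qed
  qed (use p q in auto)
  then show ?thesis using mset kd by (simp only: unitary_conjugates_def mem_Collect_eq)
qed

section \<open>Translation into the displayed shapes\<close>

lemma segment_chunk: "j \<le> length D \<Longrightarrow> segment D (Suc i) j = chunk D i j"
  by (rule nth_equalityI) (auto simp: segment_def length_chunk nth_chunk coord_def simp del: upt_Suc)

lemma down_chunk:
  assumes str: "string_on D s (s + r + 1)" and len: "s + r + 1 \<le> length D"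
    and ij: "0 \<le> i" "i \<le> j + 1" "j \<le> int r"
  shows "down (D ! s) i j = chunk D (s + nat i) (s + nat (j + 1))"
proof (rule nth_equalityI)
  have l: "s + nat (j + 1) \<le> length D" using ij len by linarith
  have n: "nat (j - i + 1) = s + nat (j + 1) - (s + nat i)" using ij by linarith
  show "length (down (D ! s) i j) = length (chunk D (s + nat i) (s + nat (j + 1)))"
    using l n by (simp add: down_def length_chunk)
  fix t assume "t < length (down (D ! s) i j)"
  then have t: "t < nat (j - i + 1)" by (simp add: down_def)
  have it: "i + int t \<le> j" using t by linarith
  have "down (D ! s) i j ! t = D ! s - of_int (i + int t)"
    using t it by (simp add: down_def nth_upto)
  also have "\<dots> = D ! s - real (nat i + t)" using ij by simp
  also have "\<dots> = D ! (s + (nat i + t))"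
    using it ij by (intro string_on_nth[OF str, symmetric]) linarith
  also have "\<dots> = chunk D (s + nat i) (s + nat (j + 1)) ! t"
    using l t n by (simp add: nth_chunk add.assoc)
  finally show "down (D ! s) i j ! t = chunk D (s + nat i) (s + nat (j + 1)) ! t" .
qed

text \<open>The string is extended separately to the left and to the right from the positions
  \<open>q - 1\<close> and \<open>q\<close>. The last clause places every string through both
  positions inside it, which makes the list of string conjugates complete.\<close>

lemma maximal_string:
  assumes q: "1 \<le> q" "q < n" and adj: "D ! q = D ! (q - 1) - 1"
  obtains s e where "s < q" "q < e" "e \<le> n" "string_on D s e"
    "0 < s \<Longrightarrow> D ! s \<noteq> D ! (s - 1) - 1" "e < n \<Longrightarrow> D ! e \<noteq> D ! (e - 1) - 1"
    "\<And>i j. string_on D i j \<Longrightarrow> i < q \<Longrightarrow> q < j \<Longrightarrow> j \<le> n \<Longrightarrow> s \<le> i \<and> j \<le> e"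
proof -
  define S where "S = {i. i < q \<and> string_on D i (q + 1)}"
  define T where "T = {j. q < j \<and> j \<le> n \<and> string_on D (q - 1) j}"
  have "string_on D (q - 1) (q + 1)"
    unfolding string_on_def
  proof (intro allI impI)
    fix t assume "q - 1 \<le> t \<and> t + 1 < q + 1"
    then have "t = q - 1" by linarith
    then show "D ! (t + 1) = D ! t - 1" using adj q by simp
  qed
  then have S: "finite S" "q - 1 \<in> S" and T: "finite T" "q + 1 \<in> T"
    unfolding S_def T_def using q by auto
  obtain s where s: "s \<in> S" "\<And>x. x \<in> S \<Longrightarrow> s \<le> x" using Min_in[of S] Min_le[of S] S by blast
  obtain e where e: "e \<in> T" "\<And>x. x \<in> T \<Longrightarrow> x \<le> e" using Max_in[of T] Max_ge[of T] T by blast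
  have se: "string_on D s e"
    unfolding string_on_def
  proof (intro allI impI)
    fix t assume t: "s \<le> t \<and> t + 1 < e"
    show "D ! (t + 1) = D ! t - 1"
      using s(1) e(1) t by (cases "t < q") (auto simp: S_def T_def string_on_def)
  qed
  show ?thesis
  proof (rule that[OF _ _ _ se])
    show "s < q" "q < e" "e \<le> n" using s e by (auto simp: S_def T_def)
    show "D ! s \<noteq> D ! (s - 1) - 1" if "0 < s"
    proof
      assume "D ! s = D ! (s - 1) - 1"
      then have "string_on D (s - 1) (q + 1)"
        unfolding string_on_def
      proof (intro allI impI)
        fix t assume *: "D ! s = D ! (s - 1) - 1" and "s - 1 \<le> t \<and> t + 1 < q + 1"
        then show "D ! (t + 1) = D ! t - 1"
          using s(1) that by (cases "t = s - 1") (auto simp: S_def string_on_def)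
      qed
      then have "s - 1 \<in> S" using s(1) by (auto simp: S_def)
      then show False using s(2)[of "s - 1"] that by simp
    qed
    show "D ! e \<noteq> D ! (e - 1) - 1" if "e < n"
    proof
      assume "D ! e = D ! (e - 1) - 1"
      then have "string_on D (q - 1) (e + 1)"
        unfolding string_on_def
      proof (intro allI impI)
        fix t assume *: "D ! e = D ! (e - 1) - 1" and t: "q - 1 \<le> t \<and> t + 1 < e + 1"
        show "D ! (t + 1) = D ! t - 1"
        proof (cases "t + 1 = e")
          case True
          then show ?thesis using * by auto
        next
          case False
          then show ?thesis using e(1) t by (auto simp: T_def string_on_def)
        qed
      qed
      then have "e + 1 \<in> T" using e(1) that by (auto simp: T_def)
      then show False using e(2)[of "e + 1"] by simp
    qed
    show "s \<le> i \<and> j \<le> e" if "string_on D i j" "i < q" "q < j" "j \<le> n" for i j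
    proof
      have "i \<in> S" using that by (auto simp: S_def string_on_def)
      then show "s \<le> i" by (rule s(2))
      have "j \<in> T" using that by (auto simp: T_def string_on_def)
      then show "j \<le> e" by (rule e(2))
    qed
  qed
qed

text \<open>Here \<open>s\<close> counts from 0, so the theorem's \<open>s\<close> is
  \<open>s + 1\<close>. The cuts come after offsets \<open>a - 1\<close>, \<open>b\<close> and
  \<open>c\<close> of the string, and the formula for \<open>c\<close> says
  \<open>lo + hi = q + mid\<close>, the condition that the second block has \<open>q\<close>
  entries.\<close>

lemma string_conjugate_interleave:
  assumes lenD: "length D = p + q" and str: "string_on D s (s + r + 1)" and sr: "s + r + 1 \<le> p + q"
    and adm: "admissible q (s + 1) r a b c" and sq: "s < q"
  obtains lo mid hi where "lo = s + nat a" "mid = s + nat b + 1" "hi = s + nat c + 1"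
    "lo < mid" "mid < hi" "hi \<le> s + r + 1" "lo + hi = q + mid"
    "string_conjugate p q D (s + 1) r a b c = interleave D lo mid hi"
proof -
  have adm': "0 \<le> a" "a < int q - int s" "a \<le> b" "b - a \<le> int s + int r - int q" "c = b - a - int s + int q"
    using adm by (auto simp: admissible_def)
  \<comment> \<open>Inserting the formula for \<open>c\<close>, the upper bound on \<open>a\<close>
    becomes \<open>b < c\<close> and the upper bound on \<open>b - a\<close> becomes
    \<open>c \<le> r\<close>.\<close>
  have abc: "0 \<le> a" "a \<le> b" "b < c" "c \<le> int r" using adm' by auto
  have n: "nat (a - 1 + 1) = nat a" "nat (b + 1) = nat b + 1" "nat (c + 1) = nat c + 1" "nat (int r + 1) = r + 1"
    using abc by auto
  have cs: "coord D (s + 1) = D ! s" by (simp add: coord_def)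
  note dc = down_chunk[OF str, unfolded lenD, OF sr]
  have 1: "down (D ! s) a b = chunk D (s + nat a) (s + nat b + 1)"
    using dc[of a b] abc n by (simp add: add.assoc)
  have 2: "down (D ! s) (c + 1) (int r) = chunk D (s + nat c + 1) (s + r + 1)"
    using dc[of "c + 1" "int r"] abc n by (simp add: add.assoc)
  have 3: "down (D ! s) 0 (a - 1) = chunk D s (s + nat a)"
    using dc[of 0 "a - 1"] abc n by simp
  have 4: "down (D ! s) (b + 1) c = chunk D (s + nat b + 1) (s + nat c + 1)"
    using dc[of "b + 1" c] abc n by (simp add: add.assoc)
  have 5: "segment D (s + 1 + r + 1) (p + q) = chunk D (s + r + 1) (p + q)"
    using segment_chunk[of "p + q" D "s + r + 1"] lenD by simp
  have 6: "segment D 1 (s + 1 - 1) = chunk D 0 s"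
    using segment_chunk[of s D 0] lenD sq by simp
  have 7: "chunk D (s + nat c + 1) (s + r + 1) @ chunk D (s + r + 1) (p + q) = drop (s + nat c + 1) D"
    using abc sr lenD by (subst chunk_append) (auto simp: chunk_to_length)
  have 8: "chunk D 0 s @ chunk D s (s + nat a) = take (s + nat a) D"
    by (subst chunk_append) (auto simp: chunk_from_0)
  have "string_conjugate p q D (s + 1) r a b c = interleave D (s + nat a) (s + nat b + 1) (s + nat c + 1)"
    unfolding string_conjugate_def cs 1 2 3 4 5 6 interleave_def 7[symmetric] 8[symmetric] by simp
  moreover have "s + nat a < s + nat b + 1" "s + nat b + 1 < s + nat c + 1" "s + nat c + 1 \<le> s + r + 1"
      "s + nat a + (s + nat c + 1) = q + (s + nat b + 1)"
    using abc adm' by linarith+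
  ultimately show ?thesis by (intro that) auto
qed

lemma antidominant_conjugate_eq:
  "length D = p + q \<Longrightarrow> antidominant_conjugate p q D = drop q D @ take q D"
  using segment_chunk[of "p + q" D q] segment_chunk[of q D 0]
  by (simp add: antidominant_conjugate_def chunk_from_0 chunk_to_length)

theorem theorem2p2:
  fixes p q n :: nat and D :: "real list"
  assumes "1 \<le> p" and "p \<le> q" and "n = p + q"
    and "length D = n" and "g_dominant_regular D" and "integral_param D"
  shows
    "(coord D q = coord D (q + 1) + 1 \<longrightarrow>
       (\<exists>s r. 1 \<le> s \<and> s \<le> q \<and> q + 1 - s \<le> r \<and> r \<le> n - s \<and>
          D = segment D 1 (s - 1) @ down (coord D s) 0 (int r) @ segment D (s + r + 1) n \<and>
          (s > 1 \<longrightarrow> coord D (s - 1) \<ge> coord D s + 2) \<and>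
          (n > s + r \<longrightarrow> coord D (s + r + 1) \<le> coord D s - real r - 2) \<and>
          s \<le> q \<and> q \<le> s + r - 1 \<and>
          unitary_conjugates p q D =
            {antidominant_conjugate p q D} \<union>
            {string_conjugate p q D s r a b c | a b c. admissible q s r a b c} \<and>
          (\<forall>a b c \<Lambda>. admissible q s r a b c \<and> \<Lambda> = string_conjugate p q D s r a b c \<longrightarrow>
             coord \<Lambda> (p_prime p \<Lambda>) = coord D s - of_int b \<and>
             coord \<Lambda> (n - q_prime p q \<Lambda> + 1) = coord D s - of_int b - 1 \<and>
             int (p_prime p \<Lambda>) = b - a + 1 \<and>
             int (q_prime p q \<Lambda>) = c - b))) \<and>
     (coord D q \<noteq> coord D (q + 1) + 1 \<longrightarrow>
       unitary_conjugates p q D = {antidominant_conjugate p q D})"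
proof -
  have p: "1 \<le> p" and q: "1 \<le> q" and lenD: "length D = p + q" using assms by auto
  note D = assms(5) and int = assms(6) and n = assms(3)
  have sD: "sorted_wrt (>) D" using D by (simp add: g_dominant_regular_def)
  have dec: "D ! j < D ! i" if "i < j" "j < n" for i j
    using sorted_wrt_nth_less[OF sD, of i j] that lenD n by simp
  have anti: "antidominant_conjugate p q D = drop q D @ take q D"
    using lenD by (rule antidominant_conjugate_eq)
  have anti_in: "antidominant_conjugate p q D \<in> unitary_conjugates p q D"
    unfolding anti using p q lenD D int by (rule antidominant_unitary)
  have shape: "L = antidominant_conjugate p q D \<or> (\<exists>lo mid hi. lo < q \<and> q < hi \<and> lo < mid \<and> mid < hi \<and> hi \<le> p + q \<and>
      lo + hi = q + mid \<and> string_on D lo hi \<and> L = interleave D lo mid hi)" if "L \<in> unitary_conjugates p q D" for L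
    unfolding anti using that p q lenD D int
    by (intro unitary_conjugate_shape) (auto simp: unitary_conjugates_def)
  have adj_iff: "coord D q = coord D (q + 1) + 1 \<longleftrightarrow> D ! q = D ! (q - 1) - 1"
    by (auto simp: coord_def)
  show ?thesis
  proof (intro conjI impI, goal_cases)
    case 2
    then have nadj: "D ! q \<noteq> D ! (q - 1) - 1" using adj_iff by blast
    have "L = antidominant_conjugate p q D" if L: "L \<in> unitary_conjugates p q D" for L
      using shape[OF L]
    proof (elim disjE exE conjE)
      fix lo hi assume "lo < q" "q < hi" "string_on D lo hi"
      \<comment> \<open>A string conjugate needs a string through the positions \<open>q - 1\<close>
        and \<open>q\<close> of \<open>D\<close>, contrary to the gap there.\<close>
      moreover from this have "lo \<le> q - 1 \<and> q - 1 + 1 < hi" by linarith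
      ultimately have "D ! (q - 1 + 1) = D ! (q - 1) - 1" unfolding string_on_def by blast
      then show ?thesis using nadj q by simp
    qed
    then show ?case using anti_in by blast
  next
    case 1
    then have adj: "D ! q = D ! (q - 1) - 1" using adj_iff by blast
    obtain s e where s: "s < q" "q < e" "e \<le> n" "string_on D s e"
      and gaps: "0 < s \<Longrightarrow> D ! s \<noteq> D ! (s - 1) - 1" "e < n \<Longrightarrow> D ! e \<noteq> D ! (e - 1) - 1"
      and max: "\<And>i j. string_on D i j \<Longrightarrow> i < q \<Longrightarrow> q < j \<Longrightarrow> j \<le> n \<Longrightarrow> s \<le> i \<and> j \<le> e"
      using maximal_string[OF q _ adj, of n] p n by auto
    \<comment> \<open>The string fills the positions \<open>s, \<dots>, e - 1\<close>, and
      \<open>r\<close> is the offset of its last entry.\<close>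
    define r where "r = e - s - 1"
    have e: "e = s + r + 1" using s by (simp add: r_def)
    have str: "string_on D s (s + r + 1)" using s e by simp
    have val: "D ! (s + t) = D ! s - real t" if "t \<le> r" for t
      using string_on_nth[OF str, of t] that by simp
    have gap: "D ! j + 2 \<le> D ! i" if "i < j" "j < n" "D ! j \<noteq> D ! i - 1" for i j
    proof -
      have "D ! i - D ! j \<in> \<int>" using int that lenD n by (simp add: integral_param_def)
      then have "D ! j + 1 \<le> D ! i" using dec[OF that(1,2)] by (rule Ints_less_imp_add1_le)
      then have "D ! j + 1 < D ! i" using that(3) by simp
      moreover have "D ! i - (D ! j + 1) \<in> \<int>"
        using Ints_diff[OF \<open>D ! i - D ! j \<in> \<int>\<close> Ints_1] by (simp add: algebra_simps)
      ultimately have "D ! j + 1 + 1 \<le> D ! i" by (intro Ints_less_imp_add1_le)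
      then show ?thesis by simp
    qed
    have cs: "coord D (s + 1) = D ! s" by (simp add: coord_def)
    show ?case
    proof (rule exI[of _ "s + 1"], rule exI[of _ r], intro conjI allI impI)
      show "1 \<le> s + 1" "s + 1 \<le> q" "q + 1 - (s + 1) \<le> r" "r \<le> n - (s + 1)" "s + 1 \<le> q" "q \<le> s + 1 + r - 1"
        using s e by auto
      have "down (D ! s) 0 (int r) = chunk D s (s + r + 1)"
        using down_chunk[OF str, of 0 "int r"] s e lenD n by (simp add: nat_add_distrib)
      moreover have "segment D (s + 1 + r + 1) n = chunk D (s + r + 1) n"
        using segment_chunk[of n D "s + r + 1"] lenD n by simp
      moreover have "segment D 1 (s + 1 - 1) = chunk D 0 s"
        using segment_chunk[of s D 0] lenD s by simp
      moreover have "chunk D 0 s @ chunk D s (s + r + 1) @ chunk D (s + r + 1) n = D"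
        using s e lenD n by (simp add: chunk_append) (simp add: chunk_to_length)
      ultimately show "D = segment D 1 (s + 1 - 1) @ down (coord D (s + 1)) 0 (int r) @ segment D (s + 1 + r + 1) n"
        unfolding cs by simp
      show "coord D (s + 1) + 2 \<le> coord D (s + 1 - 1)" if "1 < s + 1"
        using gap[of "s - 1" s] gaps(1) that s by (simp add: coord_def)
      show "coord D (s + 1 + r + 1) \<le> coord D (s + 1) - real r - 2" if "s + 1 + r < n"
        using gap[of "e - 1" e] gaps(2) that e val[of r] by (simp add: coord_def)
      let ?strings = "{string_conjugate p q D (s + 1) r a b c | a b c. admissible q (s + 1) r a b c}"
      show "unitary_conjugates p q D = {antidominant_conjugate p q D} \<union> ?strings"
      proof (intro equalityI subsetI)
        fix L assume "L \<in> unitary_conjugates p q D"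
        from shape[OF this] show "L \<in> {antidominant_conjugate p q D} \<union> ?strings"
        proof (elim disjE exE conjE)
          fix lo mid hi assume abc: "lo < q" "q < hi" "lo < mid" "mid < hi" "hi \<le> p + q" "lo + hi = q + mid"
            and st: "string_on D lo hi" and L: "L = interleave D lo mid hi"
          have le: "s \<le> lo" "hi \<le> s + r + 1" using max[OF st abc(1,2)] abc n e by auto
          \<comment> \<open>Offsets within the maximal string: \<open>a\<close> and \<open>b\<close>
            belong to the first and last entry of \<open>A\<close>, \<open>c\<close> to the last
            entry of \<open>B\<close>.\<close>
          define a b c where "a = int lo - int s" and "b = int mid - 1 - int s" and "c = int hi - 1 - int s"
          have adm: "admissible q (s + 1) r a b c"
            using abc le by (auto simp: admissible_def a_def b_def c_def)
          obtain "string_conjugate p q D (s + 1) r a b c = interleave D (s + nat a) (s + nat b + 1) (s + nat c + 1)"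
            using string_conjugate_interleave[OF lenD str _ adm s(1)] s e n by metis
          moreover have "s + nat a = lo" "s + nat b + 1 = mid" "s + nat c + 1 = hi"
            using abc le by (auto simp: a_def b_def c_def)
          ultimately show ?thesis using adm L by auto
        qed auto
      next
        fix L assume "L \<in> {antidominant_conjugate p q D} \<union> ?strings"
        then show "L \<in> unitary_conjugates p q D"
        proof
          assume "L \<in> ?strings"
          then obtain a b c where adm: "admissible q (s + 1) r a b c" and L: "L = string_conjugate p q D (s + 1) r a b c"
            by auto
          obtain lo mid hi where abc: "lo = s + nat a" "lo < mid" "mid < hi" "hi \<le> s + r + 1" "lo + hi = q + mid"
            and eq: "string_conjugate p q D (s + 1) r a b c = interleave D lo mid hi"
            using string_conjugate_interleave[OF lenD str _ adm s(1)] s e n by metis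
          have "string_on D lo hi" using str abc by (auto simp: string_on_def)
          then show ?thesis
            unfolding L eq using abc s e n by (intro interleave_unitary(1)[OF lenD D int]) auto
        qed (use anti_in in auto)
      qed
    next
      fix a b c L assume *: "admissible q (s + 1) r a b c \<and> L = string_conjugate p q D (s + 1) r a b c"
      then have adm: "admissible q (s + 1) r a b c" by simp
      have ab: "0 \<le> a" "a \<le> b" "b < c" "c \<le> int r" using adm by (auto simp: admissible_def)
      obtain lo mid hi where abc: "lo = s + nat a" "mid = s + nat b + 1" "hi = s + nat c + 1"
          "lo < mid" "mid < hi" "hi \<le> s + r + 1" "lo + hi = q + mid"
        and "string_conjugate p q D (s + 1) r a b c = interleave D lo mid hi"
        using string_conjugate_interleave[OF lenD str _ adm s(1)] s e n by metis
      then have L: "L = interleave D lo mid hi" using * by simp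
      have st: "string_on D lo hi" using str abc by (auto simp: string_on_def)
      have "hi \<le> p + q" using abc s e n by simp
      note iu = interleave_unitary[OF lenD D int abc(4,5) this abc(7) st L]
      show "coord L (p_prime p L) = coord D (s + 1) - of_int b"
        unfolding iu(4) cs using val[of "nat b"] ab abc by simp
      show "coord L (n - q_prime p q L + 1) = coord D (s + 1) - of_int b - 1"
        unfolding n iu(5) cs using val[of "nat b + 1"] ab abc by simp
      show "int (p_prime p L) = b - a + 1" unfolding iu(2) using ab abc by simp
      show "int (q_prime p q L) = c - b" unfolding iu(3) using ab abc by (simp add: of_nat_diff nat_mono)
    qed
  qed
qed

end
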